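(* Let $G$ be an open non-Archimedean quasi-Polish groupoid (in particular, $G$ may be any open non-Archimedean Polish groupoid). Then there exist a countable (multi-sorted) first-order language $\mathcal L$ and a second-countable étale $\mathcal L$-structure $\mathcal M$ over the space of objects $G^0$ such that there is an isomorphism of topological groupoids $G\cong\mathrm{Iso}_{G^0}(\mathcal M)$ which is the identity on objects.
   Context: Quasi-Polish spaces. Let $\mathbb S=\{0,1\}$ with open sets $\emptyset,\{1\},\{0,1\}$. A set is $\mathbf\Pi^0_2$ if it is of the form $\bigcap_{i\in\mathbb N}(F_i\cup U_i)$ with $F_i$ closed, $U_i$ open. A space is quasi-Polish if it is homeomorphic to a $\mathbf\Pi^0_2$ subspace of $\mathbb S^{\mathbb N}$. Polish spaces are quasi-Polish. Groupoids. A groupoid $G$ is a small category with all morphisms invertible; $G$ also denotes its set of morphisms and $G^0\subseteq G$ its set of objects (identified with unit morphisms); $\sigma,\tau:G\to G^0$ are source and target. A topological groupoid has topologies on $G^0,G$ making source, target, unit, multiplication and inverse continuous; it is open if $\sigma$ is an open map, and (quasi-)Polish if $G^0$ and $G$ are. A subgroupoid is a subset of $G$ closed under inverse and multiplication. $G$ is non-Archimedean if every $x\in G^0$ has a neighborhood basis in $G$ consisting of open subgroupoids. Étale spaces and structures. Let $X$ be a topological space. For maps $p:A\to X$, $q:B\to X$: $A_x=p^{-1}(x)$, $A\times_XB=\{(a,b):p(a)=q(b)\}$ with the subspace topology; a map $f:A\to B$ is over $X$ if $q\circ f=p$. The empty fiber product is $X$. An étale space over $X$ is a topological space $A$ with a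 continuous $p:A\to X$ such that $A$ is covered by open sections, i.e., open sets $S\subseteq A$ for which $p|S:S\to X$ is an open embedding. A multi-sorted first-order language $\mathcal L$ has sorts, relation symbols with arities finite tuples of sorts, and function symbols with arities finite tuples of sorts and a value sort. An étale $\mathcal L$-structure $\mathcal M$ over $X$ consists of an étale space $P^{\mathcal M}$ over $X$ for each sort $P$; an open $R^{\mathcal M}\subseteq P_0^{\mathcal M}\times_X\cdots\times_XP_{n-1}^{\mathcal M}$ for each $(P_0,\dots,P_{n-1})$-ary relation symbol $R$; and a continuous map $f^{\mathcal M}:P_0^{\mathcal M}\times_X\cdots\times_XP_{n-1}^{\mathcal M}\to Q^{\mathcal M}$ over $X$ for each $(P_0,\dots,P_{n-1})$-ary $Q$-valued function symbol $f$. The fibers over $x\in X$ form an ordinary $\mathcal L$-structure $\mathcal M_x$. $\mathcal M$ is second-countable if $\mathcal L$ is countable and $X$ and all $P^{\mathcal M}$ are second-countable. Isomorphism groupoid. $\mathrm{Iso}_X(\mathcal M)$ has object space $X$, and morphisms $x\to y$ are triples $(x,y,f)$ with $f=(f_P)_P$ an $\mathcal L$-isomorphism $\mathcal M_x\cong\mathcal M_y$, composed as usual; its set of morphisms has the topology generated by continuity of $\sigma,\tau$ (source and target) together with the sets $\{(x,y,f): f_P(S_x)\cap T_y\neq\emptyset\}$ for sorts $P$ and open $S,T\subseteq P^{\mathcal M}$, where $S_x=S\cap P^{\mathcal M}_x$. *)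

theory Defs
  imports "HOL-Analysis.Analysis"
begin

section \<open>Polish and quasi-Polish spaces\<close>

definition sierpinski :: "bool topology" where
  "sierpinski = topology (\<lambda>U. U \<in> {{}, {True}, UNIV})"

lemma openin_sierpinski: "openin sierpinski U \<longleftrightarrow> U \<in> {{}, {True}, UNIV}"
proof -
  have "istopology (\<lambda>U::bool set. U \<in> {{}, {True}, UNIV})"
    unfolding istopology_def
  proof (intro conjI allI impI)
    fix K :: "bool set set"
    assume K: "\<forall>S\<in>K. S \<in> {{}, {True}, UNIV}"
    show "\<Union>K \<in> {{}, {True}, UNIV}"
    proof (cases "UNIV \<in> K")
      case True
      then show ?thesis by auto
    next
      case False
      then have "\<Union>K \<subseteq> {True}" using K by blast
      then show ?thesis by blast
    qed
  qed auto
  then show ?thesis by (simp add: sierpinski_def)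
qed

definition Pi02_in :: "'a topology \<Rightarrow> 'a set \<Rightarrow> bool" where
  "Pi02_in X A \<longleftrightarrow>
     (\<exists>F U. (\<forall>i::nat. closedin X (F i) \<and> openin X (U i)) \<and> A = (\<Inter>i. F i \<union> U i))"

definition quasi_Polish_space :: "'a topology \<Rightarrow> bool" where
  "quasi_Polish_space X \<longleftrightarrow>
     (\<exists>A. Pi02_in (product_topology (\<lambda>_::nat. sierpinski) UNIV) A \<and>
          X homeomorphic_space subtopology (product_topology (\<lambda>_::nat. sierpinski) UNIV) A)"

definition Polish_space :: "'a topology \<Rightarrow> bool" where
  "Polish_space X \<longleftrightarrow> completely_metrizable_space X \<and> separable_space X"


section \<open>Topological groupoids\<close>

text \<open>Objects and morphisms have separate types, and \<open>unit_of\<close> identifies an object with its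
  unit morphism.  The underlying sets are the \<open>topspace\<close>s of the two topologies.  A product
  \<open>comp G g h\<close> is meaningful when the source of \<open>g\<close> is the target of \<open>h\<close>;
  operations are unconstrained outside their domains.\<close>

record ('o, 'm) groupoid =
  Obj :: "'o topology"
  Mor :: "'m topology"
  src :: "'m \<Rightarrow> 'o"
  tgt :: "'m \<Rightarrow> 'o"
  unit_of :: "'o \<Rightarrow> 'm"
  comp :: "'m \<Rightarrow> 'm \<Rightarrow> 'm"
  inverse_of :: "'m \<Rightarrow> 'm"

definition composable :: "('o, 'm) groupoid \<Rightarrow> ('m \<times> 'm) set" where
  "composable G =
     {(g, h). g \<in> topspace (Mor G) \<and> h \<in> topspace (Mor G) \<and> src G g = tgt G h}"

locale groupoid =
  fixes G :: "('o, 'm) groupoid"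
  assumes src_closed: "g \<in> topspace (Mor G) \<Longrightarrow> src G g \<in> topspace (Obj G)"
    and tgt_closed: "g \<in> topspace (Mor G) \<Longrightarrow> tgt G g \<in> topspace (Obj G)"
    and unit_closed: "x \<in> topspace (Obj G) \<Longrightarrow> unit_of G x \<in> topspace (Mor G)"
    and comp_closed: "(g, h) \<in> composable G \<Longrightarrow> comp G g h \<in> topspace (Mor G)"
    and inverse_closed: "g \<in> topspace (Mor G) \<Longrightarrow> inverse_of G g \<in> topspace (Mor G)"
    and src_unit: "x \<in> topspace (Obj G) \<Longrightarrow> src G (unit_of G x) = x"
    and tgt_unit: "x \<in> topspace (Obj G) \<Longrightarrow> tgt G (unit_of G x) = x"
    and src_comp: "(g, h) \<in> composable G \<Longrightarrow> src G (comp G g h) = src G h"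
    and tgt_comp: "(g, h) \<in> composable G \<Longrightarrow> tgt G (comp G g h) = tgt G g"
    and comp_assoc: "(g, h) \<in> composable G \<Longrightarrow> (h, k) \<in> composable G \<Longrightarrow>
          comp G (comp G g h) k = comp G g (comp G h k)"
    and unit_left: "g \<in> topspace (Mor G) \<Longrightarrow> comp G (unit_of G (tgt G g)) g = g"
    and unit_right: "g \<in> topspace (Mor G) \<Longrightarrow> comp G g (unit_of G (src G g)) = g"
    and src_inverse: "g \<in> topspace (Mor G) \<Longrightarrow> src G (inverse_of G g) = tgt G g"
    and tgt_inverse: "g \<in> topspace (Mor G) \<Longrightarrow> tgt G (inverse_of G g) = src G g"
    and inverse_left:
      "g \<in> topspace (Mor G) \<Longrightarrow> comp G (inverse_of G g) g = unit_of G (src G g)"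
    and inverse_right:
      "g \<in> topspace (Mor G) \<Longrightarrow> comp G g (inverse_of G g) = unit_of G (tgt G g)"

locale topological_groupoid = groupoid G
  for G :: "('o, 'm) groupoid" +
  assumes continuous_src: "continuous_map (Mor G) (Obj G) (src G)"
    and continuous_tgt: "continuous_map (Mor G) (Obj G) (tgt G)"
    and continuous_unit: "continuous_map (Obj G) (Mor G) (unit_of G)"
    and continuous_comp:
      "continuous_map (subtopology (prod_topology (Mor G) (Mor G)) (composable G)) (Mor G)
         (\<lambda>(g, h). comp G g h)"
    and continuous_inverse: "continuous_map (Mor G) (Mor G) (inverse_of G)"

definition open_groupoid :: "('o, 'm) groupoid \<Rightarrow> bool" where
  "open_groupoid G \<longleftrightarrow> open_map (Mor G) (Obj G) (src G)"

definition quasi_Polish_groupoid :: "('o, 'm) groupoid \<Rightarrow> bool" where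
  "quasi_Polish_groupoid G \<longleftrightarrow> quasi_Polish_space (Obj G) \<and> quasi_Polish_space (Mor G)"

definition Polish_groupoid :: "('o, 'm) groupoid \<Rightarrow> bool" where
  "Polish_groupoid G \<longleftrightarrow> Polish_space (Obj G) \<and> Polish_space (Mor G)"

definition subgroupoid :: "('o, 'm) groupoid \<Rightarrow> 'm set \<Rightarrow> bool" where
  "subgroupoid G U \<longleftrightarrow> U \<subseteq> topspace (Mor G) \<and>
     (\<forall>g\<in>U. inverse_of G g \<in> U) \<and>
     (\<forall>g\<in>U. \<forall>h\<in>U. src G g = tgt G h \<longrightarrow> comp G g h \<in> U)"

definition non_Archimedean :: "('o, 'm) groupoid \<Rightarrow> bool" where
  "non_Archimedean G \<longleftrightarrow>
     (\<forall>x\<in>topspace (Obj G). \<forall>V. openin (Mor G) V \<and> unit_of G x \<in> V \<longrightarrow>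
        (\<exists>U. openin (Mor G) U \<and> subgroupoid G U \<and> unit_of G x \<in> U \<and> U \<subseteq> V))"

definition topological_groupoid_isomorphism ::
  "('o, 'm) groupoid \<Rightarrow> ('p, 'n) groupoid \<Rightarrow> ('o \<Rightarrow> 'p) \<Rightarrow> ('m \<Rightarrow> 'n) \<Rightarrow> bool" where
  "topological_groupoid_isomorphism G H \<phi> \<Phi> \<longleftrightarrow>
     homeomorphic_map (Obj G) (Obj H) \<phi> \<and>
     homeomorphic_map (Mor G) (Mor H) \<Phi> \<and>
     (\<forall>g\<in>topspace (Mor G). src H (\<Phi> g) = \<phi> (src G g)) \<and>
     (\<forall>g\<in>topspace (Mor G). tgt H (\<Phi> g) = \<phi> (tgt G g)) \<and>
     (\<forall>x\<in>topspace (Obj G). \<Phi> (unit_of G x) = unit_of H (\<phi> x)) \<and>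
     (\<forall>(g, h)\<in>composable G. \<Phi> (comp G g h) = comp H (\<Phi> g) (\<Phi> h)) \<and>
     (\<forall>g\<in>topspace (Mor G). \<Phi> (inverse_of G g) = inverse_of H (\<Phi> g))"


section \<open>Multi-sorted languages and structures\<close>

record ('s, 'r, 'f) language =
  sorts :: "'s set"
  rel_symbols :: "'r set"
  fun_symbols :: "'f set"
  rel_arity :: "'r \<Rightarrow> 's list"
  fun_arity :: "'f \<Rightarrow> 's list"
  fun_value :: "'f \<Rightarrow> 's"

definition language :: "('s, 'r, 'f) language \<Rightarrow> bool" where
  "language L \<longleftrightarrow>
     (\<forall>R\<in>rel_symbols L. set (rel_arity L R) \<subseteq> sorts L) \<and>
     (\<forall>f\<in>fun_symbols L. set (fun_arity L f) \<subseteq> sorts L \<and> fun_value L f \<in> sorts L)"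

definition countable_language :: "('s, 'r, 'f) language \<Rightarrow> bool" where
  "countable_language L \<longleftrightarrow>
     countable (sorts L) \<and> countable (rel_symbols L) \<and> countable (fun_symbols L)"

text \<open>Throughout, an \<open>n\<close>-tuple is an extensional function on \<open>{..<n}\<close>.\<close>

record ('s, 'r, 'f, 'a) struct =
  universe :: "'s \<Rightarrow> 'a set"
  rel_interp :: "'r \<Rightarrow> (nat \<Rightarrow> 'a) set"
  fun_interp :: "'f \<Rightarrow> (nat \<Rightarrow> 'a) \<Rightarrow> 'a"

definition tuples :: "('s, 'r, 'f, 'a) struct \<Rightarrow> 's list \<Rightarrow> (nat \<Rightarrow> 'a) set" where
  "tuples A Ps = (\<Pi>\<^sub>E i\<in>{..<length Ps}. universe A (Ps ! i))"

definition map_tuple :: "('s \<Rightarrow> 'a \<Rightarrow> 'b) \<Rightarrow> 's list \<Rightarrow> (nat \<Rightarrow> 'a) \<Rightarrow> nat \<Rightarrow> 'b" where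
  "map_tuple h Ps a = (\<lambda>i\<in>{..<length Ps}. h (Ps ! i) (a i))"

text \<open>An isomorphism is a family of bijections indexed by the sorts; membership in \<open>\<Pi>\<^sub>E\<close> makes
  it a unique HOL function, with no spurious values outside the sorts and the universes.\<close>

definition isomorphisms ::
  "('s, 'r, 'f) language \<Rightarrow> ('s, 'r, 'f, 'a) struct \<Rightarrow> ('s, 'r, 'f, 'b) struct \<Rightarrow>
     ('s \<Rightarrow> 'a \<Rightarrow> 'b) set" where
  "isomorphisms L A B =
     {h \<in> (\<Pi>\<^sub>E P\<in>sorts L. universe A P \<rightarrow>\<^sub>E universe B P).
        (\<forall>P\<in>sorts L. bij_betw (h P) (universe A P) (universe B P)) \<and>
        (\<forall>R\<in>rel_symbols L. \<forall>a\<in>tuples A (rel_arity L R).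
           a \<in> rel_interp A R \<longleftrightarrow> map_tuple h (rel_arity L R) a \<in> rel_interp B R) \<and>
        (\<forall>f\<in>fun_symbols L. \<forall>a\<in>tuples A (fun_arity L f).
           h (fun_value L f) (fun_interp A f a) =
           fun_interp B f (map_tuple h (fun_arity L f) a))}"


section \<open>Etale spaces and etale structures\<close>

definition etale_space :: "'x topology \<Rightarrow> 'a topology \<Rightarrow> ('a \<Rightarrow> 'x) \<Rightarrow> bool" where
  "etale_space X A p \<longleftrightarrow> continuous_map A X p \<and>
     (\<forall>a\<in>topspace A. \<exists>S. openin A S \<and> a \<in> S \<and>
        embedding_map (subtopology A S) X p \<and> open_map (subtopology A S) X p)"

text \<open>A point of the fiber product of \<open>A 0, \<dots>, A (n - 1)\<close> over \<open>X\<close> is recorded together with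
  its base point.  For \<open>n > 0\<close> the base point is a continuous function of the tuple, so this is
  the usual subspace of the product; for \<open>n = 0\<close> it gives (a copy of) \<open>X\<close>.\<close>

definition fiber_product ::
  "'x topology \<Rightarrow> (nat \<Rightarrow> 'a topology) \<Rightarrow> (nat \<Rightarrow> 'a \<Rightarrow> 'x) \<Rightarrow> nat \<Rightarrow> ('x \<times> (nat \<Rightarrow> 'a)) topology"
  where
  "fiber_product X A p n =
     subtopology (prod_topology X (product_topology A {..<n})) {(x, a). \<forall>i<n. p i (a i) = x}"

record ('s, 'r, 'f, 'x, 'a) etale_struct =
  sort_space :: "'s \<Rightarrow> 'a topology"
  sort_proj :: "'s \<Rightarrow> 'a \<Rightarrow> 'x"
  rel_set :: "'r \<Rightarrow> ('x \<times> (nat \<Rightarrow> 'a)) set"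
  fun_map :: "'f \<Rightarrow> 'x \<times> (nat \<Rightarrow> 'a) \<Rightarrow> 'a"

definition sort_product ::
  "'x topology \<Rightarrow> ('s, 'r, 'f, 'x, 'a) etale_struct \<Rightarrow> 's list \<Rightarrow> ('x \<times> (nat \<Rightarrow> 'a)) topology" where
  "sort_product X M Ps =
     fiber_product X (\<lambda>i. sort_space M (Ps ! i)) (\<lambda>i. sort_proj M (Ps ! i)) (length Ps)"

definition etale_structure ::
  "'x topology \<Rightarrow> ('s, 'r, 'f) language \<Rightarrow> ('s, 'r, 'f, 'x, 'a) etale_struct \<Rightarrow> bool" where
  "etale_structure X L M \<longleftrightarrow> language L \<and>
     (\<forall>P\<in>sorts L. etale_space X (sort_space M P) (sort_proj M P)) \<and>
     (\<forall>R\<in>rel_symbols L. openin (sort_product X M (rel_arity L R)) (rel_set M R)) \<and>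
     (\<forall>f\<in>fun_symbols L.
        continuous_map (sort_product X M (fun_arity L f)) (sort_space M (fun_value L f))
          (fun_map M f) \<and>
        (\<forall>(x, a)\<in>topspace (sort_product X M (fun_arity L f)).
           sort_proj M (fun_value L f) (fun_map M f (x, a)) = x))"

definition second_countable_structure ::
  "'x topology \<Rightarrow> ('s, 'r, 'f) language \<Rightarrow> ('s, 'r, 'f, 'x, 'a) etale_struct \<Rightarrow> bool" where
  "second_countable_structure X L M \<longleftrightarrow> countable_language L \<and> second_countable X \<and>
     (\<forall>P\<in>sorts L. second_countable (sort_space M P))"

definition fiber :: "('s, 'r, 'f, 'x, 'a) etale_struct \<Rightarrow> 'x \<Rightarrow> ('s, 'r, 'f, 'a) struct" where
  "fiber M x =
     \<lparr>universe = (\<lambda>P. {a \<in> topspace (sort_space M P). sort_proj M P a = x}),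
      rel_interp = (\<lambda>R. {a. (x, a) \<in> rel_set M R}),
      fun_interp = (\<lambda>f a. fun_map M f (x, a))\<rparr>"


section \<open>The isomorphism groupoid\<close>

definition Iso_morphisms ::
  "'x topology \<Rightarrow> ('s, 'r, 'f) language \<Rightarrow> ('s, 'r, 'f, 'x, 'a) etale_struct \<Rightarrow>
     ('x \<times> 'x \<times> ('s \<Rightarrow> 'a \<Rightarrow> 'a)) set" where
  "Iso_morphisms X L M =
     {(x, y, h). x \<in> topspace X \<and> y \<in> topspace X \<and> h \<in> isomorphisms L (fiber M x) (fiber M y)}"

definition Iso_topology ::
  "'x topology \<Rightarrow> ('s, 'r, 'f) language \<Rightarrow> ('s, 'r, 'f, 'x, 'a) etale_struct \<Rightarrow>
     ('x \<times> 'x \<times> ('s \<Rightarrow> 'a \<Rightarrow> 'a)) topology" where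
  "Iso_topology X L M = topology_generated_by
     ({{(x, y, h) \<in> Iso_morphisms X L M. x \<in> U} | U. openin X U} \<union>
      {{(x, y, h) \<in> Iso_morphisms X L M. y \<in> U} | U. openin X U} \<union>
      {{(x, y, h) \<in> Iso_morphisms X L M.
          h P ` (S \<inter> universe (fiber M x) P) \<inter> (T \<inter> universe (fiber M y) P) \<noteq> {}} | P S T.
        P \<in> sorts L \<and> openin (sort_space M P) S \<and> openin (sort_space M P) T})"

lemma topspace_Iso_topology: "topspace (Iso_topology X L M) = Iso_morphisms X L M"
  unfolding Iso_topology_def topology_generated_by_topspace
proof (rule subset_antisym)
  show "Iso_morphisms X L M \<subseteq> \<Union> ({{(x, y, h) \<in> Iso_morphisms X L M. x \<in> U} | U. openin X U} \<union>
      {{(x, y, h) \<in> Iso_morphisms X L M. y \<in> U} | U. openin X U} \<union>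
      {{(x, y, h) \<in> Iso_morphisms X L M.
          h P ` (S \<inter> universe (fiber M x) P) \<inter> (T \<inter> universe (fiber M y) P) \<noteq> {}} | P S T.
        P \<in> sorts L \<and> openin (sort_space M P) S \<and> openin (sort_space M P) T})"
    (is "_ \<subseteq> \<Union> (?A \<union> ?B \<union> ?C)")
  proof -
    have "Iso_morphisms X L M = {(x, y, h) \<in> Iso_morphisms X L M. x \<in> topspace X}"
      by (auto simp: Iso_morphisms_def)
    then have "Iso_morphisms X L M \<in> ?A"
      using openin_topspace[of X] by (intro CollectI exI[of _ "topspace X"] conjI)
    then show ?thesis by (intro Union_upper UnI1)
  qed
qed (rule Union_least, elim UnE CollectE exE conjE, simp_all, auto)

definition Iso ::
  "'x topology \<Rightarrow> ('s, 'r, 'f) language \<Rightarrow> ('s, 'r, 'f, 'x, 'a) etale_struct \<Rightarrow>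
     ('x, 'x \<times> 'x \<times> ('s \<Rightarrow> 'a \<Rightarrow> 'a)) groupoid" where
  "Iso X L M =
     \<lparr>Obj = X,
      Mor = Iso_topology X L M,
      src = (\<lambda>(x, y, h). x),
      tgt = (\<lambda>(x, y, h). y),
      unit_of = (\<lambda>x. (x, x, \<lambda>P\<in>sorts L. \<lambda>a\<in>universe (fiber M x) P. a)),
      comp = (\<lambda>(y, z, k) (x, w, h).
        (x, z, \<lambda>P\<in>sorts L. \<lambda>a\<in>universe (fiber M x) P. k P (h P a))),
      inverse_of = (\<lambda>(x, y, h).
        (y, x, \<lambda>P\<in>sorts L. \<lambda>b\<in>universe (fiber M y) P.
           inv_into (universe (fiber M x) P) (h P) b))\<rparr>"

end

theory Submission
  imports Defs
begin

text \<open>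
  Let \<open>\<U>\<close> be a countable family of open subgroupoids that contains a neighbourhood basis of every
  unit.  For \<open>U \<in> \<U>\<close> the left cosets \<open>g U\<close>, placed over the target of \<open>g\<close>, form an
  etale space over the objects: products of open sets are open because the source map is open
  (\<open>openin_product_set\<close>), so the quotient map is open, and two arrows with common target that are
  close to each other lie in the same coset (\<open>etale_coset_space\<close>).  The groupoid acts on these
  spaces by left translation.  The structure has one sort for each coset space and, for
  \<open>U, V \<in> \<U>\<close> and \<open>B\<close> in a countable base of the arrows, the binary relation that holds of
  \<open>g U\<close> and \<open>g b V\<close> for all \<open>g\<close> and all \<open>b \<in> B\<close>.  It is open and invariant, so
  every arrow acts as an isomorphism of fibres.  The subbasic sets of the isomorphism groupoid pull
  back to products of open sets, and products \<open>W U\<close> with \<open>W\<close> open form a base; hence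
  translation is an embedding.

  It remains to see that every isomorphism \<open>f\<close> from the fibre over \<open>x\<close> to the fibre over \<open>y\<close>
  is translation by an arrow (\<open>induced_by_translation\<close>).  Such an arrow would lie in all cosets
  \<open>f (1 U)\<close>, where \<open>1\<close> is the unit at \<open>x\<close>, but it is not clear that they have a common
  element.  As in the proof that a Polish group is complete in its two-sided uniformity, a Baire
  category argument helps: one finds arrows \<open>h\<close> into \<open>x\<close> and \<open>k\<close> into \<open>y\<close>, with the
  same source, such that \<open>f (h U) = k U\<close> for all \<open>U \<in> \<U>\<close> containing the unit at that source.
  The relations then force \<open>f\<close> to be translation by \<open>k\<close> times the inverse of \<open>h\<close>.

  The arrows \<open>h\<close> and \<open>k\<close> are limits of two descending sequences of basic open sets that are
  built simultaneously (\<open>generic_pair\<close>).  A pair of open sets is admissible if it contains a pair of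
  cosets that correspond under \<open>f\<close>.  Either set of an admissible pair can be shrunk around the
  coset it contains, for \<open>f\<close> maps subcosets to subcosets (\<open>refine_match\<close>); so countably many
  requirements can be met.  Completeness enters through the notion \<open>countably_Choquet\<close>, which
  Polish and quasi-Polish spaces share: finitely described tasks, countably many in all, ensure that a
  descending sequence of basic open sets is a neighbourhood basis of a point.  As points need not be
  closed, it is the \<open>T\<^sub>0\<close> axiom that identifies the targets of the limits with \<open>x\<close>
  and \<open>y\<close> and their sources with each other.
\<close>

section \<open>Completeness as convergence of descending sequences\<close>

definition base_of :: "'a topology \<Rightarrow> 'a set set \<Rightarrow> bool" where
  "base_of X \<B> \<longleftrightarrow> (\<forall>B\<in>\<B>. openin X B) \<and>
     (\<forall>V x. openin X V \<and> x \<in> V \<longrightarrow> (\<exists>B\<in>\<B>. x \<in> B \<and> B \<subseteq> V))"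

text \<open>The only form of completeness that the proof uses, and a common consequence of both kinds of
  Polishness.  It says that, in the strong Choquet game with moves in \<open>\<B>\<close>, a descending
  sequence converges as soon as it meets countably many tasks: whenever it enters \<open>W\<close>, it later
  enters a member of the cover \<open>\<C>\<close> of \<open>W\<close>.  Convergence is meant in the strong sense
  that the sequence is a neighbourhood basis of its limit, so that in a \<open>T\<^sub>0\<close> space the limit is
  unique.  Recording the tasks as data lets them be interleaved with other countable families of tasks.\<close>

definition countably_Choquet :: "'a topology \<Rightarrow> bool" where
  "countably_Choquet X \<longleftrightarrow>
     (\<exists>\<B> \<W>. countable \<B> \<and> base_of X \<B> \<and> countable \<W> \<and>
        (\<forall>(W, \<C>)\<in>\<W>. W \<subseteq> \<Union>\<C> \<and> (\<forall>C\<in>\<C>. openin X C)) \<and>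
        (\<forall>H :: nat \<Rightarrow> 'a set. decseq H \<and> (\<forall>n. H n \<in> \<B> \<and> H n \<noteq> {}) \<and>
           (\<forall>(W, \<C>)\<in>\<W>. (\<exists>n. H n \<subseteq> W) \<longrightarrow> (\<exists>n. \<exists>C\<in>\<C>. H n \<subseteq> C)) \<longrightarrow>
           (\<exists>x. (\<forall>n. x \<in> H n) \<and> (\<forall>V. openin X V \<and> x \<in> V \<longrightarrow> (\<exists>n. H n \<subseteq> V)))))"

lemma countably_ChoquetI:
  assumes "countable \<B>" "base_of X \<B>" "countable \<W>"
    and "\<forall>(W, \<C>)\<in>\<W>. W \<subseteq> \<Union>\<C> \<and> (\<forall>C\<in>\<C>. openin X C)"
    and conv: "\<And>H :: nat \<Rightarrow> 'a set. decseq H \<Longrightarrow> (\<And>n. H n \<in> \<B>) \<Longrightarrow> (\<And>n. H n \<noteq> {}) \<Longrightarrow>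
      (\<And>W \<C>. (W, \<C>) \<in> \<W> \<Longrightarrow> \<exists>n. H n \<subseteq> W \<Longrightarrow> \<exists>n. \<exists>C\<in>\<C>. H n \<subseteq> C) \<Longrightarrow>
      \<exists>x. (\<forall>n. x \<in> H n) \<and> (\<forall>V. openin X V \<and> x \<in> V \<longrightarrow> (\<exists>n. H n \<subseteq> V))"
  shows "countably_Choquet X"
  unfolding countably_Choquet_def
proof (rule exI[of _ \<B>], rule exI[of _ \<W>], intro conjI assms(1-4) allI impI, elim conjE)
  fix H :: "nat \<Rightarrow> 'a set"
  assume H: "decseq H" "\<forall>n. H n \<in> \<B> \<and> H n \<noteq> {}"
    "\<forall>(W, \<C>)\<in>\<W>. (\<exists>n. H n \<subseteq> W) \<longrightarrow> (\<exists>n. \<exists>C\<in>\<C>. H n \<subseteq> C)"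
  show "\<exists>x. (\<forall>n. x \<in> H n) \<and> (\<forall>V. openin X V \<and> x \<in> V \<longrightarrow> (\<exists>n. H n \<subseteq> V))"
  proof (rule conv)
    show "\<exists>n. \<exists>C\<in>\<C>. H n \<subseteq> C" if "(W, \<C>) \<in> \<W>" "\<exists>n. H n \<subseteq> W" for W \<C>
      using bspec[OF H(3) that(1)] that(2) by simp
  qed (use H(1,2) in simp_all)
qed

lemma decseq_eventually_subset_finite:
  fixes H :: "nat \<Rightarrow> 'a set"
  assumes "decseq H" "finite a" "\<And>m. m \<in> a \<Longrightarrow> \<exists>n. H n \<subseteq> D m"
  shows "\<exists>n. \<forall>m\<in>a. H n \<subseteq> D m"
  using assms(2,3)
proof (induction a)
  case (insert m a)
  obtain i where "H i \<subseteq> D m" using insert.prems by blast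
  moreover obtain j where "\<forall>m\<in>a. H j \<subseteq> D m" using insert by blast
  moreover have "H (max i j) \<subseteq> H i" "H (max i j) \<subseteq> H j"
    using assms(1) by (simp_all add: decseq_def)
  ultimately show ?case by (intro exI[of _ "max i j"]) blast
qed auto

text \<open>A point of the product is a subset of \<open>\<nat>\<close>, and the only nontrivial open condition on a
  coordinate is membership; so the basic open sets ask for finitely many members.\<close>

lemma openin_product_sierpinski:
  "openin (product_topology (\<lambda>_::nat. sierpinski) UNIV) V \<longleftrightarrow>
     (\<forall>s\<in>V. \<exists>a. finite a \<and> (\<forall>m\<in>a. s m) \<and> {t. \<forall>m\<in>a. t m} \<subseteq> V)" (is "openin ?P V \<longleftrightarrow> ?R")
proof
  assume V: "openin ?P V"
  show ?R
  proof
    fix s assume "s \<in> V"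
    then obtain Z where Z: "s \<in> (\<Pi>\<^sub>E i\<in>UNIV. Z i)" "\<And>i. openin sierpinski (Z i)"
        "finite {i. Z i \<noteq> topspace sierpinski}" "(\<Pi>\<^sub>E i\<in>UNIV. Z i) \<subseteq> V"
      using product_topology_open_contains_basis[OF V] by meson
    define a where "a = {i. Z i \<noteq> topspace sierpinski}"
    have top: "topspace sierpinski = UNIV"
      by (metis openin_sierpinski openin_subset top.extremum_unique insertCI)
    have Zi: "Z i = {True}" if "i \<in> a" for i
      using Z(1,2) that by (auto simp: openin_sierpinski a_def top PiE_def)
    have "s m" if "m \<in> a" for m
      using Z(1) Zi[OF that] by (auto simp: PiE_def Pi_def)
    moreover have "{t. \<forall>m\<in>a. t m} \<subseteq> V"
    proof -
      have "t \<in> (\<Pi>\<^sub>E i\<in>UNIV. Z i)" if t: "\<forall>m\<in>a. t m" for t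
      proof -
        have "t i \<in> Z i" for i
        proof (cases "i \<in> a")
          case True
          then show ?thesis using t Zi by simp
        next
          case False
          then have "Z i = UNIV" unfolding a_def top by blast
          then show ?thesis by simp
        qed
        then show ?thesis by auto
      qed
      then show ?thesis using Z(4) by blast
    qed
    ultimately show "\<exists>a. finite a \<and> (\<forall>m\<in>a. s m) \<and> {t. \<forall>m\<in>a. t m} \<subseteq> V"
      using Z(3) a_def by blast
  qed
next
  assume R: ?R
  have N: "openin ?P {t. \<forall>m\<in>a. t m}" if "finite a" for a
  proof -
    have "{t::nat \<Rightarrow> bool. \<forall>m\<in>a. t m} = (\<Pi>\<^sub>E i\<in>UNIV. if i \<in> a then {True} else UNIV)"
      by (auto simp: PiE_def Pi_def split: if_splits)
    moreover have top: "topspace sierpinski = UNIV"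
      by (metis openin_sierpinski openin_subset top.extremum_unique insertCI)
    have "{i. (if i \<in> a then {True} else UNIV) \<noteq> topspace sierpinski} \<subseteq> a"
      by (auto simp: top)
    then have "openin ?P (\<Pi>\<^sub>E i\<in>UNIV. if i \<in> a then {True} else UNIV)"
      using that by (intro product_topology_basis) (auto simp: openin_sierpinski finite_subset)
    ultimately show ?thesis by simp
  qed
  show "openin ?P V"
    unfolding openin_subopen[of ?P V]
  proof
    fix s assume "s \<in> V"
    obtain a where "finite a" "\<forall>m\<in>a. s m" "{t. \<forall>m\<in>a. t m} \<subseteq> V"
      using bspec[OF R \<open>s \<in> V\<close>] by (elim exE conjE) (rule that)
    then show "\<exists>T. openin ?P T \<and> s \<in> T \<and> T \<subseteq> V"
      using N by (intro exI[of _ "{t. \<forall>m\<in>a. t m}"]) simp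
  qed
qed

text \<open>Write the space as \<open>\<Inter>i. F i \<union> U i\<close> inside the subsets of \<open>\<nat>\<close>.  A descending
  sequence \<open>H\<close> of basic sets names the set \<open>s\<close> of all \<open>m\<close> such that \<open>H\<close> ends up
  in the \<open>m\<close>-th subbasic set.  This \<open>s\<close> lies in the space precisely if, for every
  \<open>i\<close> and every basic \<open>N a\<close> disjoint from \<open>F i\<close> that contains \<open>s\<close>, also
  \<open>s \<in> U i\<close>; covering \<open>U i\<close> by basic sets turns this into countably many tasks.\<close>

lemma quasi_Polish_imp_countably_Choquet:
  assumes "quasi_Polish_space X"
  shows "countably_Choquet X \<and> t0_space X"
proof -
  let ?P = "product_topology (\<lambda>_::nat. sierpinski) UNIV"
  define N where "N a = {t::nat \<Rightarrow> bool. \<forall>m\<in>a. t m}" for a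
  have opP: "openin ?P V \<longleftrightarrow> (\<forall>s\<in>V. \<exists>a. finite a \<and> s \<in> N a \<and> N a \<subseteq> V)" for V
    by (auto simp: openin_product_sierpinski N_def)
  obtain A where "Pi02_in ?P A" and hom: "X homeomorphic_space subtopology ?P A"
    using assms unfolding quasi_Polish_space_def by blast
  then obtain F U where FU: "(\<forall>i::nat. closedin ?P (F i) \<and> openin ?P (U i)) \<and> A = (\<Inter>i. F i \<union> U i)"
    unfolding Pi02_in_def by (elim exE) (rule that)
  then have F: "\<And>i. closedin ?P (F i)" and U: "\<And>i. openin ?P (U i)"
    and A: "A = (\<Inter>i. F i \<union> U i)" by simp_all
  have topP: "topspace ?P = UNIV"
  proof -
    have "openin ?P UNIV" unfolding opP by (intro ballI exI[of _ "{}"]) (simp add: N_def)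
    then show ?thesis using openin_subset by blast
  qed
  obtain e where e: "homeomorphic_map X (subtopology ?P A) e"
    using hom by (auto simp: homeomorphic_space)
  have "e ` topspace X = topspace (subtopology ?P A)"
    using e by (simp only: homeomorphic_eq_everything_map)
  then have e_im: "e ` topspace X = A"
    by (simp only: topspace_subtopology topP Int_UNIV_left)
  have e_cont: "continuous_map X ?P e" and e_inj: "inj_on e (topspace X)"
    using e by (simp_all add: homeomorphic_eq_everything_map continuous_map_in_subtopology)
  define D where "D a = {x \<in> topspace X. e x \<in> N a}" for a
  have D_open: "openin X (D a)" if "finite a" for a
    using openin_continuous_map_preimage[OF e_cont, of "N a"] that
    by (auto simp: D_def opP N_def)
  have D_base: "\<exists>a. finite a \<and> x \<in> D a \<and> D a \<subseteq> V" if V: "openin X V" "x \<in> V" for V x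
  proof -
    have "openin (subtopology ?P A) (e ` V)"
      using e V(1) by (simp add: homeomorphic_eq_everything_map open_map_def)
    then obtain T where T: "openin ?P T" "e ` V = T \<inter> A"
      by (auto simp: openin_subtopology)
    have xX: "x \<in> topspace X" using V openin_subset by blast
    have "e x \<in> T" using T V(2) by blast
    then obtain a where a: "finite a" "e x \<in> N a" "N a \<subseteq> T" using T(1) unfolding opP by blast
    have "D a \<subseteq> V"
    proof
      fix y assume y: "y \<in> D a"
      then have "e y \<in> e ` V" using T a e_im by (auto simp: D_def)
      then show "y \<in> V" using y e_inj openin_subset[OF V(1)] by (auto simp: D_def inj_on_def)
    qed
    then show ?thesis using a xX by (auto simp: D_def)
  qed
  define \<B> where "\<B> = D ` {a. finite a}"
  define \<W> where "\<W> = (\<lambda>(i, a). (D a, D ` {b. finite b \<and> N b \<subseteq> U i})) `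
    {(i, a). finite a \<and> N a \<inter> F i = {}}"
  have "countable {a::nat set. finite a}"
    by (rule countable_Collect_finite)
  then have cB: "countable \<B>" by (simp add: \<B>_def)
  have "countable {(i::nat, a). finite a \<and> N a \<inter> F i = {}}"
    by (rule countable_subset[of _ "UNIV \<times> {a. finite a}"])
       (use \<open>countable {a::nat set. finite a}\<close> in auto)
  then have cW: "countable \<W>" by (simp add: \<W>_def)
  have base: "base_of X \<B>"
    unfolding base_of_def
  proof (intro conjI ballI allI impI)
    fix V x assume "openin X V \<and> x \<in> V"
    then obtain a where "finite a" "x \<in> D a" "D a \<subseteq> V" using D_base by blast
    then show "\<exists>B\<in>\<B>. x \<in> B \<and> B \<subseteq> V" by (intro bexI[of _ "D a"]) (simp_all add: \<B>_def)
  qed (auto simp: \<B>_def D_open)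
  have cover: "\<forall>(W, \<C>)\<in>\<W>. W \<subseteq> \<Union>\<C> \<and> (\<forall>C\<in>\<C>. openin X C)"
  proof -
    have "D a \<subseteq> \<Union> (D ` {b. finite b \<and> N b \<subseteq> U i})" if "N a \<inter> F i = {}" for i a
    proof
      fix x assume x: "x \<in> D a"
      then have "e x \<in> A" using e_im by (auto simp: D_def)
      then have "e x \<in> U i" using x that A by (auto simp: D_def)
      then obtain b where "finite b" "e x \<in> N b" "N b \<subseteq> U i" using U opP by blast
      then show "x \<in> \<Union> (D ` {b. finite b \<and> N b \<subseteq> U i})" using x by (auto simp: D_def)
    qed
    then show ?thesis using D_open by (auto simp: \<W>_def)
  qed
  have conv: "\<exists>x. (\<forall>n. x \<in> H n) \<and> (\<forall>V. openin X V \<and> x \<in> V \<longrightarrow> (\<exists>n. H n \<subseteq> V))"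
    if dec: "decseq H" and HB: "\<And>n. H n \<in> \<B>"
      and Hc: "\<And>W \<C>. (W, \<C>) \<in> \<W> \<Longrightarrow> \<exists>n. H n \<subseteq> W \<Longrightarrow> \<exists>n. \<exists>C\<in>\<C>. H n \<subseteq> C"
    for H :: "nat \<Rightarrow> 'a set"
  proof -
    have D_Int: "H n \<subseteq> D a \<longleftrightarrow> (\<forall>m\<in>a. H n \<subseteq> D {m})" for n a
    proof -
      have "H n \<subseteq> topspace X" using HB[of n] by (auto simp: \<B>_def D_def)
      then show ?thesis by (auto simp: D_def N_def)
    qed
    define s where "s = (\<lambda>m. \<exists>n. H n \<subseteq> D {m})"
    have s: "s \<in> N a \<longleftrightarrow> (\<exists>n. H n \<subseteq> D a)" if "finite a" for a
    proof
      assume "s \<in> N a"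
      then show "\<exists>n. H n \<subseteq> D a"
        using decseq_eventually_subset_finite[OF dec that, of "\<lambda>m. D {m}"]
        by (simp add: N_def s_def D_Int[of _ a])
    next
      assume "\<exists>n. H n \<subseteq> D a"
      then show "s \<in> N a" unfolding N_def s_def D_Int[of _ a] by blast
    qed
    have "s \<in> F i \<union> U i" for i
    proof (cases "s \<in> F i")
      case False
      have "openin ?P (- F i)" using F[of i] unfolding closedin_def topP Compl_eq_Diff_UNIV by (rule conjunct2)
      then obtain a where a: "finite a" "s \<in> N a" "N a \<subseteq> - F i"
        using False unfolding opP by blast
      then have "(D a, D ` {b. finite b \<and> N b \<subseteq> U i}) \<in> \<W>"
        by (force simp: \<W>_def)
      moreover have "\<exists>n. H n \<subseteq> D a" using s a by simp
      ultimately obtain n b where "finite b" "N b \<subseteq> U i" "H n \<subseteq> D b"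
        using Hc[of "D a" "D ` {b. finite b \<and> N b \<subseteq> U i}"] by auto
      then show ?thesis using s by blast
    qed auto
    then have "s \<in> A" using A by blast
    then obtain x where x: "x \<in> topspace X" "e x = s" using e_im by blast
    have xD: "x \<in> D a \<longleftrightarrow> (\<exists>n. H n \<subseteq> D a)" if "finite a" for a
      using x s[OF that] by (simp add: D_def)
    have "x \<in> H n" for n
      using HB[of n] xD by (auto simp: \<B>_def)
    moreover have "\<exists>n. H n \<subseteq> V" if V: "openin X V" "x \<in> V" for V
    proof -
      obtain a where a: "finite a" "x \<in> D a" "D a \<subseteq> V" using D_base[OF V] by blast
      then obtain n where "H n \<subseteq> D a" using xD[OF a(1)] by blast
      then show ?thesis using a by blast
    qed
    ultimately show ?thesis by blast
  qed
  have "countably_Choquet X"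
    by (rule countably_ChoquetI[OF cB base cW cover conv])
  moreover have "t0_space X"
    unfolding t0_space_def
  proof (intro ballI impI)
    fix x y assume xy: "x \<in> topspace X" "y \<in> topspace X" "x \<noteq> y"
    then have "e x \<noteq> e y" using e_inj by (auto simp: inj_on_def)
    then obtain m where "e x m \<noteq> e y m" by blast
    then show "\<exists>V. openin X V \<and> (x \<notin> V \<longleftrightarrow> y \<in> V)"
      using xy D_open[of "{m}"] by (intro exI[of _ "D {m}"]) (auto simp: D_def N_def)
  qed
  ultimately show ?thesis by blast
qed

text \<open>The tasks are to pass, from any ball \<open>V\<close> and for any \<open>k\<close>, to a ball whose closure lies in
  \<open>V\<close> and which lies in some ball of radius \<open>1 / (k + 1)\<close>.  The closures of a sequence that meets them
  shrink to a point, and that point lies in the open sets too because each of them contains a later closure.\<close>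

lemma Polish_imp_countably_Choquet:
  assumes "Polish_space X"
  shows "countably_Choquet X \<and> t0_space X"
proof -
  obtain M d where "Metric_space M d" and comp: "Metric_space.mcomplete M d"
    and X: "X = Metric_space.mtopology M d"
    using assms unfolding Polish_space_def completely_metrizable_space_def by blast
  interpret Metric_space M d by fact
  obtain Q where Q: "countable Q" "Q \<subseteq> M" "mtopology closure_of Q = M"
    using assms unfolding Polish_space_def separable_space_def X by auto
  define \<B> where "\<B> = (\<lambda>(q, k). mball q (1 / real (Suc k))) ` (Q \<times> UNIV)"
  define \<W> where "\<W> = (\<lambda>(V, k). (V, {C \<in> \<B>. mtopology closure_of C \<subseteq> V \<and> (\<exists>a. C \<subseteq> mball a (1 / real (Suc k)))})) `
      (\<B> \<times> UNIV)"
  \<comment> \<open>The radius \<open>1 / (k + 1)\<close> is less than half of that of a ball about \<open>x\<close>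
    inside \<open>V\<close>, so a centre \<open>q\<close> of \<open>Q\<close> within that distance of \<open>x\<close> does.\<close>
  have small: "\<exists>q k. q \<in> Q \<and> x \<in> mball q (1 / real (Suc k)) \<and> k \<ge> k0 \<and>
      mcball q (1 / real (Suc k)) \<subseteq> V"
    if V: "openin mtopology V" "x \<in> V" for V x k0
  proof -
    have xM: "x \<in> M" using V openin_subset by fastforce
    obtain r where r: "r > 0" "mball x r \<subseteq> V"
      using V unfolding openin_mtopology by blast
    obtain k where k: "inverse (real (Suc k)) < min (r / 2) (1 / Suc k0)"
      using reals_Archimedean[of "min (r / 2) (1 / Suc k0)"] r by auto
    have kk: "k0 \<le> k"
    proof (rule ccontr)
      assume "\<not> k0 \<le> k"
      then have "real (Suc k) \<le> real (Suc k0)" by simp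
      then have "inverse (real (Suc k0)) \<le> inverse (real (Suc k))"
        by (intro le_imp_inverse_le) auto
      then show False using k by (simp add: inverse_eq_divide)
    qed
    define \<delta> where "\<delta> = 1 / real (Suc k)"
    have \<delta>: "0 < \<delta>" "\<delta> < r / 2" using k by (auto simp: \<delta>_def inverse_eq_divide)
    have "x \<in> mtopology closure_of Q" using Q xM by simp
    then obtain q where q: "q \<in> Q" "q \<in> mball x \<delta>"
      using \<delta> xM unfolding metric_closure_of by blast
    have "mcball q \<delta> \<subseteq> mball x r"
      using q \<delta> Q xM commute[of q x] by (intro mcball_subset_mball) auto
    then show ?thesis
      using q r kk commute[of q x] unfolding \<delta>_def
      by (intro exI[of _ q] exI[of _ k]) auto
  qed
  have cB: "countable \<B>" using Q(1) by (simp add: \<B>_def)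
  then have cW: "countable \<W>" by (simp add: \<W>_def)
  have base: "base_of mtopology \<B>"
    unfolding base_of_def \<B>_def
  proof (intro conjI ballI allI impI)
    fix V x assume "openin mtopology V \<and> x \<in> V"
    then obtain q k where "q \<in> Q" "x \<in> mball q (1 / real (Suc k))" "mcball q (1 / real (Suc k)) \<subseteq> V"
      using small by blast
    then show "\<exists>B\<in>(\<lambda>(q, k). mball q (1 / real (Suc k))) ` (Q \<times> UNIV). x \<in> B \<and> B \<subseteq> V"
      using mball_subset_mcball by (intro bexI[of _ "mball q (1 / real (Suc k))"]) blast+
  qed auto
  have closure_ball: "mtopology closure_of (mball q r) \<subseteq> mcball q r" for q r
    by (intro closure_of_minimal mball_subset_mcball closedin_mcball)
  have cover: "\<forall>(W, \<C>)\<in>\<W>. W \<subseteq> \<Union>\<C> \<and> (\<forall>C\<in>\<C>. openin mtopology C)"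
  proof -
    have "x \<in> \<Union>{C \<in> \<B>. mtopology closure_of C \<subseteq> V \<and> (\<exists>a. C \<subseteq> mball a (1 / real (Suc k)))}"
      if "V \<in> \<B>" "x \<in> V" for V x k
    proof -
      have "openin mtopology V" using base that by (simp add: base_of_def)
      then obtain q j where q: "q \<in> Q" "x \<in> mball q (1 / real (Suc j))" "k \<le> j"
          "mcball q (1 / real (Suc j)) \<subseteq> V"
        using small[OF _ \<open>x \<in> V\<close>] by blast
      then have "mball q (1 / real (Suc j)) \<subseteq> mball q (1 / real (Suc k))"
        by (intro mball_subset_concentric) (simp add: field_simps)
      then show ?thesis
        using q closure_ball[of q "1 / real (Suc j)"]
        by (intro UnionI[of "mball q (1 / real (Suc j))"]) (auto simp: \<B>_def)
    qed
    then show ?thesis using base by (auto simp: \<W>_def base_of_def)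
  qed
  have conv: "\<exists>x. (\<forall>n. x \<in> H n) \<and> (\<forall>V. openin mtopology V \<and> x \<in> V \<longrightarrow> (\<exists>n. H n \<subseteq> V))"
    if dec: "decseq H" and HB: "\<And>n. H n \<in> \<B>" and ne: "\<And>n. H n \<noteq> {}"
      and Hc: "\<And>W \<C>. (W, \<C>) \<in> \<W> \<Longrightarrow> \<exists>n. H n \<subseteq> W \<Longrightarrow> \<exists>n. \<exists>C\<in>\<C>. H n \<subseteq> C"
    for H :: "nat \<Rightarrow> 'a set"
  proof -
    have step: "\<exists>m. mtopology closure_of (H m) \<subseteq> H n \<and> (\<exists>a. H m \<subseteq> mball a (1 / real (Suc k)))" for n k
    proof -
      have "(H n, {C \<in> \<B>. mtopology closure_of C \<subseteq> H n \<and> (\<exists>a. C \<subseteq> mball a (1 / real (Suc k)))}) \<in> \<W>"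
        using HB by (force simp: \<W>_def)
      then obtain m C a where "mtopology closure_of C \<subseteq> H n" "C \<subseteq> mball a (1 / real (Suc k))" "H m \<subseteq> C"
        using Hc by blast
      then show ?thesis using closure_of_mono[of "H m" C mtopology] by blast
    qed
    have HM: "H n \<subseteq> M" for n
      using HB[of n] mball_subset_mspace by (auto simp: \<B>_def)
    define K where "K n = mtopology closure_of (H n)" for n
    have "\<exists>n a. K n \<subseteq> mcball a \<epsilon>" if \<epsilon>: "\<epsilon> > 0" for \<epsilon>
    proof -
      obtain k where k: "inverse (real (Suc k)) < \<epsilon>" using reals_Archimedean[OF \<epsilon>] by blast
      obtain m a where m: "H m \<subseteq> mball a (1 / real (Suc k))" using step by blast
      have "K m \<subseteq> mcball a (1 / real (Suc k))"
        unfolding K_def using closure_of_mono[OF m, of mtopology] closure_ball by blast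
      also have "\<dots> \<subseteq> mcball a \<epsilon>"
        using k by (intro mcball_subset_concentric) (simp add: inverse_eq_divide)
      finally show ?thesis by blast
    qed
    moreover have "decseq K"
      using dec by (auto simp: K_def decseq_def intro!: closure_of_mono)
    moreover have "K n \<noteq> {}" for n
      using ne[of n] HM[of n] closure_of_subset[of "H n" mtopology] by (auto simp: K_def)
    moreover have "closedin mtopology (K n)" for n by (simp add: K_def)
    ultimately have "\<Inter> (range K) \<noteq> {}"
      using comp unfolding mcomplete_nest by blast
    then obtain x where x: "\<And>n. x \<in> K n" by blast
    have xH: "x \<in> H n" for n
      using step[of n 0] x by (auto simp: K_def)
    have "\<exists>n. H n \<subseteq> V" if V: "openin mtopology V" "x \<in> V" for V
    proof -
      obtain r where r: "r > 0" "mball x r \<subseteq> V" using V unfolding openin_mtopology by blast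
      obtain k where k: "inverse (real (Suc k)) < r / 2" using reals_Archimedean[of "r / 2"] r by auto
      obtain m a where m: "H m \<subseteq> mball a (1 / real (Suc k))" using step by blast
      have "y \<in> mball x r" if "y \<in> H m" for y
      proof -
        have "x \<in> mball a (1 / real (Suc k))" "y \<in> mball a (1 / real (Suc k))" using m that xH by blast+
        then show ?thesis
          using k triangle[of x a y] commute[of a x] by (auto simp: inverse_eq_divide)
      qed
      then show ?thesis using r by blast
    qed
    then show ?thesis using xH by blast
  qed
  have "countably_Choquet mtopology"
    by (rule countably_ChoquetI[OF cB base cW cover conv])
  then show ?thesis
    using Hausdorff_space_mtopology Hausdorff_imp_t0_space by (auto simp: X)
qed

lemma meet_countably_many_dense_sets:
  fixes \<D> :: "'p set set" and le :: "'p \<Rightarrow> 'p \<Rightarrow> bool"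
  assumes "p0 \<in> P" and "countable \<D>"
    and refl: "\<And>p. le p p"
    and dense: "\<And>D p. D \<in> \<D> \<Longrightarrow> p \<in> P \<Longrightarrow> \<exists>q\<in>P. le q p \<and> q \<in> D"
  shows "\<exists>s :: nat \<Rightarrow> 'p. (\<forall>n. s n \<in> P \<and> le (s (Suc n)) (s n)) \<and> (\<forall>D\<in>\<D>. \<exists>n. s n \<in> D)"
proof (cases "\<D> = {}")
  case True
  then show ?thesis using assms(1) refl by (intro exI[of _ "\<lambda>_. p0"]) auto
next
  case False
  have "\<exists>s. \<forall>n. s n \<in> P \<and> (le (s (Suc n)) (s n) \<and> s (Suc n) \<in> from_nat_into \<D> n)"
    by (rule dependent_nat_choice) (use assms(1) dense from_nat_into[OF False] in blast)+
  then obtain s where s: "\<And>n. s n \<in> P" "\<And>n. le (s (Suc n)) (s n)"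
      "\<And>n. s (Suc n) \<in> from_nat_into \<D> n" by blast
  moreover have "\<exists>n. s n \<in> D" if "D \<in> \<D>" for D
    using s(3) from_nat_into_surj[OF assms(2) that] by metis
  ultimately show ?thesis by blast
qed

lemma t0_eqI:
  assumes "t0_space X" "a \<in> topspace X" "b \<in> topspace X"
    and "\<And>V. openin X V \<Longrightarrow> a \<in> V \<longleftrightarrow> b \<in> V"
  shows "a = b"
  using assms unfolding t0_space_def by metis

text \<open>The tasks of interest have the form ``once \<open>A\<close> holds, attain \<open>B\<close>''.  The conditions
  that attain \<open>B\<close> or have no extension with \<open>A\<close> are dense, so each task need be visited only once.\<close>

lemma generic_descending_sequence:
  fixes le :: "'p \<Rightarrow> 'p \<Rightarrow> bool" and \<Q> :: "(('p \<Rightarrow> bool) \<times> ('p \<Rightarrow> bool)) set"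
  assumes "p0 \<in> P" "countable \<Q>"
    and refl: "\<And>p. le p p"
    and trans: "\<And>p q r. le p q \<Longrightarrow> le q r \<Longrightarrow> le p r"
    and hereditary: "\<And>A B p q. (A, B) \<in> \<Q> \<Longrightarrow> A p \<Longrightarrow> le q p \<Longrightarrow> A q"
    and attain: "\<And>A B p. (A, B) \<in> \<Q> \<Longrightarrow> p \<in> P \<Longrightarrow> A p \<Longrightarrow> \<exists>q\<in>P. le q p \<and> B q"
  shows "\<exists>s :: nat \<Rightarrow> 'p. (\<forall>n. s n \<in> P \<and> le (s (Suc n)) (s n)) \<and>
    (\<forall>A B. (A, B) \<in> \<Q> \<longrightarrow> (\<exists>n. A (s n)) \<longrightarrow> (\<exists>n. B (s n)))"
proof -
  define D where "D A B = {p. B p \<or> \<not> (\<exists>q\<in>P. le q p \<and> A q)}" for A B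
  have "\<exists>s. (\<forall>n. s n \<in> P \<and> le (s (Suc n)) (s n)) \<and> (\<forall>E\<in>(\<lambda>(A, B). D A B) ` \<Q>. \<exists>n. s n \<in> E)"
  proof (rule meet_countably_many_dense_sets)
    show "\<exists>q\<in>P. le q p \<and> q \<in> E" if E: "E \<in> (\<lambda>(A, B). D A B) ` \<Q>" and p: "p \<in> P" for E p
    proof -
      obtain A B where AB: "(A, B) \<in> \<Q>" "E = D A B" using E by auto
      show ?thesis
      proof (cases "\<exists>q\<in>P. le q p \<and> A q")
        case True
        then obtain q where q: "q \<in> P" "le q p" "A q" by blast
        then obtain r where "r \<in> P" "le r q" "B r" using attain AB by blast
        then show ?thesis using q trans AB by (intro bexI[of _ r]) (auto simp: D_def)
      next
        case False
        then show ?thesis using p refl AB by (intro bexI[of _ p]) (auto simp: D_def)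
      qed
    qed
  qed (use assms in auto)
  then obtain s where s: "\<And>n. s n \<in> P" "\<And>n. le (s (Suc n)) (s n)"
    and sD: "\<And>A B. (A, B) \<in> \<Q> \<Longrightarrow> \<exists>n. s n \<in> D A B" by force
  have mono: "le (s n) (s m)" if "m \<le> n" for m n
    using that by (induction rule: dec_induct) (use refl trans s(2) in blast)+
  have "\<exists>n. B (s n)" if AB: "(A, B) \<in> \<Q>" and n: "A (s n)" for A B n
  proof -
    obtain m where m: "s m \<in> D A B" using sD AB by blast
    have "A (s (max m n))" using hereditary[OF AB n] mono by simp
    moreover have "le (s (max m n)) (s m)" using mono by simp
    ultimately show ?thesis using m s(1) by (auto simp: D_def)
  qed
  then show ?thesis using s by blast
qed

section \<open>Left cosets of subgroupoids\<close>

definition units_in :: "('o, 'm) groupoid \<Rightarrow> 'm set \<Rightarrow> 'o set" where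
  "units_in G U = {x \<in> topspace (Obj G). unit_of G x \<in> U}"

definition left_coset :: "('o, 'm) groupoid \<Rightarrow> 'm \<Rightarrow> 'm set \<Rightarrow> 'm set" where
  "left_coset G g U = {comp G g u | u. u \<in> U \<and> tgt G u = src G g}"

definition left_cosets :: "('o, 'm) groupoid \<Rightarrow> 'm set \<Rightarrow> 'm set set" where
  "left_cosets G U = {left_coset G g U | g. g \<in> topspace (Mor G) \<and> src G g \<in> units_in G U}"

text \<open>All arrows of a left coset have the same target, so the choice is immaterial (\<open>coset_base_eq\<close>).\<close>

definition coset_base :: "('o, 'm) groupoid \<Rightarrow> 'm set \<Rightarrow> 'o" where
  "coset_base G c = tgt G (SOME g. g \<in> c)"

definition product_set :: "('o, 'm) groupoid \<Rightarrow> 'm set \<Rightarrow> 'm set \<Rightarrow> 'm set" where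
  "product_set G W V = {comp G w v | w v. w \<in> W \<and> v \<in> V \<and> src G w = tgt G v}"

text \<open>The quotient topology of \<open>{g. src g \<in> units_in G U}\<close>: as the cosets partition that set,
  the preimage of a set of cosets is its union.\<close>

definition coset_topology :: "('o, 'm) groupoid \<Rightarrow> 'm set \<Rightarrow> 'm set topology" where
  "coset_topology G U = topology (\<lambda>\<O>. \<O> \<subseteq> left_cosets G U \<and> openin (Mor G) (\<Union>\<O>))"

definition cosets_meeting :: "('o, 'm) groupoid \<Rightarrow> 'm set \<Rightarrow> 'm set \<Rightarrow> 'm set set" where
  "cosets_meeting G U W = {c \<in> left_cosets G U. c \<inter> W \<noteq> {}}"

text \<open>These relations are the orbits, under left translation, of the conditions ``\<open>c\<close> is the coset of a
  unit and \<open>d\<close> meets \<open>B\<close>''.  They are invariant by construction, and they are all that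
  an isomorphism of the coset structure is asked to preserve.  For \<open>B \<subseteq> V\<close> and
  \<open>U \<subseteq> V\<close> the relation forces \<open>c \<subseteq> d\<close>.\<close>

definition coset_rel ::
  "('o, 'm) groupoid \<Rightarrow> 'm set \<Rightarrow> 'm set \<Rightarrow> 'm set \<Rightarrow> 'm set \<Rightarrow> 'm set \<Rightarrow> bool" where
  "coset_rel G U V B c d \<longleftrightarrow>
     (\<exists>g b. g \<in> topspace (Mor G) \<and> b \<in> topspace (Mor G) \<and> b \<in> B \<and> src G g = tgt G b \<and>
        src G g \<in> units_in G U \<and> src G b \<in> units_in G V \<and>
        c = left_coset G g U \<and> d = left_coset G (comp G g b) V)"

context groupoid
begin

abbreviation (input) "Arr \<equiv> topspace (Mor G)"

lemma comp_arr: "g \<in> Arr \<Longrightarrow> h \<in> Arr \<Longrightarrow> src G g = tgt G h \<Longrightarrow> comp G g h \<in> Arr"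
  by (simp add: comp_closed composable_def)

lemma src_comp': "g \<in> Arr \<Longrightarrow> h \<in> Arr \<Longrightarrow> src G g = tgt G h \<Longrightarrow> src G (comp G g h) = src G h"
  by (simp add: src_comp composable_def)

lemma tgt_comp': "g \<in> Arr \<Longrightarrow> h \<in> Arr \<Longrightarrow> src G g = tgt G h \<Longrightarrow> tgt G (comp G g h) = tgt G g"
  by (simp add: tgt_comp composable_def)

lemma comp_assoc': "g \<in> Arr \<Longrightarrow> h \<in> Arr \<Longrightarrow> k \<in> Arr \<Longrightarrow> src G g = tgt G h \<Longrightarrow> src G h = tgt G k \<Longrightarrow>
    comp G (comp G g h) k = comp G g (comp G h k)"
  by (simp add: comp_assoc composable_def)

lemma unit_left': "g \<in> Arr \<Longrightarrow> tgt G g = x \<Longrightarrow> comp G (unit_of G x) g = g"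
  using unit_left by blast

lemma unit_right': "g \<in> Arr \<Longrightarrow> src G g = x \<Longrightarrow> comp G g (unit_of G x) = g"
  using unit_right by blast

lemmas arr_simps = src_closed tgt_closed unit_closed inverse_closed src_unit tgt_unit unit_left' unit_right'
  src_inverse tgt_inverse inverse_left inverse_right comp_arr src_comp' tgt_comp'

lemma inverse_comp_cancel:
  assumes "g \<in> Arr" "h \<in> Arr" "src G g = tgt G h"
  shows "comp G (inverse_of G g) (comp G g h) = h"
proof -
  have "comp G (inverse_of G g) (comp G g h) = comp G (comp G (inverse_of G g) g) h"
    using assms by (simp add: comp_assoc' inverse_closed src_inverse tgt_inverse)
  then show ?thesis using assms by (simp add: arr_simps)
qed

lemma comp_inverse_cancel:
  assumes "g \<in> Arr" "h \<in> Arr" "tgt G g = tgt G h"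
  shows "comp G g (comp G (inverse_of G g) h) = h"
proof -
  have "comp G g (comp G (inverse_of G g) h) = comp G (comp G g (inverse_of G g)) h"
    using assms by (simp add: comp_assoc' inverse_closed src_inverse tgt_inverse)
  then show ?thesis using assms by (simp add: arr_simps)
qed

lemma inverse_unique:
  assumes "g \<in> Arr" "h \<in> Arr" "src G g = tgt G h" "comp G g h = unit_of G (tgt G g)"
  shows "h = inverse_of G g"
  using inverse_comp_cancel[OF assms(1-3)] assms unit_right[of "inverse_of G g"]
  by (simp add: arr_simps)

lemma inverse_inverse: "g \<in> Arr \<Longrightarrow> inverse_of G (inverse_of G g) = g"
  using inverse_unique[of "inverse_of G g" g] by (simp add: arr_simps)

lemma inverse_comp:
  assumes "g \<in> Arr" "h \<in> Arr" "src G g = tgt G h"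
  shows "inverse_of G (comp G g h) = comp G (inverse_of G h) (inverse_of G g)"
proof (rule inverse_unique[symmetric])
  show "comp G (comp G g h) (comp G (inverse_of G h) (inverse_of G g)) = unit_of G (tgt G (comp G g h))"
    using assms by (simp add: comp_assoc' comp_inverse_cancel arr_simps)
qed (use assms in \<open>simp_all add: arr_simps\<close>)

lemma inverse_unit: "x \<in> topspace (Obj G) \<Longrightarrow> inverse_of G (unit_of G x) = unit_of G x"
  using inverse_unique[of "unit_of G x" "unit_of G x"] unit_left[of "unit_of G x"]
  by (simp add: arr_simps)

lemma subgroupoid_units_in:
  assumes "subgroupoid G U" "u \<in> U"
  shows "u \<in> Arr" "src G u \<in> units_in G U" "tgt G u \<in> units_in G U"
proof -
  show u: "u \<in> Arr" using assms by (auto simp: subgroupoid_def)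
  have i: "inverse_of G u \<in> U" using assms by (auto simp: subgroupoid_def)
  have "comp G (inverse_of G u) u \<in> U" "comp G u (inverse_of G u) \<in> U"
    using assms i u by (simp_all add: subgroupoid_def src_inverse tgt_inverse)
  then have "unit_of G (src G u) \<in> U" "unit_of G (tgt G u) \<in> U"
    using u by (simp_all add: inverse_left inverse_right)
  then show "src G u \<in> units_in G U" "tgt G u \<in> units_in G U"
    using u by (auto simp: units_in_def arr_simps)
qed

lemma mem_left_coset_iff:
  assumes "g \<in> Arr" "U \<subseteq> Arr"
  shows "h \<in> left_coset G g U \<longleftrightarrow>
    h \<in> Arr \<and> tgt G h = tgt G g \<and> comp G (inverse_of G g) h \<in> U"
proof
  assume "h \<in> left_coset G g U"
  then obtain u where "u \<in> U" "tgt G u = src G g" "h = comp G g u"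
    by (auto simp: left_coset_def)
  then show "h \<in> Arr \<and> tgt G h = tgt G g \<and> comp G (inverse_of G g) h \<in> U"
    using assms by (auto simp: inverse_comp_cancel arr_simps)
next
  assume h: "h \<in> Arr \<and> tgt G h = tgt G g \<and> comp G (inverse_of G g) h \<in> U"
  then have "h = comp G g (comp G (inverse_of G g) h)"
    using assms by (simp add: comp_inverse_cancel)
  then show "h \<in> left_coset G g U"
    using assms h by (auto simp: left_coset_def arr_simps)
qed

lemma left_coset_eqI:
  assumes U: "subgroupoid G U" and g: "g \<in> Arr" and h: "h \<in> left_coset G g U"
  shows "left_coset G h U = left_coset G g U"
proof -
  have UA: "U \<subseteq> Arr" using U by (simp add: subgroupoid_def)
  have h': "h \<in> Arr" "tgt G h = tgt G g" "comp G (inverse_of G g) h \<in> U"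
    using h mem_left_coset_iff[OF g UA] by auto
  have mult: "comp G a b \<in> U" if "a \<in> U" "b \<in> U" "src G a = tgt G b" for a b
    using U that by (auto simp: subgroupoid_def)
  have inv: "inverse_of G a \<in> U" if "a \<in> U" for a
    using U that by (auto simp: subgroupoid_def)
  have "comp G (inverse_of G h) k \<in> U \<longleftrightarrow> comp G (inverse_of G g) k \<in> U"
    if k: "k \<in> Arr" "tgt G k = tgt G g" for k
  proof
    assume "comp G (inverse_of G h) k \<in> U"
    then have "comp G (comp G (inverse_of G g) h) (comp G (inverse_of G h) k) \<in> U"
      using mult h' k g by (simp add: arr_simps)
    then show "comp G (inverse_of G g) k \<in> U"
      using h' k g by (simp add: comp_assoc' comp_inverse_cancel arr_simps)
  next
    assume *: "comp G (inverse_of G g) k \<in> U"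
    have "comp G (inverse_of G h) g \<in> U"
      using inv[OF h'(3)] h' g by (simp add: inverse_comp inverse_inverse arr_simps)
    then have "comp G (comp G (inverse_of G h) g) (comp G (inverse_of G g) k) \<in> U"
      using mult * h' k g by (simp add: arr_simps)
    then show "comp G (inverse_of G h) k \<in> U"
      using h' k g by (simp add: comp_assoc' comp_inverse_cancel arr_simps)
  qed
  then show ?thesis
    using h' mem_left_coset_iff[OF g UA] mem_left_coset_iff[OF h'(1) UA] by auto
qed

lemma self_mem_left_coset:
  assumes "g \<in> Arr" "src G g \<in> units_in G U"
  shows "g \<in> left_coset G g U"
  using assms unfolding left_coset_def units_in_def
  by (intro CollectI exI[of _ "unit_of G (src G g)"]) (simp add: arr_simps)

lemma left_coset_in_cosets:
  "g \<in> Arr \<Longrightarrow> src G g \<in> units_in G U \<Longrightarrow> left_coset G g U \<in> left_cosets G U"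
  by (auto simp: left_cosets_def)

lemma left_cosets_memD:
  assumes U: "subgroupoid G U" and c: "c \<in> left_cosets G U" and g: "g \<in> c"
  shows "g \<in> Arr" "src G g \<in> units_in G U" "c = left_coset G g U"
proof -
  obtain h where h: "h \<in> Arr" "src G h \<in> units_in G U" "c = left_coset G h U"
    using c by (auto simp: left_cosets_def)
  have UA: "U \<subseteq> Arr" using U by (simp add: subgroupoid_def)
  show gA: "g \<in> Arr" using g h mem_left_coset_iff[OF h(1) UA] by auto
  show "c = left_coset G g U" using left_coset_eqI[OF U h(1)] g h by auto
  obtain u where u: "u \<in> U" "tgt G u = src G h" "g = comp G h u"
    using g h by (auto simp: left_coset_def)
  then have "src G g = src G u" using h UA by (auto simp: arr_simps)
  then show "src G g \<in> units_in G U" using subgroupoid_units_in[OF U u(1)] by simp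
qed

lemma left_cosets_nonempty: "c \<in> left_cosets G U \<Longrightarrow> \<exists>g. g \<in> c"
  using self_mem_left_coset by (auto simp: left_cosets_def)

lemma left_cosets_disjoint:
  assumes "subgroupoid G U" "c \<in> left_cosets G U" "d \<in> left_cosets G U" "g \<in> c" "g \<in> d"
  shows "c = d"
  using left_cosets_memD(3)[OF assms(1,2,4)] left_cosets_memD(3)[OF assms(1,3,5)] by simp

lemma tgt_left_coset:
  assumes "subgroupoid G U" "g \<in> Arr" "h \<in> left_coset G g U"
  shows "tgt G h = tgt G g"
  using mem_left_coset_iff[of g U h] assms by (auto simp: subgroupoid_def)

lemma coset_base_eq:
  assumes "subgroupoid G U" "c \<in> left_cosets G U" "g \<in> c"
  shows "coset_base G c = tgt G g"
proof -
  have "(SOME h. h \<in> c) \<in> c" using assms(3) by (rule someI)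
  then show ?thesis
    using tgt_left_coset[of U g] left_cosets_memD[OF assms] assms(1) unfolding coset_base_def by metis
qed

lemma coset_base_left_coset:
  "subgroupoid G U \<Longrightarrow> g \<in> Arr \<Longrightarrow> src G g \<in> units_in G U \<Longrightarrow> coset_base G (left_coset G g U) = tgt G g"
  by (rule coset_base_eq[OF _ left_coset_in_cosets self_mem_left_coset])

lemma coset_base_in_Obj:
  assumes "subgroupoid G U" "c \<in> left_cosets G U"
  shows "coset_base G c \<in> topspace (Obj G)"
proof -
  obtain g where "g \<in> c" using left_cosets_nonempty assms(2) by blast
  then show ?thesis using coset_base_eq left_cosets_memD assms tgt_closed by metis
qed

lemma left_coset_eq_iff:
  assumes "subgroupoid G U" "g \<in> Arr" "h \<in> Arr" "src G h \<in> units_in G U"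
  shows "left_coset G h U = left_coset G g U \<longleftrightarrow>
    tgt G h = tgt G g \<and> comp G (inverse_of G g) h \<in> U"
proof -
  have UA: "U \<subseteq> Arr" using assms by (simp add: subgroupoid_def)
  show ?thesis
    using left_coset_eqI[OF assms(1,2), of h] self_mem_left_coset[OF assms(3,4)]
      mem_left_coset_iff[OF assms(2) UA, of h] assms(3) by auto
qed

lemma translate_left_coset:
  assumes "U \<subseteq> Arr" "g \<in> Arr" "h \<in> Arr" "src G g = tgt G h"
  shows "comp G g ` left_coset G h U = left_coset G (comp G g h) U"
proof -
  have "comp G g (comp G h u) = comp G (comp G g h) u" if "u \<in> U" "tgt G u = src G h" for u
    using that assms by (auto simp: comp_assoc')
  then show ?thesis
    using assms unfolding left_coset_def by (fastforce simp: arr_simps image_iff)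
qed

lemma left_coset_mono: "V \<subseteq> U \<Longrightarrow> left_coset G g V \<subseteq> left_coset G g U"
  by (auto simp: left_coset_def)

lemma translate_in_cosets:
  assumes U: "subgroupoid G U" and c: "c \<in> left_cosets G U" and g: "g \<in> Arr" "src G g = coset_base G c"
  shows "comp G g ` c \<in> left_cosets G U" "coset_base G (comp G g ` c) = tgt G g"
    "comp G (inverse_of G g) ` comp G g ` c = c"
proof -
  obtain h where h: "h \<in> c" using left_cosets_nonempty c by blast
  note h' = left_cosets_memD[OF U c h]
  have UA: "U \<subseteq> Arr" using U by (simp add: subgroupoid_def)
  have gh: "src G g = tgt G h" using g coset_base_eq[OF U c h] by simp
  have tr: "comp G g ` c = left_coset G (comp G g h) U"
    using translate_left_coset[OF UA g(1) h'(1) gh] h'(3) by simp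
  have 1: "comp G g h \<in> Arr" "src G (comp G g h) \<in> units_in G U"
    using g h' gh by (simp_all add: arr_simps)
  show "comp G g ` c \<in> left_cosets G U" using tr left_coset_in_cosets[OF 1] by simp
  show "coset_base G (comp G g ` c) = tgt G g"
    using tr coset_base_left_coset[OF U 1] g h' gh by (simp add: arr_simps)
  have "comp G (inverse_of G g) ` comp G g ` c = left_coset G (comp G (inverse_of G g) (comp G g h)) U"
    unfolding tr using g h' gh by (intro translate_left_coset UA) (simp_all add: arr_simps)
  then show "comp G (inverse_of G g) ` comp G g ` c = c"
    using inverse_comp_cancel[OF g(1) h'(1) gh] h'(3) by simp
qed

lemma translate_coset_rel:
  assumes U: "subgroupoid G U" and V: "subgroupoid G V" and g: "g \<in> Arr" "src G g = coset_base G c"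
    and R: "coset_rel G U V B c d"
  shows "coset_rel G U V B (comp G g ` c) (comp G g ` d)"
proof -
  obtain h b where hb: "h \<in> Arr" "b \<in> Arr" "b \<in> B" "src G h = tgt G b" "src G h \<in> units_in G U"
    "src G b \<in> units_in G V" "c = left_coset G h U" "d = left_coset G (comp G h b) V"
    using R by (auto simp: coset_rel_def)
  have gh: "src G g = tgt G h" using g hb coset_base_left_coset[OF U] by simp
  have "comp G g ` c = left_coset G (comp G g h) U"
    using U hb gh g by (auto simp: subgroupoid_def translate_left_coset)
  moreover have "comp G g ` d = left_coset G (comp G (comp G g h) b) V"
    using V hb gh g by (auto simp: subgroupoid_def translate_left_coset comp_assoc' arr_simps)
  ultimately show ?thesis
    using hb gh g unfolding coset_rel_def
    by (intro exI[of _ "comp G g h"] exI[of _ b]) (simp add: arr_simps)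
qed

lemma coset_rel_in_cosets:
  assumes "subgroupoid G U" "subgroupoid G V" "coset_rel G U V B c d"
  shows "c \<in> left_cosets G U" "d \<in> left_cosets G V" "coset_base G c = coset_base G d"
  using assms unfolding coset_rel_def
  by (auto simp: coset_base_left_coset arr_simps intro!: left_coset_in_cosets)

lemma openin_coset_topology:
  assumes U: "subgroupoid G U"
  shows "openin (coset_topology G U) \<O> \<longleftrightarrow> \<O> \<subseteq> left_cosets G U \<and> openin (Mor G) (\<Union>\<O>)"
proof -
  have "istopology (\<lambda>\<O>. \<O> \<subseteq> left_cosets G U \<and> openin (Mor G) (\<Union>\<O>))"
    unfolding istopology_def
  proof (intro conjI allI impI)
    fix S T assume S: "S \<subseteq> left_cosets G U \<and> openin (Mor G) (\<Union> S)"
      and T: "T \<subseteq> left_cosets G U \<and> openin (Mor G) (\<Union> T)"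
    have "\<Union> (S \<inter> T) = \<Union> S \<inter> \<Union> T"
    proof
      show "\<Union> S \<inter> \<Union> T \<subseteq> \<Union> (S \<inter> T)"
      proof
        fix g assume "g \<in> \<Union> S \<inter> \<Union> T"
        then obtain c d where cd: "c \<in> S" "d \<in> T" "g \<in> c" "g \<in> d" by blast
        then have "c = d" using left_cosets_disjoint[OF U] S T by blast
        then show "g \<in> \<Union> (S \<inter> T)" using cd by blast
      qed
    qed blast
    then show "openin (Mor G) (\<Union> (S \<inter> T))" using S T by (simp add: openin_Int)
    show "S \<inter> T \<subseteq> left_cosets G U" using S by blast
  next
    fix K assume K: "\<forall>S\<in>K. S \<subseteq> left_cosets G U \<and> openin (Mor G) (\<Union> S)"
    show "\<Union> K \<subseteq> left_cosets G U" using K by blast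
    have "\<Union> (\<Union> K) = \<Union> (Union ` K)" by blast
    then show "openin (Mor G) (\<Union> (\<Union> K))" using K by auto
  qed
  then show ?thesis by (simp add: coset_topology_def)
qed

end

section \<open>Coset spaces are etale\<close>

locale open_topological_groupoid = topological_groupoid +
  assumes open_src: "open_map (Mor G) (Obj G) (src G)"
begin

lemma open_tgt: "open_map (Mor G) (Obj G) (tgt G)"
  unfolding open_map_def
proof (intro allI impI)
  fix W assume W: "openin (Mor G) W"
  have "openin (Mor G) {g \<in> Arr. inverse_of G g \<in> W}"
    using openin_continuous_map_preimage[OF continuous_inverse W] .
  then have "openin (Obj G) (src G ` {g \<in> Arr. inverse_of G g \<in> W})"
    using open_src by (simp add: open_map_def)
  moreover have "src G ` {g \<in> Arr. inverse_of G g \<in> W} = tgt G ` W"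
  proof -
    have "tgt G g \<in> src G ` {g \<in> Arr. inverse_of G g \<in> W}" if "g \<in> W" for g
      using that openin_subset[OF W]
      by (intro image_eqI[of _ _ "inverse_of G g"]) (auto simp: arr_simps inverse_inverse)
    moreover have "src G g \<in> tgt G ` W" if "g \<in> Arr" "inverse_of G g \<in> W" for g
      using that by (intro image_eqI[of _ _ "inverse_of G g"]) (auto simp: arr_simps)
    ultimately show ?thesis by auto
  qed
  ultimately show "openin (Obj G) (tgt G ` W)" by simp
qed

lemma openin_src_preimage: "openin (Obj G) N \<Longrightarrow> openin (Mor G) {g \<in> Arr. src G g \<in> N}"
  using openin_continuous_map_preimage[OF continuous_src] by blast

lemma openin_tgt_preimage: "openin (Obj G) N \<Longrightarrow> openin (Mor G) {g \<in> Arr. tgt G g \<in> N}"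
  using openin_continuous_map_preimage[OF continuous_tgt] by blast

lemma openin_units_in: "openin (Mor G) U \<Longrightarrow> openin (Obj G) (units_in G U)"
  unfolding units_in_def using openin_continuous_map_preimage[OF continuous_unit] by blast

lemma comp_neighbourhoods:
  assumes gh: "g \<in> Arr" "h \<in> Arr" "src G g = tgt G h" and V: "openin (Mor G) V" "comp G g h \<in> V"
  shows "\<exists>W N. openin (Mor G) W \<and> openin (Mor G) N \<and> g \<in> W \<and> h \<in> N \<and>
    (\<forall>w\<in>W. \<forall>n\<in>N. src G w = tgt G n \<longrightarrow> comp G w n \<in> V)"
proof -
  let ?P = "prod_topology (Mor G) (Mor G)"
  have "openin (subtopology ?P (composable G))
      {p \<in> topspace (subtopology ?P (composable G)). (\<lambda>(g, h). comp G g h) p \<in> V}"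
    using openin_continuous_map_preimage[OF continuous_comp V(1)] .
  then obtain T where T: "openin ?P T"
    "{p \<in> topspace (subtopology ?P (composable G)). (\<lambda>(g, h). comp G g h) p \<in> V} = T \<inter> composable G"
    unfolding openin_subtopology by (elim exE conjE) (rule that)
  have "(g, h) \<in> {p \<in> topspace (subtopology ?P (composable G)). (\<lambda>(g, h). comp G g h) p \<in> V}"
    using gh V by (simp add: composable_def)
  then have "(g, h) \<in> T" unfolding T(2) by blast
  then obtain W N where WN: "openin (Mor G) W" "openin (Mor G) N" "g \<in> W" "h \<in> N" "W \<times> N \<subseteq> T"
    using T(1) unfolding openin_prod_topology_alt by meson
  have "comp G w n \<in> V" if "w \<in> W" "n \<in> N" "src G w = tgt G n" for w n
  proof -
    have "(w, n) \<in> T \<inter> composable G"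
      using that WN openin_subset[OF WN(1)] openin_subset[OF WN(2)] by (auto simp: composable_def)
    then show ?thesis unfolding T(2)[symmetric] by simp
  qed
  then show ?thesis using WN by blast
qed

lemma division_neighbourhoods:
  assumes gk: "g \<in> Arr" "k \<in> Arr" "tgt G g = tgt G k"
    and V: "openin (Mor G) V" "comp G (inverse_of G g) k \<in> V"
  shows "\<exists>W N. openin (Mor G) W \<and> openin (Mor G) N \<and> g \<in> W \<and> k \<in> N \<and>
    (\<forall>w\<in>W. \<forall>n\<in>N. tgt G w = tgt G n \<longrightarrow> comp G (inverse_of G w) n \<in> V)"
proof -
  obtain W N where WN: "openin (Mor G) W" "openin (Mor G) N" "inverse_of G g \<in> W" "k \<in> N"
    "\<And>w n. w \<in> W \<Longrightarrow> n \<in> N \<Longrightarrow> src G w = tgt G n \<Longrightarrow> comp G w n \<in> V"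
    using comp_neighbourhoods[of "inverse_of G g" k V] gk V by (auto simp: arr_simps)
  have "openin (Mor G) {w \<in> Arr. inverse_of G w \<in> W}"
    using openin_continuous_map_preimage[OF continuous_inverse WN(1)] .
  then show ?thesis
    using WN gk by (intro exI[of _ "{w \<in> Arr. inverse_of G w \<in> W}"] exI[of _ N]) (auto simp: arr_simps)
qed

text \<open>For \<open>k = w v\<close> the set of \<open>a\<close> near \<open>w\<close> with \<open>comp G (inverse_of G a) n \<in> V\<close> for all
  \<open>n\<close> near \<open>k\<close> with the same target is a neighbourhood of \<open>w\<close>; its targets form an open
  set because the target map is open, and the \<open>n\<close> above that set lie in \<open>W V\<close>.\<close>

lemma openin_product_set:
  assumes W: "openin (Mor G) W" and V: "openin (Mor G) V"
  shows "openin (Mor G) (product_set G W V)"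
  unfolding openin_subopen[of "Mor G" "product_set G W V"]
proof
  fix k assume "k \<in> product_set G W V"
  then obtain w v where wv: "w \<in> W" "v \<in> V" "src G w = tgt G v" "k = comp G w v"
    by (auto simp: product_set_def)
  have "w \<in> Arr" "v \<in> Arr" using wv openin_subset[OF W] openin_subset[OF V] by blast+
  then have A: "w \<in> Arr" "v \<in> Arr" "k \<in> Arr" "tgt G w = tgt G k" "comp G (inverse_of G w) k = v"
    using wv by (simp_all add: arr_simps inverse_comp_cancel)
  obtain W' N where N: "openin (Mor G) W'" "openin (Mor G) N" "w \<in> W'" "k \<in> N"
    "\<And>a n. a \<in> W' \<Longrightarrow> n \<in> N \<Longrightarrow> tgt G a = tgt G n \<Longrightarrow> comp G (inverse_of G a) n \<in> V"
    using division_neighbourhoods[of w k V] A V wv by metis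
  define T where "T = N \<inter> {n \<in> Arr. tgt G n \<in> tgt G ` (W \<inter> W')}"
  have "openin (Obj G) (tgt G ` (W \<inter> W'))"
    using open_tgt W N(1) by (simp add: open_map_def openin_Int)
  then have "openin (Mor G) T"
    unfolding T_def using N(2) openin_tgt_preimage by blast
  moreover have "k \<in> T"
  proof -
    have "tgt G k \<in> tgt G ` (W \<inter> W')" unfolding A(4)[symmetric] using N(3) wv(1) by blast
    then show ?thesis using A(3) N(4) by (simp add: T_def)
  qed
  moreover have "T \<subseteq> product_set G W V"
  proof
    fix n assume n: "n \<in> T"
    then obtain a where a: "a \<in> W" "a \<in> W'" "tgt G n = tgt G a" "n \<in> N" "n \<in> Arr"
      by (auto simp: T_def)
    have aA: "a \<in> Arr" using a openin_subset[OF W] by blast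
    have "n = comp G a (comp G (inverse_of G a) n)" using a aA by (simp add: comp_inverse_cancel)
    moreover have "comp G (inverse_of G a) n \<in> V" using a N(5) by simp
    ultimately show "n \<in> product_set G W V"
      using a aA unfolding product_set_def
      by (intro CollectI exI[of _ a] exI[of _ "comp G (inverse_of G a) n"]) (simp add: arr_simps)
  qed
  ultimately show "\<exists>T. openin (Mor G) T \<and> k \<in> T \<and> T \<subseteq> product_set G W V" by blast
qed

text \<open>Two arrows of \<open>C\<close> with a common target lie in the same coset of \<open>U\<close>.  So \<open>C\<close> gives a local
  section of the coset space through the coset of \<open>g\<close>, and within one target fibre \<open>C\<close> pins that
  coset down.\<close>

lemma small_section:
  assumes U: "openin (Mor G) U" and g: "g \<in> Arr" "src G g \<in> units_in G U"
  shows "\<exists>C. openin (Mor G) C \<and> g \<in> C \<and> (\<forall>c\<in>C. src G c \<in> units_in G U) \<and>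
    (\<forall>a\<in>C. \<forall>b\<in>C. tgt G a = tgt G b \<longrightarrow> comp G (inverse_of G a) b \<in> U)"
proof -
  have "comp G (inverse_of G g) g \<in> U" using g by (simp add: arr_simps units_in_def)
  then obtain W N where WN: "openin (Mor G) W" "openin (Mor G) N" "g \<in> W" "g \<in> N"
    "\<forall>w\<in>W. \<forall>n\<in>N. tgt G w = tgt G n \<longrightarrow> comp G (inverse_of G w) n \<in> U"
    using division_neighbourhoods[OF g(1) g(1) refl U] by blast
  define C where "C = W \<inter> N \<inter> {g \<in> Arr. src G g \<in> units_in G U}"
  have "openin (Mor G) C"
    unfolding C_def using WN openin_src_preimage[OF openin_units_in[OF U]] by blast
  then show ?thesis using WN g by (intro exI[of _ C]) (auto simp: C_def)
qed

lemma Union_cosets_meeting: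
  assumes U: "subgroupoid G U" and W: "W \<subseteq> Arr"
  shows "\<Union> (cosets_meeting G U W) = product_set G W U"
proof (intro equalityI subsetI)
  fix h assume "h \<in> \<Union> (cosets_meeting G U W)"
  then obtain c g where c: "c \<in> left_cosets G U" "h \<in> c" "g \<in> c" "g \<in> W"
    by (auto simp: cosets_meeting_def)
  then have "h \<in> left_coset G g U" using left_cosets_memD[OF U] by blast
  then show "h \<in> product_set G W U"
    using c(4) by (auto simp: left_coset_def product_set_def) metis
next
  fix h assume "h \<in> product_set G W U"
  then obtain g u where g: "g \<in> W" "u \<in> U" "src G g = tgt G u" "h = comp G g u"
    by (auto simp: product_set_def)
  then have "src G g \<in> units_in G U" using subgroupoid_units_in[OF U] by simp
  then have "left_coset G g U \<in> cosets_meeting G U W"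
    using g W self_mem_left_coset[of g U] left_coset_in_cosets[of g U] by (auto simp: cosets_meeting_def)
  moreover have "h \<in> left_coset G g U" using g by (auto simp: left_coset_def)
  ultimately show "h \<in> \<Union> (cosets_meeting G U W)" by blast
qed

lemma openin_cosets_meeting:
  assumes "subgroupoid G U" "openin (Mor G) U" "openin (Mor G) W"
  shows "openin (coset_topology G U) (cosets_meeting G U W)"
  using assms openin_subset[OF assms(3)] openin_product_set[OF assms(3,2)]
  by (auto simp: openin_coset_topology Union_cosets_meeting) (auto simp: cosets_meeting_def)

lemma topspace_coset_topology:
  assumes "subgroupoid G U" "openin (Mor G) U"
  shows "topspace (coset_topology G U) = left_cosets G U"
proof
  show "topspace (coset_topology G U) \<subseteq> left_cosets G U"
    using openin_topspace openin_coset_topology[OF assms(1)] by blast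
  have "left_cosets G U \<subseteq> cosets_meeting G U Arr"
    using left_cosets_nonempty left_cosets_memD[OF assms(1)] by (fastforce simp: cosets_meeting_def)
  then show "left_cosets G U \<subseteq> topspace (coset_topology G U)"
    using openin_subset[OF openin_cosets_meeting[OF assms openin_topspace]] by blast
qed

lemma coset_base_image:
  assumes U: "subgroupoid G U" and \<O>: "\<O> \<subseteq> left_cosets G U"
  shows "coset_base G ` \<O> = tgt G ` \<Union>\<O>"
proof (intro equalityI subsetI)
  fix x assume "x \<in> coset_base G ` \<O>"
  then obtain c where c: "c \<in> \<O>" "x = coset_base G c" by blast
  then obtain g where g: "g \<in> c" using left_cosets_nonempty \<O> by blast
  then have "x = tgt G g" using coset_base_eq[OF U _ g] c \<O> by blast
  then show "x \<in> tgt G ` \<Union>\<O>" using c g by blast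
next
  fix x assume "x \<in> tgt G ` \<Union>\<O>"
  then obtain c g where c: "c \<in> \<O>" "g \<in> c" "x = tgt G g" by blast
  then have "coset_base G c = x" using coset_base_eq[OF U _ c(2)] \<O> by blast
  then show "x \<in> coset_base G ` \<O>" using c by blast
qed

text \<open>The projection is open because the target map is, and it is injective on the set of cosets that
  meet a set \<open>C\<close> as in \<open>small_section\<close>.\<close>

lemma etale_coset_space:
  assumes U: "subgroupoid G U" "openin (Mor G) U"
  shows "etale_space (Obj G) (coset_topology G U) (coset_base G)"
proof -
  have cont: "continuous_map (coset_topology G U) (Obj G) (coset_base G)"
    unfolding continuous_map_def
  proof (intro conjI allI impI)
    show "coset_base G \<in> topspace (coset_topology G U) \<rightarrow> topspace (Obj G)"
      using coset_base_in_Obj[OF U(1)] topspace_coset_topology[OF U] by auto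
    fix N assume N: "openin (Obj G) N"
    have "coset_base G c \<in> N \<longleftrightarrow> c \<inter> {g \<in> Arr. tgt G g \<in> N} \<noteq> {}" if c: "c \<in> left_cosets G U" for c
    proof -
      have "coset_base G c = tgt G g \<and> g \<in> Arr" if "g \<in> c" for g
        using coset_base_eq[OF U(1) c that] left_cosets_memD[OF U(1) c that] by simp
      then show ?thesis using left_cosets_nonempty[OF c] by fastforce
    qed
    then have "{c \<in> topspace (coset_topology G U). coset_base G c \<in> N} =
        cosets_meeting G U {g \<in> Arr. tgt G g \<in> N}"
      unfolding cosets_meeting_def topspace_coset_topology[OF U] by blast
    then show "openin (coset_topology G U) {c \<in> topspace (coset_topology G U). coset_base G c \<in> N}"
      using openin_cosets_meeting[OF U openin_tgt_preimage[OF N]] by simp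
  qed
  have "\<exists>S. openin (coset_topology G U) S \<and> c \<in> S \<and>
      embedding_map (subtopology (coset_topology G U) S) (Obj G) (coset_base G) \<and>
      open_map (subtopology (coset_topology G U) S) (Obj G) (coset_base G)"
    if "c \<in> topspace (coset_topology G U)" for c
  proof -
    have c: "c \<in> left_cosets G U" using that topspace_coset_topology[OF U] by simp
    then obtain g where g: "g \<in> c" using left_cosets_nonempty by blast
    obtain C where C: "openin (Mor G) C" "g \<in> C" "\<And>a. a \<in> C \<Longrightarrow> src G a \<in> units_in G U"
      "\<And>a b. a \<in> C \<Longrightarrow> b \<in> C \<Longrightarrow> tgt G a = tgt G b \<Longrightarrow> comp G (inverse_of G a) b \<in> U"
      using small_section[OF U(2) left_cosets_memD(1,2)[OF U(1) c g]] by blast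
    define S where "S = cosets_meeting G U C"
    have S: "openin (coset_topology G U) S" unfolding S_def using openin_cosets_meeting[OF U C(1)] .
    have inj: "inj_on (coset_base G) S"
    proof (rule inj_onI)
      fix d e assume de: "d \<in> S" "e \<in> S" "coset_base G d = coset_base G e"
      then obtain a b where ab: "a \<in> d" "a \<in> C" "b \<in> e" "b \<in> C" "d \<in> left_cosets G U" "e \<in> left_cosets G U"
        by (auto simp: S_def cosets_meeting_def)
      have t: "tgt G a = tgt G b" using de ab coset_base_eq[OF U(1)] by metis
      then have "comp G (inverse_of G a) b \<in> U" using C ab by blast
      then have "left_coset G b U = left_coset G a U"
        using left_coset_eq_iff[OF U(1), of a b] t ab C(3) openin_subset[OF C(1)] by auto
      then show "d = e" using left_cosets_memD(3)[OF U(1)] ab by metis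
    qed
    have op: "open_map (subtopology (coset_topology G U) S) (Obj G) (coset_base G)"
      unfolding open_map_def
    proof (intro allI impI)
      fix \<O> assume "openin (subtopology (coset_topology G U) S) \<O>"
      then have "openin (coset_topology G U) \<O>" using S openin_open_subtopology by blast
      then have "\<O> \<subseteq> left_cosets G U" "openin (Mor G) (\<Union>\<O>)"
        by (simp_all add: openin_coset_topology[OF U(1)])
      then show "openin (Obj G) (coset_base G ` \<O>)"
        using open_tgt by (simp add: coset_base_image[OF U(1)] open_map_def)
    qed
    have "embedding_map (subtopology (coset_topology G U) S) (Obj G) (coset_base G)"
      using inj op cont continuous_map_from_subtopology
      by (intro injective_open_imp_embedding_map) (auto intro: inj_on_subset)
    moreover have "c \<in> S" using c g C by (auto simp: S_def cosets_meeting_def)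
    ultimately show ?thesis using S op by blast
  qed
  then show ?thesis using cont by (simp add: etale_space_def)
qed

lemma second_countable_coset_topology:
  assumes U: "subgroupoid G U" "openin (Mor G) U" and \<B>: "countable \<B>" "base_of (Mor G) \<B>"
  shows "second_countable (coset_topology G U)"
  unfolding second_countable_def
proof (intro exI[of _ "cosets_meeting G U ` \<B>"] conjI ballI allI impI)
  show "countable (cosets_meeting G U ` \<B>)" using \<B> by simp
  show "openin (coset_topology G U) V" if "V \<in> cosets_meeting G U ` \<B>" for V
    using that openin_cosets_meeting[OF U] \<B>(2) by (auto simp: base_of_def)
  fix \<O> c assume "openin (coset_topology G U) \<O> \<and> c \<in> \<O>"
  then have \<O>: "\<O> \<subseteq> left_cosets G U" "openin (Mor G) (\<Union>\<O>)" "c \<in> \<O>"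
    by (simp_all add: openin_coset_topology[OF U(1)])
  then obtain g where g: "g \<in> c" using left_cosets_nonempty by blast
  then obtain B where B: "B \<in> \<B>" "g \<in> B" "B \<subseteq> \<Union>\<O>" using \<B>(2) \<O> unfolding base_of_def by blast
  have "cosets_meeting G U B \<subseteq> \<O>"
  proof
    fix d assume "d \<in> cosets_meeting G U B"
    then obtain a where "d \<in> left_cosets G U" "a \<in> d" "a \<in> B"
      by (auto simp: cosets_meeting_def)
    moreover from this obtain e where "e \<in> \<O>" "a \<in> e" using B(3) by blast
    ultimately show "d \<in> \<O>" using left_cosets_disjoint[OF U(1)] \<O>(1) by blast
  qed
  moreover have "c \<in> cosets_meeting G U B" using g B \<O> by (auto simp: cosets_meeting_def)
  ultimately show "\<exists>V\<in>cosets_meeting G U ` \<B>. c \<in> V \<and> V \<subseteq> \<O>" using B(1) by blast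
qed

text \<open>Move the two representatives \<open>g\<close> and \<open>g b\<close> independently to \<open>w\<close> and
  \<open>n\<close> with a common target: the quotient of \<open>w\<close> and \<open>n\<close> is close to \<open>b\<close>, hence in \<open>B\<close>.\<close>

lemma coset_rel_neighbourhoods:
  assumes U: "subgroupoid G U" "openin (Mor G) U" and V: "subgroupoid G V" "openin (Mor G) V"
    and B: "openin (Mor G) B" and R: "coset_rel G U V B c d"
  shows "\<exists>\<O> \<P>. openin (coset_topology G U) \<O> \<and> openin (coset_topology G V) \<P> \<and> c \<in> \<O> \<and> d \<in> \<P> \<and>
    (\<forall>c'\<in>\<O>. \<forall>d'\<in>\<P>. coset_base G c' = coset_base G d' \<longrightarrow> coset_rel G U V B c' d')"
proof -
  obtain g b where gb: "g \<in> Arr" "b \<in> Arr" "b \<in> B" "src G g = tgt G b" "src G g \<in> units_in G U"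
    "src G b \<in> units_in G V" "c = left_coset G g U" "d = left_coset G (comp G g b) V"
    using R by (auto simp: coset_rel_def)
  have "comp G (inverse_of G g) (comp G g b) \<in> B" using gb by (simp add: inverse_comp_cancel)
  then obtain W N where WN: "openin (Mor G) W" "openin (Mor G) N" "g \<in> W" "comp G g b \<in> N"
    "\<And>w n. w \<in> W \<Longrightarrow> n \<in> N \<Longrightarrow> tgt G w = tgt G n \<Longrightarrow> comp G (inverse_of G w) n \<in> B"
    using division_neighbourhoods[of g "comp G g b" B] gb B by (auto simp: arr_simps)
  have "coset_rel G U V B c' d'"
    if c': "c' \<in> cosets_meeting G U W" and d': "d' \<in> cosets_meeting G V N"
      and eq: "coset_base G c' = coset_base G d'" for c' d'
  proof -
    obtain w n where w: "w \<in> c'" "w \<in> W" "c' \<in> left_cosets G U" and n: "n \<in> d'" "n \<in> N" "d' \<in> left_cosets G V"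
      using c' d' by (auto simp: cosets_meeting_def)
    note w' = left_cosets_memD[OF U(1) w(3,1)] and n' = left_cosets_memD[OF V(1) n(3,1)]
    have t: "tgt G w = tgt G n" using eq coset_base_eq[OF U(1) w(3,1)] coset_base_eq[OF V(1) n(3,1)] by simp
    then show ?thesis
      unfolding coset_rel_def using w w' n n' WN(5)
      by (intro exI[of _ w] exI[of _ "comp G (inverse_of G w) n"])
        (simp add: arr_simps comp_inverse_cancel)
  qed
  moreover have "c \<in> cosets_meeting G U W"
    using gb WN self_mem_left_coset left_coset_in_cosets by (auto simp: cosets_meeting_def)
  moreover have "d \<in> cosets_meeting G V N"
  proof -
    have "comp G g b \<in> Arr" "src G (comp G g b) \<in> units_in G V" using gb by (simp_all add: arr_simps)
    then show ?thesis
      using gb WN self_mem_left_coset left_coset_in_cosets by (auto simp: cosets_meeting_def)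
  qed
  ultimately show ?thesis
    using openin_cosets_meeting[OF U WN(1)] openin_cosets_meeting[OF V WN(2)]
    by (intro exI[of _ "cosets_meeting G U W"] exI[of _ "cosets_meeting G V N"]) blast
qed

end

section \<open>Isomorphisms between fibres of coset spaces are translations\<close>

definition cosets_over :: "('o, 'm) groupoid \<Rightarrow> 'o \<Rightarrow> 'm set \<Rightarrow> 'm set set" where
  "cosets_over G x U = {c \<in> left_cosets G U. coset_base G c = x}"

text \<open>The data from which the structure is built: \<open>\<U>\<close> gives the sorts, \<open>\<B>\<close> the relations;
  \<open>\<W>\<close> are the tasks of the completeness property of the arrow space.\<close>

locale coset_geometry = open_topological_groupoid G
  for G :: "('o, 'm) groupoid" +
  fixes \<U> \<B> :: "'m set set" and \<W> :: "('m set \<times> 'm set set) set" and \<X> :: "'o set set"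
  assumes subgroupoid: "U \<in> \<U> \<Longrightarrow> subgroupoid G U"
    and open_subgroupoid: "U \<in> \<U> \<Longrightarrow> openin (Mor G) U"
    and unit_neighbourhood: "x \<in> topspace (Obj G) \<Longrightarrow> openin (Mor G) N \<Longrightarrow> unit_of G x \<in> N \<Longrightarrow>
      \<exists>U\<in>\<U>. unit_of G x \<in> U \<and> U \<subseteq> N"
    and countable_\<U>: "countable \<U>"
    and base_Mor: "base_of (Mor G) \<B>" "countable \<B>"
    and base_Obj: "base_of (Obj G) \<X>" "countable \<X>"
    and t0_Obj: "t0_space (Obj G)"
    and t0_Mor: "t0_space (Mor G)"
    and countable_\<W>: "countable \<W>"
    and covers: "(W, \<C>) \<in> \<W> \<Longrightarrow> W \<subseteq> \<Union>\<C>" "(W, \<C>) \<in> \<W> \<Longrightarrow> C \<in> \<C> \<Longrightarrow> openin (Mor G) C"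
    and convergence: "\<And>H :: nat \<Rightarrow> 'm set. decseq H \<Longrightarrow> (\<And>n. H n \<in> \<B>) \<Longrightarrow> (\<And>n. H n \<noteq> {}) \<Longrightarrow>
      (\<And>W \<C>. (W, \<C>) \<in> \<W> \<Longrightarrow> \<exists>n. H n \<subseteq> W \<Longrightarrow> \<exists>n. \<exists>C\<in>\<C>. H n \<subseteq> C) \<Longrightarrow>
      \<exists>g. (\<forall>n. g \<in> H n) \<and> (\<forall>V. openin (Mor G) V \<and> g \<in> V \<longrightarrow> (\<exists>n. H n \<subseteq> V))"
begin

lemma base_Mor_open: "B \<in> \<B> \<Longrightarrow> openin (Mor G) B"
  using base_Mor(1) by (simp add: base_of_def)

lemma base_Mor_neighbourhood:
  assumes "openin (Mor G) V" "g \<in> V"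
  obtains B where "B \<in> \<B>" "g \<in> B" "B \<subseteq> V"
  using base_Mor(1) assms unfolding base_of_def by blast

lemma \<U>_arr: "U \<in> \<U> \<Longrightarrow> U \<subseteq> Arr"
  using subgroupoid by (simp add: subgroupoid_def)

lemma cosets_over_memD:
  assumes "U \<in> \<U>" "c \<in> cosets_over G x U" "g \<in> c"
  shows "g \<in> Arr" "src G g \<in> units_in G U" "tgt G g = x" "c = left_coset G g U"
  using left_cosets_memD[OF subgroupoid[OF assms(1)] _ assms(3)]
    coset_base_eq[OF subgroupoid[OF assms(1)] _ assms(3)] assms(2)
  by (auto simp: cosets_over_def)

lemma cosets_over_nonempty: "c \<in> cosets_over G x U \<Longrightarrow> \<exists>g. g \<in> c"
  using left_cosets_nonempty by (auto simp: cosets_over_def)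

lemma left_coset_in_cosets_over:
  "U \<in> \<U> \<Longrightarrow> g \<in> Arr \<Longrightarrow> src G g \<in> units_in G U \<Longrightarrow> tgt G g = x \<Longrightarrow> left_coset G g U \<in> cosets_over G x U"
  by (simp add: cosets_over_def left_coset_in_cosets coset_base_left_coset subgroupoid)

end

text \<open>Up to the precision \<open>V\<close>, the map \<open>f\<close> carries the arrow \<open>h\<close> to the arrow \<open>k\<close>.
  The sources of \<open>h\<close> and \<open>k\<close> may still differ.\<close>

definition matches ::
  "('o, 'm) groupoid \<Rightarrow> ('m set \<Rightarrow> 'm set \<Rightarrow> 'm set) \<Rightarrow> 'm set \<Rightarrow> 'm \<Rightarrow> 'm \<Rightarrow> bool" where
  "matches G f V h k \<longleftrightarrow> h \<in> topspace (Mor G) \<and> k \<in> topspace (Mor G) \<and>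
     src G h \<in> units_in G V \<and> src G k \<in> units_in G V \<and> f V (left_coset G h V) = left_coset G k V"

text \<open>An isomorphism from the fibre over \<open>x\<close> to the fibre over \<open>y\<close>, with the sorts taken to be the
  subgroupoids themselves.\<close>

locale coset_isomorphism = coset_geometry +
  fixes x y :: 'a and f :: "'b set \<Rightarrow> 'b set \<Rightarrow> 'b set"
  assumes bij: "U \<in> \<U> \<Longrightarrow> bij_betw (f U) (cosets_over G x U) (cosets_over G y U)"
    and rel: "U \<in> \<U> \<Longrightarrow> V \<in> \<U> \<Longrightarrow> B \<in> \<B> \<Longrightarrow> c \<in> cosets_over G x U \<Longrightarrow> d \<in> cosets_over G x V \<Longrightarrow>
      coset_rel G U V B c d \<longleftrightarrow> coset_rel G U V B (f U c) (f V d)"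
    and base_points: "x \<in> topspace (Obj G)" "y \<in> topspace (Obj G)"
begin

definition inv_f :: "'b set \<Rightarrow> 'b set \<Rightarrow> 'b set" where
  "inv_f U = inv_into (cosets_over G x U) (f U)"

lemma f_inv_f: "U \<in> \<U> \<Longrightarrow> c \<in> cosets_over G y U \<Longrightarrow> f U (inv_f U c) = c"
  unfolding inv_f_def using bij by (meson bij_betw_inv_into_right)

lemma inv_f_f: "U \<in> \<U> \<Longrightarrow> c \<in> cosets_over G x U \<Longrightarrow> inv_f U (f U c) = c"
  unfolding inv_f_def using bij by (meson bij_betw_inv_into_left)

lemma f_in: "U \<in> \<U> \<Longrightarrow> c \<in> cosets_over G x U \<Longrightarrow> f U c \<in> cosets_over G y U"
  using bij bij_betwE by blast

lemma inv_f_in: "U \<in> \<U> \<Longrightarrow> c \<in> cosets_over G y U \<Longrightarrow> inv_f U c \<in> cosets_over G x U"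
  unfolding inv_f_def using bij bij_betw_inv_into bij_betwE by blast

text \<open>The construction below treats \<open>x\<close> and \<open>y\<close> alternately; this symmetry halves the work.\<close>

lemma coset_isomorphism_inverse: "coset_isomorphism G \<U> \<B> \<W> \<X> y x inv_f"
proof
  show "bij_betw (inv_f U) (cosets_over G y U) (cosets_over G x U)" if "U \<in> \<U>" for U
    unfolding inv_f_def using bij[OF that] by (rule bij_betw_inv_into)
  show "coset_rel G U V B c d \<longleftrightarrow> coset_rel G U V B (inv_f U c) (inv_f V d)"
    if "U \<in> \<U>" "V \<in> \<U>" "B \<in> \<B>" "c \<in> cosets_over G y U" "d \<in> cosets_over G y V" for U V B c d
    using rel[OF that(1-3) inv_f_in[OF that(1,4)] inv_f_in[OF that(2,5)]] that by (simp add: f_inv_f)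
qed (rule base_points)+

lemma matches_tgt:
  assumes "V \<in> \<U>" "tgt G h = x" "matches G f V h k"
  shows "tgt G k = y"
proof -
  have "left_coset G k V \<in> cosets_over G y V"
    using f_in[OF assms(1)] left_coset_in_cosets_over[OF assms(1)] assms unfolding matches_def by metis
  then show ?thesis
    using assms cosets_over_memD(3)[OF assms(1)] self_mem_left_coset unfolding matches_def by metis
qed

lemma matches_inverse:
  assumes "V \<in> \<U>" "tgt G h = x" "matches G f V h k"
  shows "matches G inv_f V k h"
  using assms inv_f_f[OF assms(1) left_coset_in_cosets_over[OF assms(1)]]
  unfolding matches_def by metis

lemma inverse_matches:
  assumes "V \<in> \<U>" "tgt G k = y" "matches G inv_f V k h"
  shows "matches G f V h k"
proof -
  have "inv_f V (left_coset G k V) = left_coset G h V" using assms by (simp add: matches_def)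
  then have "f V (left_coset G h V) = left_coset G k V"
    using f_inv_f[OF assms(1)] left_coset_in_cosets_over[OF assms(1)] assms unfolding matches_def by metis
  then show ?thesis using assms by (simp add: matches_def)
qed

lemma match_exists:
  assumes "V \<in> \<U>" "h \<in> Arr" "tgt G h = x" "src G h \<in> units_in G V"
  shows "\<exists>k. matches G f V h k"
proof -
  have c: "f V (left_coset G h V) \<in> cosets_over G y V"
    using f_in left_coset_in_cosets_over assms by blast
  then obtain k where k: "k \<in> f V (left_coset G h V)" using cosets_over_nonempty by blast
  then show ?thesis using cosets_over_memD[OF assms(1) c k] assms by (auto simp: matches_def)
qed

text \<open>The cosets of \<open>h\<close> and \<open>h b\<close> are related through any basic \<open>B\<close> around \<open>b\<close>.
  Hence so are their images, which means that \<open>f\<close> moves \<open>h b\<close> to the coset of \<open>k' b'\<close>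
  with \<open>k'\<close> as good as \<open>k\<close> and \<open>b'\<close> as close to \<open>b\<close> as desired.\<close>

lemma transport:
  assumes V: "V \<in> \<U>" and hk: "tgt G h = x" "matches G f V h k"
    and U: "U \<in> \<U>" and b: "b \<in> Arr" "src G h = tgt G b" "src G b \<in> units_in G U"
    and N: "openin (Mor G) N" "b \<in> N"
  shows "\<exists>k' b'. k' \<in> left_coset G k V \<and> b' \<in> N \<and> b' \<in> Arr \<and> src G k' = tgt G b' \<and>
    src G b' \<in> units_in G U \<and> f U (left_coset G (comp G h b) U) = left_coset G (comp G k' b') U"
proof -
  obtain B where B: "B \<in> \<B>" "b \<in> B" "B \<subseteq> N" using base_Mor_neighbourhood N by blast
  have h: "h \<in> Arr" "src G h \<in> units_in G V" using hk by (simp_all add: matches_def)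
  have "coset_rel G V U B (left_coset G h V) (left_coset G (comp G h b) U)"
    unfolding coset_rel_def using h b B by blast
  moreover have "left_coset G h V \<in> cosets_over G x V" using left_coset_in_cosets_over V h hk by blast
  moreover have "left_coset G (comp G h b) U \<in> cosets_over G x U"
    using U h hk b by (intro left_coset_in_cosets_over) (simp_all add: arr_simps)
  ultimately have "coset_rel G V U B (left_coset G k V) (f U (left_coset G (comp G h b) U))"
    using rel V U B hk unfolding matches_def by metis
  then obtain k' b' where k': "k' \<in> Arr" "b' \<in> Arr" "b' \<in> B" "src G k' = tgt G b'" "src G k' \<in> units_in G V"
    "src G b' \<in> units_in G U" "left_coset G k V = left_coset G k' V"
    "f U (left_coset G (comp G h b) U) = left_coset G (comp G k' b') U"
    unfolding coset_rel_def by blast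
  moreover have "k' \<in> left_coset G k V" using k' self_mem_left_coset by simp
  ultimately show ?thesis using B(3) by blast
qed

text \<open>Since \<open>V \<subseteq> U\<close>, the coset of \<open>h\<close> for \<open>V\<close> lies in that for \<open>U\<close>, and \<open>f\<close>
  respects this: apply \<open>transport\<close> to a unit, which keeps \<open>b'\<close> inside \<open>U\<close>.\<close>

lemma matches_mono:
  assumes V: "V \<in> \<U>" and hk: "tgt G h = x" "matches G f V h k" and U: "U \<in> \<U>" "V \<subseteq> U"
  shows "matches G f U h k"
proof -
  have a: "h \<in> Arr" "k \<in> Arr" "src G h \<in> units_in G U" "src G k \<in> units_in G U"
    using hk U by (auto simp: matches_def units_in_def)
  have "unit_of G (src G h) \<in> U" using a by (simp add: units_in_def)
  then obtain k' b' where k': "k' \<in> left_coset G k V" "b' \<in> U" "src G k' = tgt G b'" "src G b' \<in> units_in G U"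
    "f U (left_coset G (comp G h (unit_of G (src G h))) U) = left_coset G (comp G k' b') U"
    using transport[OF V hk U(1), of "unit_of G (src G h)" U] open_subgroupoid[OF U(1)] a
    by (auto simp: arr_simps)
  have k'U: "k' \<in> left_coset G k U" using k'(1) left_coset_mono[OF U(2)] by blast
  have "left_coset G k' U = left_coset G k U"
    using left_coset_eqI[OF subgroupoid[OF U(1)] a(2) k'U] .
  moreover have "comp G k' b' \<in> left_coset G k' U"
    using k' unfolding left_coset_def by auto
  ultimately have "left_coset G (comp G k' b') U = left_coset G k U"
    using left_coset_eqI[OF subgroupoid[OF U(1)] a(2)] by simp
  then show ?thesis using a k' by (simp add: matches_def arr_simps)
qed

text \<open>A match can be made finer without moving \<open>h\<close>, at the price of moving \<open>k\<close> inside its old coset.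
  The new coset of \<open>h\<close> becomes small, but nothing is said about that of \<open>k'\<close>: the latter
  is shrunk by the same lemma for the inverse isomorphism, which in turn moves \<open>h\<close>.\<close>

lemma refine_match:
  assumes V: "V \<in> \<U>" and hk: "tgt G h = x" "matches G f V h k"
    and W: "openin (Mor G) W" "h \<in> W" and N: "openin (Mor G) N" "unit_of G (src G h) \<in> N"
  shows "\<exists>V'\<in>\<U>. \<exists>k'. k' \<in> left_coset G k V \<and> matches G f V' h k' \<and> V' \<subseteq> V \<and> V' \<subseteq> N \<and> left_coset G h V' \<subseteq> W"
proof -
  have h: "h \<in> Arr" "src G h \<in> units_in G V" using hk by (simp_all add: matches_def)
  let ?u = "unit_of G (src G h)"
  have u: "?u \<in> Arr" "src G h = tgt G ?u" "comp G h ?u = h" "?u \<in> V"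
    using h by (simp_all add: arr_simps units_in_def)
  obtain W' N' where WN: "openin (Mor G) W'" "openin (Mor G) N'" "h \<in> W'" "?u \<in> N'"
    "\<And>w n. w \<in> W' \<Longrightarrow> n \<in> N' \<Longrightarrow> src G w = tgt G n \<Longrightarrow> comp G w n \<in> W"
    using comp_neighbourhoods[OF h(1) u(1,2) W(1)] u W by metis
  have "openin (Mor G) (V \<inter> N \<inter> N')" using open_subgroupoid[OF V] N WN by blast
  moreover have "src G h \<in> topspace (Obj G)" using h by (simp add: arr_simps)
  ultimately obtain V' where V': "V' \<in> \<U>" "?u \<in> V'" "V' \<subseteq> V \<inter> N \<inter> N'"
    using unit_neighbourhood[of "src G h" "V \<inter> N \<inter> N'"] u N WN by blast
  then obtain k' where k': "matches G f V' h k'"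
    using match_exists[of V' h] h hk by (auto simp: units_in_def arr_simps)
  then have "matches G f V h k'" using matches_mono[OF V'(1) hk(1)] V V' by blast
  then have "k' \<in> left_coset G k V" using self_mem_left_coset[of k' V] hk by (simp add: matches_def)
  moreover have "left_coset G h V' \<subseteq> W"
    using V' WN by (auto simp: left_coset_def)
  ultimately show ?thesis using k' V' by blast
qed

text \<open>The forcing conditions for a pair of arrows \<open>h \<in> H\<close> and \<open>k \<in> K\<close>.  It is not enough to ask
  for a matching pair of arrows: whole cosets must fit into \<open>H\<close> and \<open>K\<close>, so that there is room
  for the moves of \<open>refine_match\<close>.\<close>

definition compatible :: "'b set \<Rightarrow> 'b set \<Rightarrow> bool" where
  "compatible H K \<longleftrightarrow> (\<exists>V\<in>\<U>. \<exists>h k. tgt G h = x \<and> matches G f V h k \<and>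
     left_coset G h V \<subseteq> H \<and> left_coset G k V \<subseteq> K)"

text \<open>A guarantee that any \<open>h \<in> H\<close> over \<open>x\<close> and \<open>k \<in> K\<close> over \<open>y\<close> match with respect
  to \<open>U\<close>.\<close>

definition captured :: "'b set \<Rightarrow> 'b set \<Rightarrow> 'b set \<Rightarrow> bool" where
  "captured U H K \<longleftrightarrow> (\<exists>c\<in>cosets_over G x U.
     (\<forall>h\<in>H. tgt G h = x \<longrightarrow> h \<in> c) \<and> (\<forall>k\<in>K. tgt G k = y \<longrightarrow> k \<in> f U c))"

lemma coset_subset:
  assumes "V \<in> \<U>" "V' \<subseteq> V" "g \<in> Arr" "g' \<in> left_coset G g V"
  shows "left_coset G g' V' \<subseteq> left_coset G g V"
  using left_coset_mono[OF assms(2), of g'] left_coset_eqI[OF subgroupoid[OF assms(1)] assms(3,4)] by simp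

lemma compatible_shrink_left:
  assumes V: "V \<in> \<U>" and hk: "tgt G h = x" "matches G f V h k"
    and W: "openin (Mor G) W" "h \<in> W" and K: "openin (Mor G) K" "left_coset G k V \<subseteq> K"
  shows "\<exists>H'\<in>\<B>. \<exists>K'\<in>\<B>. compatible H' K' \<and> H' \<subseteq> W \<and> K' \<subseteq> K"
proof -
  interpret inv: coset_isomorphism G \<U> \<B> \<W> \<X> y x inv_f by (rule coset_isomorphism_inverse)
  have A: "h \<in> Arr" "k \<in> Arr" "unit_of G (src G h) \<in> V" using hk by (simp_all add: matches_def units_in_def)
  obtain H' where H': "H' \<in> \<B>" "h \<in> H'" "H' \<subseteq> W" using base_Mor_neighbourhood W by blast
  obtain V' k' where V': "V' \<in> \<U>" "k' \<in> left_coset G k V" "matches G f V' h k'" "V' \<subseteq> V" "left_coset G h V' \<subseteq> H'"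
    using refine_match[OF V hk base_Mor_open[OF H'(1)] H'(2) open_subgroupoid[OF V] A(3)] by blast
  obtain K' where K': "K' \<in> \<B>" "k' \<in> K'" "K' \<subseteq> K" using base_Mor_neighbourhood K V'(2) by blast
  have k': "tgt G k' = y" "matches G inv_f V' k' h"
    using matches_tgt[OF V'(1) hk(1) V'(3)] matches_inverse[OF V'(1) hk(1) V'(3)] .
  have "unit_of G (src G k') \<in> V'" using V'(3) by (simp add: matches_def units_in_def)
  then obtain V'' h' where V'': "V'' \<in> \<U>" "h' \<in> left_coset G h V'" "matches G inv_f V'' k' h'" "V'' \<subseteq> V'"
    "left_coset G k' V'' \<subseteq> K'"
    using inv.refine_match[OF V'(1) k' base_Mor_open[OF K'(1)] K'(2) open_subgroupoid[OF V'(1)]] by blast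
  have h': "tgt G h' = x" using inv.matches_tgt[OF V''(1) k'(1) V''(3)] .
  have "matches G f V'' h' k'" using inverse_matches[OF V''(1) k'(1) V''(3)] .
  moreover have "left_coset G h' V'' \<subseteq> H'"
    using coset_subset[OF V'(1) V''(4) A(1) V''(2)] V'(5) by blast
  ultimately have "compatible H' K'" unfolding compatible_def using V'' h' by blast
  then show ?thesis using H' K' by blast
qed

lemma compatible_shrink:
  assumes HK: "compatible H K" "openin (Mor G) H" "openin (Mor G) K"
    and cover: "\<And>h. h \<in> H \<Longrightarrow> tgt G h = x \<Longrightarrow> \<exists>C\<in>\<C>. h \<in> C" "\<And>C. C \<in> \<C> \<Longrightarrow> openin (Mor G) C"
  shows "\<exists>H'\<in>\<B>. \<exists>K'\<in>\<B>. compatible H' K' \<and> H' \<subseteq> H \<and> K' \<subseteq> K \<and> (\<exists>C\<in>\<C>. H' \<subseteq> C)"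
proof -
  obtain V h k where V: "V \<in> \<U>" "tgt G h = x" "matches G f V h k" "left_coset G h V \<subseteq> H" "left_coset G k V \<subseteq> K"
    using HK(1) unfolding compatible_def by blast
  have h: "h \<in> H" using V self_mem_left_coset by (auto simp: matches_def)
  then obtain C where C: "C \<in> \<C>" "h \<in> C" using cover(1) V(2) by blast
  then show ?thesis
    using compatible_shrink_left[OF V(1-3) openin_Int[OF HK(2) cover(2)[OF C(1)]] _ HK(3) V(5)] h by blast
qed

text \<open>Alternate refinements: the first makes the match fine enough for \<open>U\<close>; the second fits the
  coset of \<open>k1\<close> into a set \<open>K'\<close> that meets the fibre over \<open>y\<close> inside one coset of \<open>U\<close>; the
  third fits the coset of \<open>h2\<close> into an analogous \<open>H'\<close>.  From the first step on all moves stay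
  inside cosets of \<open>U\<close>, so the two captured cosets correspond under \<open>f\<close>.\<close>

lemma compatible_capture:
  assumes HK: "compatible H K" "openin (Mor G) H" "openin (Mor G) K"
    and U: "U \<in> \<U>" and HU: "\<And>h. h \<in> H \<Longrightarrow> src G h \<in> units_in G U"
  shows "\<exists>H'\<in>\<B>. \<exists>K'\<in>\<B>. compatible H' K' \<and> H' \<subseteq> H \<and> K' \<subseteq> K \<and> captured U H' K'"
proof -
  interpret inv: coset_isomorphism G \<U> \<B> \<W> \<X> y x inv_f by (rule coset_isomorphism_inverse)
  obtain V h k where V: "V \<in> \<U>" "tgt G h = x" "matches G f V h k" "left_coset G h V \<subseteq> H" "left_coset G k V \<subseteq> K"
    using HK(1) unfolding compatible_def by blast
  have h: "h \<in> H" "h \<in> Arr" "k \<in> Arr" using V self_mem_left_coset by (auto simp: matches_def)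
  then have hU: "unit_of G (src G h) \<in> U" using HU by (simp add: units_in_def)
  obtain V1 k1 where V1: "V1 \<in> \<U>" "k1 \<in> left_coset G k V" "matches G f V1 h k1" "V1 \<subseteq> V" "V1 \<subseteq> U"
      "left_coset G h V1 \<subseteq> H"
    using refine_match[OF V(1-3) HK(2) h(1) open_subgroupoid[OF U] hU] by blast
  have k1: "k1 \<in> Arr" "src G k1 \<in> units_in G V1" "src G k1 \<in> units_in G U" "tgt G k1 = y" "k1 \<in> K"
    using V1 V(5) matches_tgt[OF V1(1) V(2) V1(3)] by (auto simp: matches_def units_in_def)
  obtain C where C: "openin (Mor G) C" "k1 \<in> C"
    "\<And>a b. a \<in> C \<Longrightarrow> b \<in> C \<Longrightarrow> tgt G a = tgt G b \<Longrightarrow> comp G (inverse_of G a) b \<in> U"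
    using small_section[OF open_subgroupoid[OF U] k1(1,3)] by blast
  obtain K' where K': "K' \<in> \<B>" "k1 \<in> K'" "K' \<subseteq> K \<inter> C"
    using base_Mor_neighbourhood[OF openin_Int[OF HK(3) C(1)]] k1 C by blast
  have u1: "unit_of G (src G k1) \<in> V1" using k1(2) by (simp add: units_in_def)
  obtain V2 h2 where V2: "V2 \<in> \<U>" "h2 \<in> left_coset G h V1" "matches G inv_f V2 k1 h2" "V2 \<subseteq> V1"
      "left_coset G k1 V2 \<subseteq> K'"
    using inv.refine_match[OF V1(1) k1(4) matches_inverse[OF V1(1) V(2) V1(3)]
        base_Mor_open[OF K'(1)] K'(2) open_subgroupoid[OF V1(1)] u1] by blast
  have m2: "matches G f V2 h2 k1" using inverse_matches[OF V2(1) k1(4) V2(3)] .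
  have h2: "h2 \<in> Arr" "src G h2 \<in> units_in G V2" "src G h2 \<in> units_in G U" "tgt G h2 = x" "h2 \<in> H"
    using m2 V1 V2 inv.matches_tgt[OF V2(1) k1(4) V2(3)] by (auto simp: matches_def units_in_def)
  have m2U: "matches G f U h2 k1"
    using matches_mono[OF V2(1) h2(4) m2 U] V2 V1 by blast
  obtain D where D: "openin (Mor G) D" "h2 \<in> D"
    "\<And>a b. a \<in> D \<Longrightarrow> b \<in> D \<Longrightarrow> tgt G a = tgt G b \<Longrightarrow> comp G (inverse_of G a) b \<in> U"
    using small_section[OF open_subgroupoid[OF U] h2(1,3)] by blast
  obtain H' where H': "H' \<in> \<B>" "h2 \<in> H'" "H' \<subseteq> H \<inter> D"
    using base_Mor_neighbourhood[OF openin_Int[OF HK(2) D(1)]] h2 D by blast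
  have u2: "unit_of G (src G h2) \<in> V2" using h2(2) by (simp add: units_in_def)
  obtain V3 k3 where V3: "V3 \<in> \<U>" "k3 \<in> left_coset G k1 V2" "matches G f V3 h2 k3" "V3 \<subseteq> V2"
      "left_coset G h2 V3 \<subseteq> H'"
    using refine_match[OF V2(1) h2(4) m2 base_Mor_open[OF H'(1)] H'(2) open_subgroupoid[OF V2(1)] u2] by blast
  have "left_coset G k3 V3 \<subseteq> K'"
    using coset_subset[OF V2(1) V3(4) k1(1) V3(2)] V2(5) by blast
  then have "compatible H' K'" unfolding compatible_def using V3 h2(4) by blast
  moreover have "captured U H' K'"
    unfolding captured_def
  proof (intro bexI[of _ "left_coset G h2 U"] conjI ballI impI)
    show "left_coset G h2 U \<in> cosets_over G x U" using left_coset_in_cosets_over U h2 by blast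
    show "a \<in> left_coset G h2 U" if "a \<in> H'" "tgt G a = x" for a
      using that H' D h2 mem_left_coset_iff[OF h2(1) \<U>_arr[OF U]] openin_subset[OF D(1)] by auto
    show "a \<in> f U (left_coset G h2 U)" if "a \<in> K'" "tgt G a = y" for a
      using that K' C k1 mem_left_coset_iff[OF k1(1) \<U>_arr[OF U]] openin_subset[OF C(1)] m2U
      by (auto simp: matches_def)
  qed
  ultimately show ?thesis using H' K' by blast
qed

lemma compatible_inverse:
  "coset_isomorphism.compatible G \<U> y inv_f K H \<longleftrightarrow> compatible H K"
proof -
  interpret inv: coset_isomorphism G \<U> \<B> \<W> \<X> y x inv_f by (rule coset_isomorphism_inverse)
  have "inv.compatible K H" if "compatible H K"
  proof -
    obtain V h k where "V \<in> \<U>" "tgt G h = x" "matches G f V h k" "left_coset G h V \<subseteq> H" "left_coset G k V \<subseteq> K"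
      using \<open>compatible H K\<close> unfolding compatible_def by blast
    then show ?thesis
      unfolding inv.compatible_def using matches_tgt[of V h k] matches_inverse[of V h k] by blast
  qed
  moreover have "compatible H K" if "inv.compatible K H"
  proof -
    obtain V h k where "V \<in> \<U>" "tgt G k = y" "matches G inv_f V k h" "left_coset G h V \<subseteq> H" "left_coset G k V \<subseteq> K"
      using \<open>inv.compatible K H\<close> unfolding inv.compatible_def by blast
    then show ?thesis
      unfolding compatible_def using inv.matches_tgt[of V k h] inverse_matches[of V k h] by blast
  qed
  ultimately show ?thesis by blast
qed

lemma captured_inverse:
  assumes "U \<in> \<U>" "coset_isomorphism.captured G y x inv_f U K H"
  shows "captured U H K"
proof -
  interpret inv: coset_isomorphism G \<U> \<B> \<W> \<X> y x inv_f by (rule coset_isomorphism_inverse)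
  obtain c where "c \<in> cosets_over G y U" "\<forall>k\<in>K. tgt G k = y \<longrightarrow> k \<in> c" "\<forall>h\<in>H. tgt G h = x \<longrightarrow> h \<in> inv_f U c"
    using assms(2) unfolding inv.captured_def by blast
  then show ?thesis
    unfolding captured_def using inv_f_in[OF assms(1)] f_inv_f[OF assms(1)]
    by (intro bexI[of _ "inv_f U c"]) simp_all
qed

lemma compatible_shrink_right:
  assumes HK: "compatible H K" "openin (Mor G) H" "openin (Mor G) K"
    and cover: "\<And>k. k \<in> K \<Longrightarrow> tgt G k = y \<Longrightarrow> \<exists>C\<in>\<C>. k \<in> C" "\<And>C. C \<in> \<C> \<Longrightarrow> openin (Mor G) C"
  shows "\<exists>H'\<in>\<B>. \<exists>K'\<in>\<B>. compatible H' K' \<and> H' \<subseteq> H \<and> K' \<subseteq> K \<and> (\<exists>C\<in>\<C>. K' \<subseteq> C)"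
proof -
  interpret inv: coset_isomorphism G \<U> \<B> \<W> \<X> y x inv_f by (rule coset_isomorphism_inverse)
  show ?thesis
    using inv.compatible_shrink[OF HK(1)[folded compatible_inverse] HK(3,2) cover]
    unfolding compatible_inverse by blast
qed

lemma compatible_capture_right:
  assumes HK: "compatible H K" "openin (Mor G) H" "openin (Mor G) K"
    and U: "U \<in> \<U>" and KU: "\<And>k. k \<in> K \<Longrightarrow> src G k \<in> units_in G U"
  shows "\<exists>H'\<in>\<B>. \<exists>K'\<in>\<B>. compatible H' K' \<and> H' \<subseteq> H \<and> K' \<subseteq> K \<and> captured U H' K'"
proof -
  interpret inv: coset_isomorphism G \<U> \<B> \<W> \<X> y x inv_f by (rule coset_isomorphism_inverse)
  show ?thesis
    using inv.compatible_capture[OF HK(1)[folded compatible_inverse] HK(3,2) U KU]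
      captured_inverse[OF U] unfolding compatible_inverse by blast
qed

lemma compatible_whole: "compatible Arr Arr"
proof -
  let ?u = "unit_of G x"
  have u: "?u \<in> Arr" "tgt G ?u = x" "src G ?u = x" using base_points by (simp_all add: arr_simps)
  obtain V where V: "V \<in> \<U>" "?u \<in> V"
    using unit_neighbourhood[OF base_points(1) openin_topspace u(1)] by blast
  then obtain k where k: "matches G f V ?u k"
    using match_exists[of V ?u] u base_points by (auto simp: units_in_def)
  moreover have "left_coset G g V \<subseteq> Arr" if "g \<in> Arr" for g
    using mem_left_coset_iff[OF that \<U>_arr[OF V(1)]] by blast
  moreover have "k \<in> Arr" using k by (simp add: matches_def)
  ultimately show ?thesis unfolding compatible_def using V u by blast
qed

lemma compatible_nonempty:
  assumes "compatible H K"
  shows "\<exists>h\<in>H. tgt G h = x" "\<exists>k\<in>K. tgt G k = y"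
proof -
  obtain V h k where V: "V \<in> \<U>" "tgt G h = x" "matches G f V h k" "left_coset G h V \<subseteq> H" "left_coset G k V \<subseteq> K"
    using assms unfolding compatible_def by blast
  have "h \<in> H" "k \<in> K"
    using V(3-5) self_mem_left_coset[of h V] self_mem_left_coset[of k V] by (auto simp: matches_def)
  then show "\<exists>h\<in>H. tgt G h = x" "\<exists>k\<in>K. tgt G k = y"
    using matches_tgt[OF V(1-3)] V(2) by blast+
qed

text \<open>The tasks, for each of the two sequences: convergence, a target in each basic neighbourhood of the
  prescribed point, and capture for each \<open>U\<close> once the sources lie in \<open>units_in G U\<close>.\<close>

lemma generic_pair:
  obtains H K :: "nat \<Rightarrow> 'b set"
  where "decseq H" "decseq K"
    and "\<And>n. H n \<in> \<B>" "\<And>n. K n \<in> \<B>" "\<And>n. compatible (H n) (K n)"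
    and "\<And>W \<C>. (W, \<C>) \<in> \<W> \<Longrightarrow> \<exists>n. H n \<subseteq> W \<Longrightarrow> \<exists>n. \<exists>C\<in>\<C>. H n \<subseteq> C"
    and "\<And>W \<C>. (W, \<C>) \<in> \<W> \<Longrightarrow> \<exists>n. K n \<subseteq> W \<Longrightarrow> \<exists>n. \<exists>C\<in>\<C>. K n \<subseteq> C"
    and "\<And>N. N \<in> \<X> \<Longrightarrow> x \<in> N \<Longrightarrow> \<exists>n. H n \<subseteq> {g \<in> Arr. tgt G g \<in> N}"
    and "\<And>N. N \<in> \<X> \<Longrightarrow> y \<in> N \<Longrightarrow> \<exists>n. K n \<subseteq> {g \<in> Arr. tgt G g \<in> N}"
    and "\<And>U. U \<in> \<U> \<Longrightarrow> \<exists>n. H n \<subseteq> {g \<in> Arr. src G g \<in> units_in G U} \<Longrightarrow> \<exists>n. captured U (H n) (K n)"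
    and "\<And>U. U \<in> \<U> \<Longrightarrow> \<exists>n. K n \<subseteq> {g \<in> Arr. src G g \<in> units_in G U} \<Longrightarrow> \<exists>n. captured U (H n) (K n)"
proof -
  define P where "P = {(H, K). H \<in> \<B> \<and> K \<in> \<B> \<and> compatible H K}"
  define le where "le = (\<lambda>p q :: 'b set \<times> 'b set. fst p \<subseteq> fst q \<and> snd p \<subseteq> snd q)"
  define Q1 where "Q1 = (\<lambda>(W, \<C>). (\<lambda>p :: 'b set \<times> 'b set. fst p \<subseteq> W, \<lambda>p :: 'b set \<times> 'b set. \<exists>C\<in>\<C>. fst p \<subseteq> C)) ` \<W>"
  define Q2 where "Q2 = (\<lambda>(W, \<C>). (\<lambda>p :: 'b set \<times> 'b set. snd p \<subseteq> W, \<lambda>p :: 'b set \<times> 'b set. \<exists>C\<in>\<C>. snd p \<subseteq> C)) ` \<W>"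
  define Q3 where "Q3 = (\<lambda>N. (\<lambda>p :: 'b set \<times> 'b set. True, \<lambda>p :: 'b set \<times> 'b set. fst p \<subseteq> {g \<in> Arr. tgt G g \<in> N})) ` {N \<in> \<X>. x \<in> N}"
  define Q4 where "Q4 = (\<lambda>N. (\<lambda>p :: 'b set \<times> 'b set. True, \<lambda>p :: 'b set \<times> 'b set. snd p \<subseteq> {g \<in> Arr. tgt G g \<in> N})) ` {N \<in> \<X>. y \<in> N}"
  define Q5 where "Q5 = (\<lambda>U. (\<lambda>p :: 'b set \<times> 'b set. fst p \<subseteq> {g \<in> Arr. src G g \<in> units_in G U}, \<lambda>p. captured U (fst p) (snd p))) ` \<U>"
  define Q6 where "Q6 = (\<lambda>U. (\<lambda>p :: 'b set \<times> 'b set. snd p \<subseteq> {g \<in> Arr. src G g \<in> units_in G U}, \<lambda>p. captured U (fst p) (snd p))) ` \<U>"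
  let ?Q = "Q1 \<union> Q2 \<union> Q3 \<union> Q4 \<union> Q5 \<union> Q6"
  have "countable ?Q"
    unfolding Q1_def Q2_def Q3_def Q4_def Q5_def Q6_def
    using countable_\<W> countable_\<U> base_Obj(2) by (intro countable_Un countable_image) auto
  obtain H0 K0 where "H0 \<in> \<B>" "K0 \<in> \<B>" "compatible H0 K0"
    using compatible_shrink[OF compatible_whole openin_topspace openin_topspace, of "{Arr}"] by auto
  then have P0: "(H0, K0) \<in> P" by (simp add: P_def)
  have openP: "openin (Mor G) H" "openin (Mor G) K" "compatible H K" if "(H, K) \<in> P" for H K
    using that base_Mor_open by (auto simp: P_def)
  have shrinkP: "\<exists>q\<in>P. le q (H, K) \<and> B q"
    if "\<exists>H'\<in>\<B>. \<exists>K'\<in>\<B>. compatible H' K' \<and> H' \<subseteq> H \<and> K' \<subseteq> K \<and> B (H', K')" for H K B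
    using that by (force simp: P_def le_def)
  have attain: "\<exists>q\<in>P. le q p \<and> B q" if Q: "(A, B) \<in> ?Q" and "p \<in> P" and "A p" for A B p
  proof -
    obtain H K where p: "p = (H, K)" by (cases p)
    note HK = openP[OF \<open>p \<in> P\<close>[unfolded p]]
    have "\<exists>H'\<in>\<B>. \<exists>K'\<in>\<B>. compatible H' K' \<and> H' \<subseteq> H \<and> K' \<subseteq> K \<and> B (H', K')"
      using Q
    proof (elim UnE)
      assume "(A, B) \<in> Q1"
      then obtain W \<C> where W: "(W, \<C>) \<in> \<W>" "A = (\<lambda>p. fst p \<subseteq> W)" "B = (\<lambda>p. \<exists>C\<in>\<C>. fst p \<subseteq> C)"
        by (auto simp: Q1_def)
      have "\<exists>C\<in>\<C>. h \<in> C" if "h \<in> H" for h using W \<open>A p\<close> p covers(1)[OF W(1)] that by auto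
      then show ?thesis
        using compatible_shrink[OF HK(3,1,2), of \<C>] covers(2)[OF W(1)] unfolding W(3) by simp
    next
      assume "(A, B) \<in> Q2"
      then obtain W \<C> where W: "(W, \<C>) \<in> \<W>" "A = (\<lambda>p. snd p \<subseteq> W)" "B = (\<lambda>p. \<exists>C\<in>\<C>. snd p \<subseteq> C)"
        by (auto simp: Q2_def)
      have "\<exists>C\<in>\<C>. h \<in> C" if "h \<in> K" for h using W \<open>A p\<close> p covers(1)[OF W(1)] that by auto
      then show ?thesis
        using compatible_shrink_right[OF HK(3,1,2), of \<C>] covers(2)[OF W(1)] unfolding W(3) by simp
    next
      assume "(A, B) \<in> Q3"
      then obtain N where N: "N \<in> \<X>" "x \<in> N" "B = (\<lambda>p. fst p \<subseteq> {g \<in> Arr. tgt G g \<in> N})"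
        by (auto simp: Q3_def)
      have "openin (Mor G) {g \<in> Arr. tgt G g \<in> N}"
        using openin_tgt_preimage N(1) base_Obj(1) by (simp add: base_of_def)
      then show ?thesis
        using compatible_shrink[OF HK(3,1,2), of "{{g \<in> Arr. tgt G g \<in> N}}"] N openin_subset[OF HK(1)]
        by (auto simp: subset_iff)
    next
      assume "(A, B) \<in> Q4"
      then obtain N where N: "N \<in> \<X>" "y \<in> N" "B = (\<lambda>p. snd p \<subseteq> {g \<in> Arr. tgt G g \<in> N})"
        by (auto simp: Q4_def)
      have "openin (Mor G) {g \<in> Arr. tgt G g \<in> N}"
        using openin_tgt_preimage N(1) base_Obj(1) by (simp add: base_of_def)
      then show ?thesis
        using compatible_shrink_right[OF HK(3,1,2), of "{{g \<in> Arr. tgt G g \<in> N}}"] N openin_subset[OF HK(2)]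
        by (auto simp: subset_iff)
    next
      assume "(A, B) \<in> Q5"
      then obtain U where U: "U \<in> \<U>" "A = (\<lambda>p. fst p \<subseteq> {g \<in> Arr. src G g \<in> units_in G U})"
          "B = (\<lambda>p. captured U (fst p) (snd p))"
        by (auto simp: Q5_def)
      then show ?thesis
        using compatible_capture[OF HK(3,1,2) U(1)] \<open>A p\<close> p by auto
    next
      assume "(A, B) \<in> Q6"
      then obtain U where U: "U \<in> \<U>" "A = (\<lambda>p. snd p \<subseteq> {g \<in> Arr. src G g \<in> units_in G U})"
          "B = (\<lambda>p. captured U (fst p) (snd p))"
        by (auto simp: Q6_def)
      then show ?thesis
        using compatible_capture_right[OF HK(3,1,2) U(1)] \<open>A p\<close> p by auto
    qed
    then show ?thesis unfolding p by (rule shrinkP)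
  qed
  have hereditary: "A q" if "(A, B) \<in> ?Q" "A p" "le q p" for A B p q
    using that unfolding Q1_def Q2_def Q3_def Q4_def Q5_def Q6_def le_def by auto
  have "\<exists>s. (\<forall>n. s n \<in> P \<and> le (s (Suc n)) (s n)) \<and>
      (\<forall>A B. (A, B) \<in> ?Q \<longrightarrow> (\<exists>n. A (s n)) \<longrightarrow> (\<exists>n. B (s n)))"
  proof (rule generic_descending_sequence[OF P0 \<open>countable ?Q\<close>])
    show "le p p" for p by (simp add: le_def)
    show "le p r" if "le p q" "le q r" for p q r using that by (auto simp: le_def)
  qed (fact hereditary attain)+
  then obtain s :: "nat \<Rightarrow> 'b set \<times> 'b set" where "\<forall>n. s n \<in> P \<and> le (s (Suc n)) (s n)"
    and sQ': "\<forall>A B. (A, B) \<in> ?Q \<longrightarrow> (\<exists>n. A (s n)) \<longrightarrow> (\<exists>n. B (s n))"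
    by (elim exE conjE) (rule that)
  then have s: "\<And>n. s n \<in> P" "\<And>n. le (s (Suc n)) (s n)" by simp_all
  have sQ: "\<exists>n. B (s n)" if "(A, B) \<in> ?Q" "\<exists>n. A (s n)" for A B
    using sQ'[rule_format, OF that(1)] that(2) by blast
  define H where "H n = fst (s n)" for n
  define K where "K n = snd (s n)" for n
  have "decseq H" "decseq K"
    using s(2) by (auto simp: decseq_Suc_iff H_def K_def le_def)
  moreover have "H n \<in> \<B>" "K n \<in> \<B>" "compatible (H n) (K n)" for n
    using s(1)[of n] by (auto simp: P_def H_def K_def)
  moreover have "\<exists>n. \<exists>C\<in>\<C>. H n \<subseteq> C" if "(W, \<C>) \<in> \<W>" "\<exists>n. H n \<subseteq> W" for W \<C>
  proof -
    have "(\<lambda>p. fst p \<subseteq> W, \<lambda>p. \<exists>C\<in>\<C>. fst p \<subseteq> C) \<in> ?Q" using that(1) by (force simp: Q1_def)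
    from sQ[OF this] show ?thesis using that(2) unfolding H_def by blast
  qed
  moreover have "\<exists>n. \<exists>C\<in>\<C>. K n \<subseteq> C" if "(W, \<C>) \<in> \<W>" "\<exists>n. K n \<subseteq> W" for W \<C>
  proof -
    have "(\<lambda>p. snd p \<subseteq> W, \<lambda>p. \<exists>C\<in>\<C>. snd p \<subseteq> C) \<in> ?Q" using that(1) by (force simp: Q2_def)
    from sQ[OF this] show ?thesis using that(2) unfolding K_def by blast
  qed
  moreover have "\<exists>n. H n \<subseteq> {g \<in> Arr. tgt G g \<in> N}" if "N \<in> \<X>" "x \<in> N" for N
  proof -
    have "(\<lambda>p. True, \<lambda>p. fst p \<subseteq> {g \<in> Arr. tgt G g \<in> N}) \<in> ?Q" using that by (simp add: Q3_def)
    from sQ[OF this] show ?thesis unfolding H_def by blast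
  qed
  moreover have "\<exists>n. K n \<subseteq> {g \<in> Arr. tgt G g \<in> N}" if "N \<in> \<X>" "y \<in> N" for N
  proof -
    have "(\<lambda>p. True, \<lambda>p. snd p \<subseteq> {g \<in> Arr. tgt G g \<in> N}) \<in> ?Q" using that by (simp add: Q4_def)
    from sQ[OF this] show ?thesis unfolding K_def by blast
  qed
  moreover have "\<exists>n. captured U (H n) (K n)"
    if "U \<in> \<U>" "\<exists>n. H n \<subseteq> {g \<in> Arr. src G g \<in> units_in G U}" for U
  proof -
    have "(\<lambda>p. fst p \<subseteq> {g \<in> Arr. src G g \<in> units_in G U}, \<lambda>p. captured U (fst p) (snd p)) \<in> ?Q"
      using that(1) by (simp add: Q5_def)
    from sQ[OF this] show ?thesis using that(2) unfolding H_def K_def by blast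
  qed
  moreover have "\<exists>n. captured U (H n) (K n)"
    if "U \<in> \<U>" "\<exists>n. K n \<subseteq> {g \<in> Arr. src G g \<in> units_in G U}" for U
  proof -
    have "(\<lambda>p. snd p \<subseteq> {g \<in> Arr. src G g \<in> units_in G U}, \<lambda>p. captured U (fst p) (snd p)) \<in> ?Q"
      using that(1) by (simp add: Q6_def)
    from sQ[OF this] show ?thesis using that(2) unfolding H_def K_def by blast
  qed
  ultimately show thesis by (rule that)
qed

text \<open>The limits of a generic pair.  Being close to \<open>x\<close> in both directions, the target of \<open>h\<close> is
  \<open>x\<close> by \<open>T\<^sub>0\<close>.  Capture puts the sources of \<open>h\<close> and \<open>k\<close> into the same sets
  \<open>units_in G U\<close>; as these sets form a basis of the object space, the sources agree.\<close>

lemma generic_arrows: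
  obtains h k where "h \<in> Arr" "k \<in> Arr" "tgt G h = x" "tgt G k = y" "src G h = src G k"
    "\<And>U. U \<in> \<U> \<Longrightarrow> src G h \<in> units_in G U \<Longrightarrow> matches G f U h k"
proof -
  obtain H K where HK: "decseq H" "decseq K" "\<And>n. H n \<in> \<B>" "\<And>n. K n \<in> \<B>" "\<And>n. compatible (H n) (K n)"
    and conv: "\<And>W \<C>. (W, \<C>) \<in> \<W> \<Longrightarrow> \<exists>n. H n \<subseteq> W \<Longrightarrow> \<exists>n. \<exists>C\<in>\<C>. H n \<subseteq> C"
      "\<And>W \<C>. (W, \<C>) \<in> \<W> \<Longrightarrow> \<exists>n. K n \<subseteq> W \<Longrightarrow> \<exists>n. \<exists>C\<in>\<C>. K n \<subseteq> C"
    and target: "\<And>N. N \<in> \<X> \<Longrightarrow> x \<in> N \<Longrightarrow> \<exists>n. H n \<subseteq> {g \<in> Arr. tgt G g \<in> N}"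
      "\<And>N. N \<in> \<X> \<Longrightarrow> y \<in> N \<Longrightarrow> \<exists>n. K n \<subseteq> {g \<in> Arr. tgt G g \<in> N}"
    and capture: "\<And>U. U \<in> \<U> \<Longrightarrow> \<exists>n. H n \<subseteq> {g \<in> Arr. src G g \<in> units_in G U} \<Longrightarrow> \<exists>n. captured U (H n) (K n)"
      "\<And>U. U \<in> \<U> \<Longrightarrow> \<exists>n. K n \<subseteq> {g \<in> Arr. src G g \<in> units_in G U} \<Longrightarrow> \<exists>n. captured U (H n) (K n)"
    by (rule generic_pair) (rule that)
  have ne: "H n \<noteq> {}" "K n \<noteq> {}" for n using compatible_nonempty[OF HK(5)] by blast+
  have "\<exists>g. (\<forall>n. g \<in> H n) \<and> (\<forall>V. openin (Mor G) V \<and> g \<in> V \<longrightarrow> (\<exists>n. H n \<subseteq> V))"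
    by (rule convergence[OF HK(1,3) ne(1)]) (fact conv(1))
  then obtain h where h: "\<And>n. h \<in> H n" "\<And>V. openin (Mor G) V \<Longrightarrow> h \<in> V \<Longrightarrow> \<exists>n. H n \<subseteq> V"
    by blast
  have "\<exists>g. (\<forall>n. g \<in> K n) \<and> (\<forall>V. openin (Mor G) V \<and> g \<in> V \<longrightarrow> (\<exists>n. K n \<subseteq> V))"
    by (rule convergence[OF HK(2,4) ne(2)]) (fact conv(2))
  then obtain k where k: "\<And>n. k \<in> K n" "\<And>V. openin (Mor G) V \<Longrightarrow> k \<in> V \<Longrightarrow> \<exists>n. K n \<subseteq> V"
    by blast
  have A: "h \<in> Arr" "k \<in> Arr"
    using h(1) k(1) openin_subset[OF base_Mor_open[OF HK(3)]] openin_subset[OF base_Mor_open[OF HK(4)]] by blast+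
  \<comment> \<open>A limit of the sets \<open>L n\<close> has target \<open>z\<close>: a neighbourhood of its target contains
    the targets of some \<open>L n\<close>, and hence \<open>z\<close>; conversely the tasks put its target into
    every neighbourhood of \<open>z\<close>.\<close>
  have tgt_limit: "tgt G g = z"
    if g: "g \<in> Arr" "\<And>n. g \<in> L n" "\<And>V. openin (Mor G) V \<Longrightarrow> g \<in> V \<Longrightarrow> \<exists>n. L n \<subseteq> V"
      and z: "z \<in> topspace (Obj G)" "\<And>n. \<exists>a\<in>L n. tgt G a = z"
      and L: "\<And>N. N \<in> \<X> \<Longrightarrow> z \<in> N \<Longrightarrow> \<exists>n. L n \<subseteq> {g \<in> Arr. tgt G g \<in> N}" for g z and L :: "nat \<Rightarrow> 'b set"
  proof (rule t0_eqI[OF t0_Obj])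
    fix V assume V: "openin (Obj G) V"
    show "tgt G g \<in> V \<longleftrightarrow> z \<in> V"
    proof
      assume "tgt G g \<in> V"
      then obtain n where "L n \<subseteq> {g \<in> Arr. tgt G g \<in> V}"
        using g(3)[OF openin_tgt_preimage[OF V]] g(1) by blast
      then show "z \<in> V" using z(2)[of n] by blast
    next
      assume "z \<in> V"
      then obtain N where "N \<in> \<X>" "z \<in> N" "N \<subseteq> V" using base_Obj(1) V unfolding base_of_def by blast
      then show "tgt G g \<in> V" using L g(2) by blast
    qed
  qed (use g z in \<open>simp_all add: arr_simps\<close>)
  have t: "tgt G h = x" "tgt G k = y"
    using tgt_limit[OF A(1) h base_points(1) compatible_nonempty(1)[OF HK(5)] target(1)]
      tgt_limit[OF A(2) k base_points(2) compatible_nonempty(2)[OF HK(5)] target(2)] by blast+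
  have m: "matches G f U h k" if U: "U \<in> \<U>" and s: "src G h \<in> units_in G U \<or> src G k \<in> units_in G U" for U
  proof -
    have "openin (Mor G) {g \<in> Arr. src G g \<in> units_in G U}"
      using openin_src_preimage openin_units_in open_subgroupoid[OF U] by blast
    then have "(\<exists>n. H n \<subseteq> {g \<in> Arr. src G g \<in> units_in G U}) \<or> (\<exists>n. K n \<subseteq> {g \<in> Arr. src G g \<in> units_in G U})"
      using s A h(2) k(2) by blast
    then obtain n where "captured U (H n) (K n)" using capture[OF U] by blast
    then obtain c where c: "c \<in> cosets_over G x U" "h \<in> c" "k \<in> f U c"
      using h(1) k(1) t unfolding captured_def by blast
    show ?thesis
      using cosets_over_memD[OF U c(1,2)] cosets_over_memD[OF U f_in[OF U c(1)] c(3)]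
      by (simp add: matches_def)
  qed
  have "src G h = src G k"
  proof (rule t0_eqI[OF t0_Obj])
    fix V assume V: "openin (Obj G) V"
    have *: "b \<in> V" if a: "a \<in> topspace (Obj G)" "a \<in> V"
      and ab: "\<And>U. U \<in> \<U> \<Longrightarrow> a \<in> units_in G U \<Longrightarrow> b \<in> units_in G U" for a b
    proof -
      have "unit_of G a \<in> {g \<in> Arr. src G g \<in> V}" using a by (simp add: arr_simps)
      then obtain U where U: "U \<in> \<U>" "unit_of G a \<in> U" "U \<subseteq> {g \<in> Arr. src G g \<in> V}"
        using unit_neighbourhood[OF a(1) openin_src_preimage[OF V]] by blast
      then have "b \<in> units_in G U" using ab a by (simp add: units_in_def)
      then show "b \<in> V" using U(3) by (auto simp: units_in_def arr_simps)
    qed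
    show "src G h \<in> V \<longleftrightarrow> src G k \<in> V"
      using *[of "src G h" "src G k"] *[of "src G k" "src G h"] A m
      by (auto simp: arr_simps matches_def)
  qed (use A in \<open>simp_all add: arr_simps\<close>)
  then show thesis using that A t m by blast
qed

text \<open>Take \<open>h\<close> and \<open>k\<close> generic and put \<open>g = comp G k (inverse_of G h)\<close>.  For
  \<open>a\<close> with target \<open>x\<close> write \<open>a = comp G h b\<close>.  By \<open>transport\<close> along a small \<open>V\<close>,
  \<open>f\<close> sends the coset of \<open>a\<close> to that of \<open>k v b'\<close> with \<open>v \<in> V\<close> close to a unit and
  \<open>b'\<close> close to \<open>b\<close>.  As \<open>v b'\<close> and \<open>b\<close> have the same target and are close, they
  lie in the same coset of \<open>U\<close>, so the image is the coset of \<open>k b = g a\<close>.\<close>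

theorem induced_by_translation:
  obtains g where "g \<in> Arr" "src G g = x" "tgt G g = y"
    "\<And>U c. U \<in> \<U> \<Longrightarrow> c \<in> cosets_over G x U \<Longrightarrow> f U c = comp G g ` c"
proof -
  obtain h k where hk: "h \<in> Arr" "k \<in> Arr" "tgt G h = x" "tgt G k = y" "src G h = src G k"
    and m: "\<And>U. U \<in> \<U> \<Longrightarrow> src G h \<in> units_in G U \<Longrightarrow> matches G f U h k"
    using generic_arrows by blast
  define g where "g = comp G k (inverse_of G h)"
  have g: "g \<in> Arr" "src G g = x" "tgt G g = y" using hk by (simp_all add: g_def arr_simps)
  have "f U c = comp G g ` c" if U: "U \<in> \<U>" and c: "c \<in> cosets_over G x U" for U c
  proof -
    obtain a where a: "a \<in> c" using cosets_over_nonempty c by blast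
    note a' = cosets_over_memD[OF U c a]
    define b where "b = comp G (inverse_of G h) a"
    have b: "b \<in> Arr" "tgt G b = src G h" "src G b \<in> units_in G U" "comp G h b = a"
      using hk a' by (simp_all add: b_def arr_simps comp_inverse_cancel)
    let ?u = "unit_of G (src G h)"
    have u: "?u \<in> Arr" "src G ?u = tgt G b" "comp G ?u b = b" using hk b by (simp_all add: arr_simps)
    obtain C where C: "openin (Mor G) C" "b \<in> C"
      "\<And>d e. d \<in> C \<Longrightarrow> e \<in> C \<Longrightarrow> tgt G d = tgt G e \<Longrightarrow> comp G (inverse_of G d) e \<in> U"
      using small_section[OF open_subgroupoid[OF U] b(1,3)] by blast
    obtain N B where NB: "openin (Mor G) N" "openin (Mor G) B" "?u \<in> N" "b \<in> B"
      "\<And>n e. n \<in> N \<Longrightarrow> e \<in> B \<Longrightarrow> src G n = tgt G e \<Longrightarrow> comp G n e \<in> C"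
      using comp_neighbourhoods[OF u(1) b(1) u(2) C(1)] u(3) C(2) by metis
    obtain V where V: "V \<in> \<U>" "?u \<in> V" "V \<subseteq> N"
      using unit_neighbourhood[OF _ NB(1,3)] hk by (auto simp: arr_simps)
    have "src G h \<in> units_in G V" using V hk by (simp add: units_in_def arr_simps)
    from transport[OF V(1) hk(3) m[OF V(1) this] U b(1) b(2)[symmetric] b(3) NB(2,4)]
    obtain k' b' where k': "k' \<in> left_coset G k V" "b' \<in> B" "b' \<in> Arr" "src G k' = tgt G b'"
      "src G b' \<in> units_in G U" "f U (left_coset G a U) = left_coset G (comp G k' b') U"
      unfolding b(4) by blast
    then obtain v where v: "v \<in> V" "tgt G v = src G k" "k' = comp G k v" by (auto simp: left_coset_def)
    have vA: "v \<in> Arr" using v \<U>_arr V by blast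
    have vb: "src G v = tgt G b'" using k' v vA hk by (simp add: arr_simps)
    have "comp G v b' \<in> C" using NB(5) v V k' vb by blast
    moreover have "tgt G (comp G v b') = tgt G b" using vA vb k' v b hk by (simp add: arr_simps)
    ultimately have "comp G (inverse_of G b) (comp G v b') \<in> U" using C by simp
    then have "left_coset G (comp G v b') U = left_coset G b U"
      using left_coset_eq_iff[OF subgroupoid[OF U] b(1), of "comp G v b'"] vA vb k' v b hk
      by (simp add: arr_simps)
    then have "comp G k ` left_coset G (comp G v b') U = comp G k ` left_coset G b U" by simp
    then have "left_coset G (comp G k (comp G v b')) U = left_coset G (comp G k b) U"
      using translate_left_coset[OF \<U>_arr[OF U] hk(2)] vA vb k' v b hk by (simp add: arr_simps)
    moreover have "comp G k (comp G v b') = comp G k' b'" using vA vb k' v hk by (simp add: comp_assoc')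
    moreover have "comp G k b = comp G g a"
      using hk a' by (simp add: b_def g_def comp_assoc' arr_simps)
    moreover have "comp G g ` left_coset G a U = left_coset G (comp G g a) U"
      using translate_left_coset[OF \<U>_arr[OF U] g(1) a'(1)] g a' by simp
    ultimately show ?thesis using k'(6) a'(4) by simp
  qed
  then show thesis using that g by blast
qed

end

section \<open>The structure of coset spaces\<close>

text \<open>Sorts are codes of the subgroupoids in \<open>\<U>\<close>.  The coding is injective on \<open>\<U>\<close>, so an
  isomorphism, which is indexed by sorts, can be read as indexed by subgroupoids.\<close>

definition sort_code :: "'m set set \<Rightarrow> 'm set \<Rightarrow> nat" where
  "sort_code \<U> = to_nat_on \<U>"

definition sort_of :: "'m set set \<Rightarrow> nat \<Rightarrow> 'm set" where
  "sort_of \<U> = from_nat_into \<U>"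

definition rel_code :: "'m set set \<Rightarrow> 'm set set \<Rightarrow> 'm set \<Rightarrow> 'm set \<Rightarrow> 'm set \<Rightarrow> nat" where
  "rel_code \<U> \<B> U V B = prod_encode (sort_code \<U> U, prod_encode (sort_code \<U> V, to_nat_on \<B> B))"

definition coset_language :: "'m set set \<Rightarrow> 'm set set \<Rightarrow> (nat, nat, nat) language" where
  "coset_language \<U> \<B> =
     \<lparr>sorts = sort_code \<U> ` \<U>,
      rel_symbols = (\<lambda>(U, V, B). rel_code \<U> \<B> U V B) ` (\<U> \<times> \<U> \<times> \<B>),
      fun_symbols = {},
      rel_arity = (\<lambda>r. [fst (prod_decode r), fst (prod_decode (snd (prod_decode r)))]),
      fun_arity = (\<lambda>_. []),
      fun_value = (\<lambda>_. 0)\<rparr>"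

definition coset_structure ::
  "('o, 'm) groupoid \<Rightarrow> 'm set set \<Rightarrow> 'm set set \<Rightarrow> (nat, nat, nat, 'o, 'm set) etale_struct" where
  "coset_structure G \<U> \<B> =
     \<lparr>sort_space = (\<lambda>i. coset_topology G (sort_of \<U> i)),
      sort_proj = (\<lambda>_. coset_base G),
      rel_set = (\<lambda>r. {(x, a). a \<in> extensional {..<2} \<and> coset_base G (a 0) = x \<and>
        coset_rel G (sort_of \<U> (fst (prod_decode r))) (sort_of \<U> (fst (prod_decode (snd (prod_decode r)))))
          (from_nat_into \<B> (snd (prod_decode (snd (prod_decode r))))) (a 0) (a 1)}),
      fun_map = (\<lambda>_ _. {})\<rparr>"

definition translation ::
  "('o, 'm) groupoid \<Rightarrow> 'm set set \<Rightarrow> 'm \<Rightarrow> 'o \<times> 'o \<times> (nat \<Rightarrow> 'm set \<Rightarrow> 'm set)" where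
  "translation G \<U> g = (src G g, tgt G g,
     \<lambda>i\<in>sort_code \<U> ` \<U>. \<lambda>c\<in>cosets_over G (src G g) (sort_of \<U> i). comp G g ` c)"

context coset_geometry
begin

abbreviation (input) "L \<equiv> coset_language \<U> \<B>"
abbreviation (input) "M \<equiv> coset_structure G \<U> \<B>"

lemma sort_of_code [simp]: "U \<in> \<U> \<Longrightarrow> sort_of \<U> (sort_code \<U> U) = U"
  unfolding sort_of_def sort_code_def using countable_\<U> by simp

lemma sort_of_in: "i \<in> sort_code \<U> ` \<U> \<Longrightarrow> sort_of \<U> i \<in> \<U>"
  by auto

lemma universe_fiber:
  "i \<in> sort_code \<U> ` \<U> \<Longrightarrow> universe (fiber M x) i = cosets_over G x (sort_of \<U> i)"
  using topspace_coset_topology[OF subgroupoid[OF sort_of_in] open_subgroupoid[OF sort_of_in]]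
  by (simp add: fiber_def coset_structure_def cosets_over_def)

lemma rel_arity_code:
  "rel_arity L (rel_code \<U> \<B> U V B) = [sort_code \<U> U, sort_code \<U> V]"
  by (simp add: coset_language_def rel_code_def)

lemma rel_set_code:
  assumes "U \<in> \<U>" "V \<in> \<U>" "B \<in> \<B>"
  shows "(x, a) \<in> rel_set M (rel_code \<U> \<B> U V B) \<longleftrightarrow>
    a \<in> extensional {..<2} \<and> coset_base G (a 0) = x \<and> coset_rel G U V B (a 0) (a 1)"
  using assms base_Mor(2) by (simp add: coset_structure_def rel_code_def)

lemma openin_rel_set:
  assumes U: "U \<in> \<U>" and V: "V \<in> \<U>" and B: "B \<in> \<B>"
  shows "openin (sort_product (Obj G) M [sort_code \<U> U, sort_code \<U> V]) (rel_set M (rel_code \<U> \<B> U V B))"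
proof -
  let ?A = "\<lambda>i. sort_space M ([sort_code \<U> U, sort_code \<U> V] ! i)"
  let ?F = "sort_product (Obj G) M [sort_code \<U> U, sort_code \<U> V]"
  have F: "?F = subtopology (prod_topology (Obj G) (product_topology ?A {..<2}))
      {(x, a). \<forall>i<2. coset_base G (a i) = x}"
    by (simp add: sort_product_def fiber_product_def coset_structure_def numeral_2_eq_2)
  have A: "?A 0 = coset_topology G U" "?A 1 = coset_topology G V"
    using U V by (simp_all add: coset_structure_def)
  have proj: "continuous_map ?F (?A i) (\<lambda>p. snd p i)" if "i < 2" for i
  proof -
    have "continuous_map (prod_topology (Obj G) (product_topology ?A {..<2})) (?A i) ((\<lambda>a. a i) \<circ> snd)"
      using that by (intro continuous_map_compose[OF continuous_map_snd] continuous_map_product_projection) simp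
    then show ?thesis unfolding F by (simp add: continuous_map_from_subtopology o_def)
  qed
  have topF: "(x, a) \<in> topspace ?F \<longleftrightarrow> x \<in> topspace (Obj G) \<and> a \<in> extensional {..<2} \<and>
      a 0 \<in> left_cosets G U \<and> a 1 \<in> left_cosets G V \<and> coset_base G (a 0) = x \<and> coset_base G (a 1) = x" for x a
  proof -
    have "(\<forall>i<2. P i) \<longleftrightarrow> P 0 \<and> P (1::nat)" for P by (auto simp: less_2_cases_iff)
    then show ?thesis
      unfolding F using A topspace_coset_topology[OF subgroupoid open_subgroupoid, OF U U]
        topspace_coset_topology[OF subgroupoid open_subgroupoid, OF V V]
      by (auto simp: PiE_def Pi_def)
  qed
  show ?thesis
    unfolding openin_subopen[of ?F "rel_set M (rel_code \<U> \<B> U V B)"]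
  proof
    fix p assume "p \<in> rel_set M (rel_code \<U> \<B> U V B)"
    then obtain x a where p: "p = (x, a)" "a \<in> extensional {..<2}" "coset_base G (a 0) = x"
        "coset_rel G U V B (a 0) (a 1)"
      using rel_set_code[OF U V B] by (cases p) auto
    obtain \<O> \<P> where OP: "openin (coset_topology G U) \<O>" "openin (coset_topology G V) \<P>" "a 0 \<in> \<O>" "a 1 \<in> \<P>"
      "\<And>c d. c \<in> \<O> \<Longrightarrow> d \<in> \<P> \<Longrightarrow> coset_base G c = coset_base G d \<Longrightarrow> coset_rel G U V B c d"
      using coset_rel_neighbourhoods[OF subgroupoid[OF U] open_subgroupoid[OF U] subgroupoid[OF V]
          open_subgroupoid[OF V] base_Mor_open[OF B] p(4)] by blast
    define T where "T = {p \<in> topspace ?F. snd p 0 \<in> \<O>} \<inter> {p \<in> topspace ?F. snd p 1 \<in> \<P>}"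
    have "openin ?F T"
      unfolding T_def
      using openin_continuous_map_preimage[OF proj[of 0], of \<O>] openin_continuous_map_preimage[OF proj[of 1], of \<P>]
        OP(1,2) unfolding A by (intro openin_Int) simp_all
    moreover have "p \<in> T"
      using p OP coset_rel_in_cosets[OF subgroupoid[OF U] subgroupoid[OF V] p(4)]
        coset_base_in_Obj[OF subgroupoid[OF U], of "a 0"] by (auto simp: T_def topF simp del: One_nat_def)
    moreover have "T \<subseteq> rel_set M (rel_code \<U> \<B> U V B)"
    proof
      fix q assume q: "q \<in> T"
      obtain z b where zb: "q = (z, b)" by (cases q)
      show "q \<in> rel_set M (rel_code \<U> \<B> U V B)"
        unfolding zb rel_set_code[OF U V B] using q OP(5)[of "b 0" "b 1"] by (simp add: T_def zb topF)
    qed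
    ultimately show "\<exists>T. openin ?F T \<and> p \<in> T \<and> T \<subseteq> rel_set M (rel_code \<U> \<B> U V B)" by blast
  qed
qed

lemma countable_coset_language: "countable_language L"
  using countable_\<U> base_Mor(2) by (simp add: countable_language_def coset_language_def)

lemma etale_coset_structure: "etale_structure (Obj G) L M"
  unfolding etale_structure_def
proof (intro conjI ballI)
  show "language L"
    by (auto simp: language_def coset_language_def rel_code_def)
  show "etale_space (Obj G) (sort_space M P) (sort_proj M P)" if "P \<in> sorts L" for P
  proof -
    have "sort_of \<U> P \<in> \<U>" using that sort_of_in by (simp add: coset_language_def)
    then show ?thesis
      using etale_coset_space subgroupoid open_subgroupoid by (simp add: coset_structure_def)
  qed
  show "openin (sort_product (Obj G) M (rel_arity L R)) (rel_set M R)" if R: "R \<in> rel_symbols L" for R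
  proof -
    obtain U V B where "U \<in> \<U>" "V \<in> \<U>" "B \<in> \<B>" "R = rel_code \<U> \<B> U V B"
      using R by (auto simp: coset_language_def)
    then show ?thesis using openin_rel_set rel_arity_code by simp
  qed
qed (simp_all add: coset_language_def)

lemma second_countable_coset_structure: "second_countable_structure (Obj G) L M"
  unfolding second_countable_structure_def
proof (intro conjI ballI countable_coset_language)
  show "second_countable (Obj G)"
    using base_Obj unfolding second_countable_def base_of_def by blast
  show "second_countable (sort_space M P)" if "P \<in> sorts L" for P
  proof -
    have "sort_of \<U> P \<in> \<U>" using that sort_of_in by (simp add: coset_language_def)
    then show ?thesis
      using second_countable_coset_topology[OF _ _ base_Mor(2,1)] subgroupoid open_subgroupoid
      by (simp add: coset_structure_def)
  qed
qed

lemma tuples_pair_iff: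
  assumes U: "U \<in> \<U>" and V: "V \<in> \<U>"
  shows "a \<in> tuples (fiber M x) [sort_code \<U> U, sort_code \<U> V] \<longleftrightarrow>
    a \<in> extensional {..<2} \<and> a 0 \<in> cosets_over G x U \<and> a 1 \<in> cosets_over G x V"
proof -
  have "(\<forall>i<2. P i) \<longleftrightarrow> P 0 \<and> P (1::nat)" for P by (auto simp: less_2_cases_iff)
  then show ?thesis
    using U V by (auto simp: tuples_def PiE_def Pi_def universe_fiber numeral_2_eq_2)
qed

text \<open>Membership of the image tuple in the interpretation over \<open>y\<close> also demands that its base point be
  \<open>y\<close>; that is what \<open>h\<close> mapping into \<open>cosets_over G y U\<close> provides.\<close>

lemma preserves_rel_iff:
  assumes U: "U \<in> \<U>" and V: "V \<in> \<U>" and B: "B \<in> \<B>"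
    and h: "\<And>c. c \<in> cosets_over G x U \<Longrightarrow> h (sort_code \<U> U) c \<in> cosets_over G y U"
  defines "R \<equiv> rel_code \<U> \<B> U V B"
  shows "(\<forall>a\<in>tuples (fiber M x) (rel_arity L R).
        a \<in> rel_interp (fiber M x) R \<longleftrightarrow> map_tuple h (rel_arity L R) a \<in> rel_interp (fiber M y) R) \<longleftrightarrow>
    (\<forall>c\<in>cosets_over G x U. \<forall>d\<in>cosets_over G x V.
        coset_rel G U V B c d \<longleftrightarrow> coset_rel G U V B (h (sort_code \<U> U) c) (h (sort_code \<U> V) d))"
    (is "?l \<longleftrightarrow> ?r")
proof -
  have ar: "rel_arity L R = [sort_code \<U> U, sort_code \<U> V]" by (simp add: R_def rel_arity_code)
  have int: "a \<in> rel_interp (fiber M z) R \<longleftrightarrow>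
      a \<in> extensional {..<2} \<and> coset_base G (a 0) = z \<and> coset_rel G U V B (a 0) (a 1)" for a z
    using rel_set_code[OF U V B] by (simp add: fiber_def R_def)
  have mt: "map_tuple h [sort_code \<U> U, sort_code \<U> V] a \<in> extensional {..<2}"
    "map_tuple h [sort_code \<U> U, sort_code \<U> V] a 0 = h (sort_code \<U> U) (a 0)"
    "map_tuple h [sort_code \<U> U, sort_code \<U> V] a 1 = h (sort_code \<U> V) (a 1)" for a
    by (simp_all add: map_tuple_def numeral_2_eq_2)
  have "?l \<longleftrightarrow> (\<forall>a :: nat \<Rightarrow> 'm set. a \<in> extensional {..<2} \<and> a 0 \<in> cosets_over G x U \<and> a 1 \<in> cosets_over G x V \<longrightarrow>
      (coset_rel G U V B (a 0) (a 1) \<longleftrightarrow>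
       coset_rel G U V B (h (sort_code \<U> U) (a 0)) (h (sort_code \<U> V) (a 1))))"
    unfolding ar int Ball_def tuples_pair_iff[OF U V] using h by (auto simp: cosets_over_def mt simp del: One_nat_def)
  also have "\<dots> \<longleftrightarrow> ?r"
  proof (rule iffI; intro ballI allI impI)
    fix c d assume *: "\<forall>a :: nat \<Rightarrow> 'm set. a \<in> extensional {..<2} \<and> a 0 \<in> cosets_over G x U \<and> a 1 \<in> cosets_over G x V \<longrightarrow>
      (coset_rel G U V B (a 0) (a 1) \<longleftrightarrow>
       coset_rel G U V B (h (sort_code \<U> U) (a 0)) (h (sort_code \<U> V) (a 1)))"
      and cd: "c \<in> cosets_over G x U" "d \<in> cosets_over G x V"
    show "coset_rel G U V B c d \<longleftrightarrow> coset_rel G U V B (h (sort_code \<U> U) c) (h (sort_code \<U> V) d)"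
      using *[rule_format, of "\<lambda>i\<in>{..<2}. if i = 0 then c else d"] cd by simp
  qed auto
  finally show ?thesis .
qed

lemma isomorphisms_iff:
  "h \<in> isomorphisms L (fiber M x) (fiber M y) \<longleftrightarrow>
     h \<in> extensional (sort_code \<U> ` \<U>) \<and>
     (\<forall>U\<in>\<U>. h (sort_code \<U> U) \<in> extensional (cosets_over G x U) \<and>
        bij_betw (h (sort_code \<U> U)) (cosets_over G x U) (cosets_over G y U)) \<and>
     (\<forall>U\<in>\<U>. \<forall>V\<in>\<U>. \<forall>B\<in>\<B>. \<forall>c\<in>cosets_over G x U. \<forall>d\<in>cosets_over G x V.
        coset_rel G U V B c d \<longleftrightarrow> coset_rel G U V B (h (sort_code \<U> U) c) (h (sort_code \<U> V) d))"
proof -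
  have s: "sorts L = sort_code \<U> ` \<U>" "fun_symbols L = {}"
    "rel_symbols L = (\<lambda>(U, V, B). rel_code \<U> \<B> U V B) ` (\<U> \<times> \<U> \<times> \<B>)"
    by (simp_all add: coset_language_def)
  have u: "universe (fiber M z) (sort_code \<U> U) = cosets_over G z U" if "U \<in> \<U>" for z U
    using universe_fiber[of "sort_code \<U> U" z] that by simp
  have 1: "h \<in> (\<Pi>\<^sub>E P\<in>sorts L. universe (fiber M x) P \<rightarrow>\<^sub>E universe (fiber M y) P) \<and>
      (\<forall>P\<in>sorts L. bij_betw (h P) (universe (fiber M x) P) (universe (fiber M y) P)) \<longleftrightarrow>
    h \<in> extensional (sort_code \<U> ` \<U>) \<and>
     (\<forall>U\<in>\<U>. h (sort_code \<U> U) \<in> extensional (cosets_over G x U) \<and>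
        bij_betw (h (sort_code \<U> U)) (cosets_over G x U) (cosets_over G y U))"
    (is "?A \<and> ?B \<longleftrightarrow> ?E")
  proof -
    have "h (sort_code \<U> U) \<in> cosets_over G x U \<rightarrow> cosets_over G y U"
      if "bij_betw (h (sort_code \<U> U)) (cosets_over G x U) (cosets_over G y U)" for U
      using that by (auto simp: bij_betw_def)
    then show ?thesis unfolding s PiE_def by (auto simp: u PiE_def Pi_iff)
  qed
  have 2: "(\<forall>R\<in>rel_symbols L. \<forall>a\<in>tuples (fiber M x) (rel_arity L R).
        a \<in> rel_interp (fiber M x) R \<longleftrightarrow> map_tuple h (rel_arity L R) a \<in> rel_interp (fiber M y) R) \<longleftrightarrow>
     (\<forall>U\<in>\<U>. \<forall>V\<in>\<U>. \<forall>B\<in>\<B>. \<forall>c\<in>cosets_over G x U. \<forall>d\<in>cosets_over G x V.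
        coset_rel G U V B c d \<longleftrightarrow> coset_rel G U V B (h (sort_code \<U> U) c) (h (sort_code \<U> V) d))"
    (is "?C \<longleftrightarrow> ?D") if "\<forall>U\<in>\<U>. bij_betw (h (sort_code \<U> U)) (cosets_over G x U) (cosets_over G y U)"
  proof -
    have "h (sort_code \<U> U) c \<in> cosets_over G y U" if "U \<in> \<U>" "c \<in> cosets_over G x U" for U c
      using \<open>\<forall>U\<in>\<U>. _\<close> that bij_betwE by blast
    moreover have "(\<forall>R\<in>rel_symbols L. Q R) \<longleftrightarrow> (\<forall>U\<in>\<U>. \<forall>V\<in>\<U>. \<forall>B\<in>\<B>. Q (rel_code \<U> \<B> U V B))" for Q
      unfolding s by auto
    ultimately show ?thesis
      by (simp only:) (intro ball_cong refl preserves_rel_iff, auto)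
  qed
  have "h \<in> isomorphisms L (fiber M x) (fiber M y) \<longleftrightarrow> (?A \<and> ?B) \<and> ?C"
    unfolding isomorphisms_def mem_Collect_eq s(2) by simp
  also have "\<dots> \<longleftrightarrow> ?E \<and> ?D"
    by (rule conj_cong[OF 1]) (rule 2, blast)
  finally show ?thesis by (simp only: conj_assoc)
qed

section \<open>Arrows are isomorphisms of fibres\<close>

abbreviation (input) "\<Phi> \<equiv> translation G \<U>"

lemma translation_cosets_over:
  assumes "U \<in> \<U>" "g \<in> Arr" "c \<in> cosets_over G (src G g) U"
  shows "comp G g ` c \<in> cosets_over G (tgt G g) U" "comp G (inverse_of G g) ` comp G g ` c = c"
  using translate_in_cosets[OF subgroupoid[OF assms(1)], of c g] assms by (simp_all add: cosets_over_def)

lemma translation_bij: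
  assumes U: "U \<in> \<U>" and g: "g \<in> Arr"
  shows "bij_betw ((`) (comp G g)) (cosets_over G (src G g) U) (cosets_over G (tgt G g) U)"
proof (rule bij_betw_byWitness[where f' = "(`) (comp G (inverse_of G g))"])
  have i: "inverse_of G g \<in> Arr" "src G (inverse_of G g) = tgt G g" "tgt G (inverse_of G g) = src G g"
    "inverse_of G (inverse_of G g) = g"
    using g by (simp_all add: arr_simps inverse_inverse)
  show "\<forall>c\<in>cosets_over G (src G g) U. comp G (inverse_of G g) ` comp G g ` c = c"
    using translation_cosets_over[OF U g] by blast
  show "\<forall>c\<in>cosets_over G (tgt G g) U. comp G g ` comp G (inverse_of G g) ` c = c"
    using translation_cosets_over(2)[OF U i(1)] i by simp
  show "(`) (comp G g) ` cosets_over G (src G g) U \<subseteq> cosets_over G (tgt G g) U"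
    using translation_cosets_over(1)[OF U g] by blast
  show "(`) (comp G (inverse_of G g)) ` cosets_over G (tgt G g) U \<subseteq> cosets_over G (src G g) U"
    using translation_cosets_over(1)[OF U i(1)] i by auto
qed

lemma translation_rel_iff:
  assumes U: "U \<in> \<U>" and V: "V \<in> \<U>" and g: "g \<in> Arr"
    and c: "c \<in> cosets_over G (src G g) U" and d: "d \<in> cosets_over G (src G g) V"
  shows "coset_rel G U V B (comp G g ` c) (comp G g ` d) \<longleftrightarrow> coset_rel G U V B c d"
proof
  assume "coset_rel G U V B (comp G g ` c) (comp G g ` d)"
  then have "coset_rel G U V B (comp G (inverse_of G g) ` comp G g ` c) (comp G (inverse_of G g) ` comp G g ` d)"
    using translation_cosets_over(1)[OF U g c] g
    by (intro translate_coset_rel[OF subgroupoid[OF U] subgroupoid[OF V] inverse_closed[OF g]])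
      (simp_all add: arr_simps cosets_over_def)
  then show "coset_rel G U V B c d"
    using translation_cosets_over(2)[OF U g c] translation_cosets_over(2)[OF V g d] by simp
next
  assume "coset_rel G U V B c d"
  then show "coset_rel G U V B (comp G g ` c) (comp G g ` d)"
    using translate_coset_rel[OF subgroupoid[OF U] subgroupoid[OF V] g] c by (simp add: cosets_over_def)
qed

lemma translation_in_Iso:
  assumes g: "g \<in> Arr"
  shows "\<Phi> g \<in> Iso_morphisms (Obj G) L M"
proof -
  let ?h = "\<lambda>i\<in>sort_code \<U> ` \<U>. \<lambda>c\<in>cosets_over G (src G g) (sort_of \<U> i). comp G g ` c"
  have h: "?h (sort_code \<U> U) = (\<lambda>c\<in>cosets_over G (src G g) U. comp G g ` c)" if "U \<in> \<U>" for U
    using that by simp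
  have "bij_betw (?h (sort_code \<U> U)) (cosets_over G (src G g) U) (cosets_over G (tgt G g) U)" if "U \<in> \<U>" for U
    unfolding h[OF that] using translation_bij[OF that g] by (rule bij_betw_cong[THEN iffD1, rotated]) simp
  then have "?h \<in> isomorphisms L (fiber M (src G g)) (fiber M (tgt G g))"
    unfolding isomorphisms_iff by (auto simp: h translation_rel_iff[OF _ _ g])
  then show ?thesis
    using g by (simp add: translation_def Iso_morphisms_def arr_simps)
qed

lemma Iso_morphism_is_translation:
  assumes "p \<in> Iso_morphisms (Obj G) L M"
  shows "\<exists>g\<in>Arr. p = \<Phi> g"
proof -
  obtain x y h where p: "p = (x, y, h)" and xy: "x \<in> topspace (Obj G)" "y \<in> topspace (Obj G)"
    and "h \<in> isomorphisms L (fiber M x) (fiber M y)"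
    using assms by (auto simp: Iso_morphisms_def)
  note h = \<open>h \<in> isomorphisms L _ _\<close>[unfolded isomorphisms_iff]
  interpret iso: coset_isomorphism G \<U> \<B> \<W> \<X> x y "\<lambda>U. h (sort_code \<U> U)"
    by unfold_locales (use h xy in blast)+
  obtain g where g: "g \<in> Arr" "src G g = x" "tgt G g = y"
    "\<And>U c. U \<in> \<U> \<Longrightarrow> c \<in> cosets_over G x U \<Longrightarrow> h (sort_code \<U> U) c = comp G g ` c"
    by (rule iso.induced_by_translation) blast
  have "h = (\<lambda>i\<in>sort_code \<U> ` \<U>. \<lambda>c\<in>cosets_over G x (sort_of \<U> i). comp G g ` c)"
  proof
    fix i
    show "h i = (\<lambda>i\<in>sort_code \<U> ` \<U>. \<lambda>c\<in>cosets_over G x (sort_of \<U> i). comp G g ` c) i"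
    proof (cases "i \<in> sort_code \<U> ` \<U>")
      case True
      then obtain U where U: "U \<in> \<U>" "i = sort_code \<U> U" by blast
      have "h i \<in> extensional (cosets_over G x U)" using h U by blast
      then have "h i = (\<lambda>c\<in>cosets_over G x U. comp G g ` c)"
        using g(4)[OF U(1)] U(2) by (intro extensionalityI[of _ "cosets_over G x U"]) auto
      then show ?thesis using U by simp
    next
      case False
      then show ?thesis using h by (auto simp: extensional_def)
    qed
  qed
  then have "p = \<Phi> g" using p g by (simp add: translation_def)
  then show ?thesis using g(1) by blast
qed

text \<open>If \<open>g\<close> carries the coset of \<open>a\<close> to that of \<open>b = g a\<close>, then \<open>g\<close> is \<open>b\<close> times
  the inverse of \<open>a\<close>.  So the subbasic sets of the isomorphism groupoid pull back to products
  of open sets of arrows.\<close>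

lemma translation_meets_iff:
  assumes U: "U \<in> \<U>" and g: "g \<in> Arr" and ST: "S \<subseteq> left_cosets G U" "T \<subseteq> left_cosets G U"
  shows "snd (snd (\<Phi> g)) (sort_code \<U> U) ` (S \<inter> universe (fiber M (src G g)) (sort_code \<U> U)) \<inter>
      (T \<inter> universe (fiber M (tgt G g)) (sort_code \<U> U)) \<noteq> {} \<longleftrightarrow>
    g \<in> product_set G (\<Union>T) {a \<in> Arr. inverse_of G a \<in> \<Union>S}"
    (is "?l \<longleftrightarrow> ?r")
proof -
  have u: "universe (fiber M z) (sort_code \<U> U) = cosets_over G z U" for z
    using universe_fiber[of "sort_code \<U> U" z] U by simp
  have h: "snd (snd (\<Phi> g)) (sort_code \<U> U) c = comp G g ` c" if "c \<in> cosets_over G (src G g) U" for c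
    using that U by (simp add: translation_def)
  have "?l \<longleftrightarrow> (\<exists>c\<in>S. c \<in> cosets_over G (src G g) U \<and>
      snd (snd (\<Phi> g)) (sort_code \<U> U) c \<in> T \<inter> cosets_over G (tgt G g) U)"
    unfolding u by blast
  also have "\<dots> \<longleftrightarrow> (\<exists>c\<in>S. c \<in> cosets_over G (src G g) U \<and> comp G g ` c \<in> T)"
    using translation_cosets_over(1)[OF U g] by (intro bex_cong refl) (auto simp: h)
  also have "\<dots> \<longleftrightarrow> ?r"
  proof
    assume "\<exists>c\<in>S. c \<in> cosets_over G (src G g) U \<and> comp G g ` c \<in> T"
    then obtain c where c: "c \<in> S" "c \<in> cosets_over G (src G g) U" "comp G g ` c \<in> T" by blast
    then obtain a where a: "a \<in> c" using cosets_over_nonempty by blast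
    note a' = cosets_over_memD[OF U c(2) a]
    have "g = comp G (comp G g a) (inverse_of G a)"
      using a' g by (simp add: comp_assoc' arr_simps)
    moreover have "comp G g a \<in> \<Union>T" using c a by blast
    moreover have "inverse_of G a \<in> {a \<in> Arr. inverse_of G a \<in> \<Union>S}"
      using a a' c by (auto simp: inverse_inverse arr_simps)
    moreover have "src G (comp G g a) = tgt G (inverse_of G a)" using a' g by (simp add: arr_simps)
    ultimately show ?r unfolding product_set_def by blast
  next
    assume ?r
    then obtain b a' where ba: "b \<in> \<Union>T" "a' \<in> Arr" "inverse_of G a' \<in> \<Union>S" "src G b = tgt G a'" "g = comp G b a'"
      by (auto simp: product_set_def)
    obtain c d where cd: "c \<in> S" "inverse_of G a' \<in> c" "d \<in> T" "b \<in> d" using ba by blast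
    have c: "c \<in> left_cosets G U" and d: "d \<in> left_cosets G U" using cd ST by blast+
    have b: "b \<in> Arr" using left_cosets_memD[OF subgroupoid[OF U] d cd(4)] by simp
    have "coset_base G c = src G g"
      using coset_base_eq[OF subgroupoid[OF U] c cd(2)] ba b by (simp add: arr_simps)
    then have c': "c \<in> cosets_over G (src G g) U" using c by (simp add: cosets_over_def)
    have "comp G g (inverse_of G a') = b"
      using ba b by (simp add: comp_assoc' arr_simps)
    then have "b \<in> comp G g ` c" using cd(2) by (metis imageI)
    moreover have "comp G g ` c \<in> left_cosets G U"
      using translation_cosets_over(1)[OF U g c'] by (simp add: cosets_over_def)
    ultimately have "comp G g ` c = d" using left_cosets_disjoint[OF subgroupoid[OF U] _ d _ cd(4)] by blast
    then show "\<exists>c\<in>S. c \<in> cosets_over G (src G g) U \<and> comp G g ` c \<in> T" using cd c' by blast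
  qed
  finally show ?thesis .
qed

definition meeting_set :: "'m set \<Rightarrow> 'm set set \<Rightarrow> 'm set set \<Rightarrow> ('o \<times> 'o \<times> (nat \<Rightarrow> 'm set \<Rightarrow> 'm set)) set" where
  "meeting_set U S T = {(x, y, h) \<in> Iso_morphisms (Obj G) L M.
     h (sort_code \<U> U) ` (S \<inter> universe (fiber M x) (sort_code \<U> U)) \<inter>
       (T \<inter> universe (fiber M y) (sort_code \<U> U)) \<noteq> {}}"

lemma translation_in_meeting_set_iff:
  assumes "U \<in> \<U>" "g \<in> Arr" "S \<subseteq> left_cosets G U" "T \<subseteq> left_cosets G U"
  shows "\<Phi> g \<in> meeting_set U S T \<longleftrightarrow> g \<in> product_set G (\<Union>T) {a \<in> Arr. inverse_of G a \<in> \<Union>S}"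
proof -
  define h where "h = snd (snd (\<Phi> g))"
  have eq: "\<Phi> g = (src G g, tgt G g, h)" by (simp add: translation_def h_def)
  have "\<Phi> g \<in> meeting_set U S T \<longleftrightarrow>
      h (sort_code \<U> U) ` (S \<inter> universe (fiber M (src G g)) (sort_code \<U> U)) \<inter>
      (T \<inter> universe (fiber M (tgt G g)) (sort_code \<U> U)) \<noteq> {}"
    using translation_in_Iso[OF assms(2)] unfolding meeting_set_def eq mem_Collect_eq prod.case by blast
  then show ?thesis using translation_meets_iff[OF assms] unfolding h_def by (rule trans)
qed

lemma openin_meeting_set:
  assumes "U \<in> \<U>" "openin (coset_topology G U) S" "openin (coset_topology G U) T"
  shows "openin (Iso_topology (Obj G) L M) (meeting_set U S T)"
  unfolding Iso_topology_def
proof (rule topology_generated_by_Basis, rule UnI2, unfold mem_Collect_eq,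
    rule exI[of _ "sort_code \<U> U"], rule exI[of _ S], rule exI[of _ T], intro conjI)
  show "meeting_set U S T = {(x, y, h) \<in> Iso_morphisms (Obj G) L M.
     h (sort_code \<U> U) ` (S \<inter> universe (fiber M x) (sort_code \<U> U)) \<inter>
       (T \<inter> universe (fiber M y) (sort_code \<U> U)) \<noteq> {}}"
    by (rule meeting_set_def)
qed (use assms in \<open>simp_all add: coset_language_def coset_structure_def\<close>)

lemma continuous_translation: "continuous_map (Mor G) (Iso_topology (Obj G) L M) \<Phi>"
  unfolding Iso_topology_def
proof (rule continuous_on_generated_topo)
  show "\<Phi> ` topspace (Mor G) \<subseteq> \<Union> ({{(x, y, h) \<in> Iso_morphisms (Obj G) L M. x \<in> U} | U. openin (Obj G) U} \<union>
      {{(x, y, h) \<in> Iso_morphisms (Obj G) L M. y \<in> U} | U. openin (Obj G) U} \<union>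
      {{(x, y, h) \<in> Iso_morphisms (Obj G) L M.
          h P ` (S \<inter> universe (fiber M x) P) \<inter> (T \<inter> universe (fiber M y) P) \<noteq> {}} | P S T.
        P \<in> sorts L \<and> openin (sort_space M P) S \<and> openin (sort_space M P) T})"
    using translation_in_Iso
    unfolding topspace_Iso_topology[of "Obj G" L M, unfolded Iso_topology_def topology_generated_by_topspace]
    by (rule image_subsetI)
next
  fix N
  assume "N \<in> {{(x, y, h) \<in> Iso_morphisms (Obj G) L M. x \<in> U} | U. openin (Obj G) U} \<union>
      {{(x, y, h) \<in> Iso_morphisms (Obj G) L M. y \<in> U} | U. openin (Obj G) U} \<union>
      {{(x, y, h) \<in> Iso_morphisms (Obj G) L M.
          h P ` (S \<inter> universe (fiber M x) P) \<inter> (T \<inter> universe (fiber M y) P) \<noteq> {}} | P S T.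
        P \<in> sorts L \<and> openin (sort_space M P) S \<and> openin (sort_space M P) T}"
  then consider (src) U where "openin (Obj G) U" "N = {(x, y, h) \<in> Iso_morphisms (Obj G) L M. x \<in> U}"
    | (tgt) U where "openin (Obj G) U" "N = {(x, y, h) \<in> Iso_morphisms (Obj G) L M. y \<in> U}"
    | (meet) P S T where "P \<in> sorts L" "openin (sort_space M P) S" "openin (sort_space M P) T"
        "N = {(x, y, h) \<in> Iso_morphisms (Obj G) L M.
          h P ` (S \<inter> universe (fiber M x) P) \<inter> (T \<inter> universe (fiber M y) P) \<noteq> {}}"
    by blast
  then show "openin (Mor G) (\<Phi> -` N \<inter> topspace (Mor G))"
  proof cases
    case src
    have "\<Phi> -` N \<inter> Arr = {g \<in> Arr. src G g \<in> U}"
      using translation_in_Iso src(2) by (auto simp: translation_def)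
    then show ?thesis using openin_src_preimage src(1) by simp
  next
    case tgt
    have "\<Phi> -` N \<inter> Arr = {g \<in> Arr. tgt G g \<in> U}"
      using translation_in_Iso tgt(2) by (auto simp: translation_def)
    then show ?thesis using openin_tgt_preimage tgt(1) by simp
  next
    case meet
    then obtain U where U: "U \<in> \<U>" "P = sort_code \<U> U" by (auto simp: coset_language_def)
    have ST: "S \<subseteq> left_cosets G U" "T \<subseteq> left_cosets G U" "openin (Mor G) (\<Union>S)" "openin (Mor G) (\<Union>T)"
      using meet(2,3) U by (simp_all add: coset_structure_def openin_coset_topology subgroupoid)
    have "N = meeting_set U S T" unfolding meeting_set_def meet(4) U(2) ..
    then have "\<Phi> -` N \<inter> Arr = product_set G (\<Union>T) {a \<in> Arr. inverse_of G a \<in> \<Union>S} \<inter> Arr"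
      using translation_in_meeting_set_iff[OF U(1) _ ST(1,2)] by blast
    moreover have "openin (Mor G) (product_set G (\<Union>T) {a \<in> Arr. inverse_of G a \<in> \<Union>S})"
      using openin_product_set[OF ST(4) openin_continuous_map_preimage[OF continuous_inverse ST(3)]] .
    ultimately show ?thesis by (simp add: openin_Int)
  qed
qed

text \<open>Choose \<open>W'\<close> around \<open>g\<close> and \<open>V\<close> around the unit with \<open>W' V \<subseteq> W\<close>.  The condition
  that some coset of a unit is carried to a coset that meets \<open>W'\<close> pulls back to \<open>W' V V = W' V\<close>.\<close>

lemma translation_neighbourhood:
  assumes W: "openin (Mor G) W" "g \<in> W"
  shows "\<exists>N. openin (Iso_topology (Obj G) L M) N \<and> \<Phi> g \<in> N \<and> (\<forall>k\<in>Arr. \<Phi> k \<in> N \<longrightarrow> k \<in> W)"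
proof -
  have g: "g \<in> Arr" using W openin_subset by blast
  let ?u = "unit_of G (src G g)"
  have u: "?u \<in> Arr" "src G g = tgt G ?u" "comp G g ?u = g" "src G g \<in> topspace (Obj G)" "src G ?u = src G g"
    using g by (simp_all add: arr_simps)
  obtain W' N where WN: "openin (Mor G) W'" "openin (Mor G) N" "g \<in> W'" "?u \<in> N"
    "\<And>w n. w \<in> W' \<Longrightarrow> n \<in> N \<Longrightarrow> src G w = tgt G n \<Longrightarrow> comp G w n \<in> W"
    using comp_neighbourhoods[OF g u(1,2) W(1)] u(3) W(2) by metis
  obtain V where V: "V \<in> \<U>" "?u \<in> V" "V \<subseteq> N" using unit_neighbourhood[OF u(4) WN(2,4)] by blast
  define S where "S = cosets_meeting G V V"
  define T where "T = cosets_meeting G V W'"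
  have sub: "subgroupoid G V" and op: "openin (Mor G) V" using V subgroupoid open_subgroupoid by blast+
  have ST: "S \<subseteq> left_cosets G V" "T \<subseteq> left_cosets G V"
    by (auto simp: S_def T_def cosets_meeting_def)
  have Un: "\<Union>S = product_set G V V" "\<Union>T = product_set G W' V"
    unfolding S_def T_def using Union_cosets_meeting[OF sub] openin_subset[OF op] openin_subset[OF WN(1)] by blast+
  have uV: "src G g \<in> units_in G V" using V u by (simp add: units_in_def)
  have "g \<in> product_set G (\<Union>T) {a \<in> Arr. inverse_of G a \<in> \<Union>S}"
  proof -
    have "g \<in> \<Union>T" unfolding Un product_set_def using WN(3) V(2) u(2,3)
      by (intro CollectI exI[of _ g] exI[of _ ?u]) simp
    moreover have "?u = comp G ?u ?u" using u by (simp add: arr_simps)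
    then have "?u \<in> \<Union>S" unfolding Un product_set_def using V(2) u
      by (intro CollectI exI[of _ ?u]) (simp add: arr_simps)
    then have "?u \<in> {a \<in> Arr. inverse_of G a \<in> \<Union>S}" using u by (simp add: inverse_unit)
    ultimately show ?thesis
      unfolding product_set_def[of G "\<Union>T"] using u(2,3)
      by (intro CollectI exI[of _ g] exI[of _ ?u] conjI) simp_all
  qed
  then have "\<Phi> g \<in> meeting_set V S T" using translation_in_meeting_set_iff[OF V(1) g ST] by simp
  moreover have "k \<in> W" if k: "k \<in> Arr" "\<Phi> k \<in> meeting_set V S T" for k
  proof -
    have mult: "comp G a b \<in> V" if "a \<in> V" "b \<in> V" "src G a = tgt G b" for a b
      using sub that by (auto simp: subgroupoid_def)
    have "k \<in> product_set G (\<Union>T) {a \<in> Arr. inverse_of G a \<in> \<Union>S}"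
      using translation_in_meeting_set_iff[OF V(1) k(1) ST] k(2) by simp
    then obtain b a where ba: "b \<in> product_set G W' V" "a \<in> Arr" "inverse_of G a \<in> product_set G V V"
      "src G b = tgt G a" "k = comp G b a"
      unfolding Un by (subst (asm) product_set_def[of G "product_set G W' V"]) blast
    have "inverse_of G a \<in> V" using ba(3) mult by (auto simp: product_set_def)
    then have "inverse_of G (inverse_of G a) \<in> V" using sub by (simp add: subgroupoid_def)
    then have a: "a \<in> V" using inverse_inverse[OF ba(2)] by simp
    obtain w v where wv: "w \<in> W'" "v \<in> V" "src G w = tgt G v" "b = comp G w v"
      using ba(1) by (auto simp: product_set_def)
    have A: "w \<in> Arr" "v \<in> Arr" using wv openin_subset[OF WN(1)] openin_subset[OF op] by blast+
    then have va: "src G v = tgt G a" using ba(4) wv by (simp add: arr_simps)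
    then have "comp G v a \<in> N" using mult wv(2) a V(3) by blast
    then have "comp G w (comp G v a) \<in> W" using WN(5) wv va A ba(2) by (simp add: arr_simps)
    then show "k \<in> W" using A va ba wv by (simp add: comp_assoc')
  qed
  moreover have "openin (Iso_topology (Obj G) L M) (meeting_set V S T)"
    unfolding S_def T_def using openin_meeting_set[OF V(1)] openin_cosets_meeting[OF sub op] op WN(1) by blast
  ultimately show ?thesis by blast
qed

text \<open>Openness comes from \<open>translation_neighbourhood\<close> because every isomorphism is a translation;
  injectivity comes from it because the arrow space is \<open>T\<^sub>0\<close>.\<close>

lemma homeomorphic_translation: "homeomorphic_map (Mor G) (Iso_topology (Obj G) L M) \<Phi>"
proof (rule bijective_open_imp_homeomorphic_map[OF continuous_translation])
  show "open_map (Mor G) (Iso_topology (Obj G) L M) \<Phi>"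
    unfolding open_map_def
  proof (intro allI impI)
    fix W assume W: "openin (Mor G) W"
    show "openin (Iso_topology (Obj G) L M) (\<Phi> ` W)"
      unfolding openin_subopen[of _ "\<Phi> ` W"]
    proof
      fix p assume "p \<in> \<Phi> ` W"
      then obtain g where "g \<in> W" "p = \<Phi> g" by blast
      with translation_neighbourhood[OF W, of g]
      obtain N where N: "openin (Iso_topology (Obj G) L M) N" "p \<in> N" "\<forall>k\<in>Arr. \<Phi> k \<in> N \<longrightarrow> k \<in> W"
        by auto
      have "N \<subseteq> \<Phi> ` W"
      proof
        fix q assume q: "q \<in> N"
        then have "q \<in> Iso_morphisms (Obj G) L M"
          using openin_subset[OF N(1)] by (auto simp: topspace_Iso_topology)
        then obtain k where k: "k \<in> Arr" "q = \<Phi> k" using Iso_morphism_is_translation by blast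
        then show "q \<in> \<Phi> ` W" using N(3) q by simp
      qed
      then show "\<exists>N. openin (Iso_topology (Obj G) L M) N \<and> p \<in> N \<and> N \<subseteq> \<Phi> ` W" using N by blast
    qed
  qed
  show "\<Phi> ` topspace (Mor G) = topspace (Iso_topology (Obj G) L M)"
    unfolding topspace_Iso_topology using translation_in_Iso Iso_morphism_is_translation by blast
  show "inj_on \<Phi> (topspace (Mor G))"
  proof (rule inj_onI)
    fix g k assume gk: "g \<in> Arr" "k \<in> Arr" "\<Phi> g = \<Phi> k"
    show "g = k"
    proof (rule t0_eqI[OF t0_Mor gk(1,2)])
      fix V assume V: "openin (Mor G) V"
      show "g \<in> V \<longleftrightarrow> k \<in> V"
        using translation_neighbourhood[OF V, of g] translation_neighbourhood[OF V, of k] gk by metis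
    qed
  qed
qed

lemma restrict_restrict_cong:
  assumes "\<And>i. i \<in> I \<Longrightarrow> A i = B i" "\<And>i c. i \<in> I \<Longrightarrow> c \<in> A i \<Longrightarrow> p i c = q i c"
  shows "(\<lambda>i\<in>I. \<lambda>c\<in>A i. p i c) = (\<lambda>i\<in>I. \<lambda>c\<in>B i. q i c)"
  using assms by (intro restrict_ext) (metis restrict_ext)

lemma translation_unit:
  assumes x: "x \<in> topspace (Obj G)"
  shows "\<Phi> (unit_of G x) = unit_of (Iso (Obj G) L M) x"
proof -
  have u: "unit_of G x \<in> Arr" "src G (unit_of G x) = x" "tgt G (unit_of G x) = x"
    using x by (simp_all add: arr_simps)
  have "comp G (unit_of G x) ` c = c" if "U \<in> \<U>" "c \<in> cosets_over G x U" for U c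
  proof -
    have "comp G (unit_of G x) a = a" if "a \<in> c" for a
      using cosets_over_memD[OF \<open>U \<in> \<U>\<close> \<open>c \<in> _\<close> that] by (simp add: unit_left')
    then show ?thesis by simp
  qed
  then have "(\<lambda>i\<in>sort_code \<U> ` \<U>. \<lambda>c\<in>cosets_over G x (sort_of \<U> i). comp G (unit_of G x) ` c) =
      (\<lambda>i\<in>sort_code \<U> ` \<U>. \<lambda>c\<in>universe (fiber M x) i. c)"
    using universe_fiber sort_of_in by (intro restrict_restrict_cong) metis+
  then show ?thesis using u by (simp add: translation_def Iso_def coset_language_def)
qed

lemma translation_comp:
  assumes g: "g \<in> Arr" and k: "k \<in> Arr" and gk: "src G g = tgt G k"
  shows "\<Phi> (comp G g k) = comp (Iso (Obj G) L M) (\<Phi> g) (\<Phi> k)"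
proof -
  have 1: "comp G (comp G g k) ` c = comp G g ` comp G k ` c" if "U \<in> \<U>" "c \<in> cosets_over G (src G k) U" for U c
  proof -
    have "comp G (comp G g k) a = comp G g (comp G k a)" if "a \<in> c" for a
      using cosets_over_memD[OF \<open>U \<in> \<U>\<close> \<open>c \<in> _\<close> that] g k gk by (simp add: comp_assoc')
    then show ?thesis by (simp add: image_image)
  qed
  have "comp G k ` c \<in> cosets_over G (src G g) U" if "U \<in> \<U>" "c \<in> cosets_over G (src G k) U" for U c
    using translation_cosets_over(1)[OF that(1) k that(2)] gk by simp
  then have "(\<lambda>i\<in>sort_code \<U> ` \<U>. \<lambda>c\<in>cosets_over G (src G k) (sort_of \<U> i). comp G (comp G g k) ` c) =
      (\<lambda>i\<in>sort_code \<U> ` \<U>. \<lambda>c\<in>universe (fiber M (src G k)) i.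
        snd (snd (\<Phi> g)) i (snd (snd (\<Phi> k)) i c))"
    using universe_fiber sort_of_in
    by (intro restrict_restrict_cong) (simp_all add: translation_def 1[OF sort_of_in])
  then show ?thesis
    using g k gk by (simp add: translation_def Iso_def coset_language_def arr_simps)
qed

lemma translation_inverse:
  assumes g: "g \<in> Arr"
  shows "\<Phi> (inverse_of G g) = inverse_of (Iso (Obj G) L M) (\<Phi> g)"
proof -
  have "comp G (inverse_of G g) ` d =
      inv_into (cosets_over G (src G g) U) (\<lambda>c\<in>cosets_over G (src G g) U. comp G g ` c) d"
    if U: "U \<in> \<U>" and d: "d \<in> cosets_over G (tgt G g) U" for U d
  proof -
    have c: "comp G (inverse_of G g) ` d \<in> cosets_over G (src G g) U"
      using translation_cosets_over(1)[OF U inverse_closed[OF g]] d g by (simp add: arr_simps)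
    have "comp G g ` comp G (inverse_of G g) ` d = d"
      using translation_cosets_over(2)[OF U inverse_closed[OF g]] d g by (simp add: arr_simps inverse_inverse)
    moreover have "inj_on (\<lambda>c\<in>cosets_over G (src G g) U. comp G g ` c) (cosets_over G (src G g) U)"
      using translation_bij[OF U g] by (simp add: bij_betw_def inj_on_def)
    ultimately show ?thesis using c by (intro inv_into_f_eq[symmetric]) simp_all
  qed
  then have "(\<lambda>i\<in>sort_code \<U> ` \<U>. \<lambda>d\<in>cosets_over G (tgt G g) (sort_of \<U> i). comp G (inverse_of G g) ` d) =
      (\<lambda>i\<in>sort_code \<U> ` \<U>. \<lambda>d\<in>universe (fiber M (tgt G g)) i.
        inv_into (universe (fiber M (src G g)) i) (snd (snd (\<Phi> g)) i) d)"
    using universe_fiber sort_of_in by (intro restrict_restrict_cong) (simp_all add: translation_def)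
  then show ?thesis
    using g by (simp add: translation_def Iso_def coset_language_def arr_simps)
qed

theorem translation_isomorphism:
  "topological_groupoid_isomorphism G (Iso (Obj G) L M) id \<Phi>"
  unfolding topological_groupoid_isomorphism_def
proof (intro conjI ballI)
  show "homeomorphic_map (Obj G) (Obj (Iso (Obj G) L M)) id" by (simp add: Iso_def)
  show "homeomorphic_map (Mor G) (Mor (Iso (Obj G) L M)) \<Phi>"
    using homeomorphic_translation by (simp add: Iso_def)
  show "case p of (g, k) \<Rightarrow> \<Phi> (comp G g k) = comp (Iso (Obj G) L M) (\<Phi> g) (\<Phi> k)"
    if "p \<in> composable G" for p
    using that translation_comp by (auto simp: composable_def)
qed (simp_all add: translation_unit translation_inverse, simp_all add: Iso_def translation_def)

end

section \<open>The representation theorem\<close>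

text \<open>A Lindelof argument.  For \<open>B\<close> in the base of the arrows, the sets of units of the open
  subgroupoids inside \<open>B\<close> are open; for each basic set \<open>N\<close> of objects contained in one of them,
  choose one such subgroupoid.\<close>

lemma (in open_topological_groupoid) countable_subgroupoid_base:
  assumes nA: "non_Archimedean G" and \<B>: "countable \<B>" "base_of (Mor G) \<B>"
    and \<X>: "countable \<X>" "base_of (Obj G) \<X>"
  obtains \<U> where "countable \<U>" "\<And>U. U \<in> \<U> \<Longrightarrow> subgroupoid G U \<and> openin (Mor G) U"
    "\<And>x N. x \<in> topspace (Obj G) \<Longrightarrow> openin (Mor G) N \<Longrightarrow> unit_of G x \<in> N \<Longrightarrow>
      \<exists>U\<in>\<U>. unit_of G x \<in> U \<and> U \<subseteq> N"
proof -
  define good where "good B N U \<longleftrightarrow> subgroupoid G U \<and> openin (Mor G) U \<and> U \<subseteq> B \<and> N \<subseteq> units_in G U"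
    for B N U
  define choice where "choice = (\<lambda>(B, N). SOME U. good B N U)"
  define \<U> where "\<U> = choice ` {(B, N) \<in> \<B> \<times> \<X>. \<exists>U. good B N U}"
  have choice: "good B N (choice (B, N))" if "\<exists>U. good B N U" for B N
    using someI_ex[OF that] by (simp add: choice_def)
  have "countable ({(B, N) \<in> \<B> \<times> \<X>. \<exists>U. good B N U})"
    by (rule countable_subset[of _ "\<B> \<times> \<X>"]) (use \<B> \<X> in auto)
  then have "countable \<U>" by (simp add: \<U>_def)
  moreover have "subgroupoid G U \<and> openin (Mor G) U" if "U \<in> \<U>" for U
    using that choice by (auto simp: \<U>_def good_def)
  moreover have "\<exists>U\<in>\<U>. unit_of G x \<in> U \<and> U \<subseteq> N"
    if x: "x \<in> topspace (Obj G)" "openin (Mor G) N" "unit_of G x \<in> N" for x N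
  proof -
    obtain B where B: "B \<in> \<B>" "unit_of G x \<in> B" "B \<subseteq> N" using \<B>(2) x unfolding base_of_def by blast
    obtain U where U: "openin (Mor G) U" "subgroupoid G U" "unit_of G x \<in> U" "U \<subseteq> B"
      using nA \<B>(2) B x(1) unfolding non_Archimedean_def base_of_def by meson
    have "openin (Obj G) (units_in G U)" "x \<in> units_in G U"
      using openin_units_in U x by (simp_all add: units_in_def)
    then obtain O' where O': "O' \<in> \<X>" "x \<in> O'" "O' \<subseteq> units_in G U" using \<X>(2) unfolding base_of_def by blast
    then have ex: "\<exists>U. good B O' U" using U by (auto simp: good_def)
    then have "choice (B, O') \<in> \<U>" using B O' by (auto simp: \<U>_def)
    moreover have "unit_of G x \<in> choice (B, O')" "choice (B, O') \<subseteq> N"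
      using choice[OF ex] O' B by (auto simp: good_def units_in_def)
    ultimately show ?thesis by blast
  qed
  ultimately show thesis by (rule that)
qed

theorem theorem1p4:
  fixes G :: "('o, 'm) groupoid"
  assumes "topological_groupoid G"
    and "open_groupoid G"
    and "non_Archimedean G"
    and "quasi_Polish_groupoid G \<or> Polish_groupoid G"
  shows "\<exists>(L :: (nat, nat, nat) language) (M :: (nat, nat, nat, 'o, 'm set) etale_struct) \<Phi>.
           countable_language L \<and>
           etale_structure (Obj G) L M \<and>
           second_countable_structure (Obj G) L M \<and>
           topological_groupoid_isomorphism G (Iso (Obj G) L M) id \<Phi>"
proof -
  have Obj: "countably_Choquet (Obj G)" "t0_space (Obj G)"
    and Mor: "countably_Choquet (Mor G)" "t0_space (Mor G)"
    using assms(4) quasi_Polish_imp_countably_Choquet Polish_imp_countably_Choquet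
    unfolding quasi_Polish_groupoid_def Polish_groupoid_def by blast+
  interpret open_topological_groupoid G
    using assms(1,2) by (simp add: open_topological_groupoid_def open_topological_groupoid_axioms_def open_groupoid_def)
  obtain \<X> where \<X>: "countable \<X>" "base_of (Obj G) \<X>"
    using Obj(1) unfolding countably_Choquet_def by (elim exE conjE) (rule that)
  obtain \<B> \<W> where \<B>: "countable \<B>" "base_of (Mor G) \<B>" and \<W>: "countable \<W>"
      "\<forall>(W, \<C>)\<in>\<W>. W \<subseteq> \<Union>\<C> \<and> (\<forall>C\<in>\<C>. openin (Mor G) C)"
    and conv: "\<forall>H :: nat \<Rightarrow> 'm set. decseq H \<and> (\<forall>n. H n \<in> \<B> \<and> H n \<noteq> {}) \<and>
           (\<forall>(W, \<C>)\<in>\<W>. (\<exists>n. H n \<subseteq> W) \<longrightarrow> (\<exists>n. \<exists>C\<in>\<C>. H n \<subseteq> C)) \<longrightarrow>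
           (\<exists>x. (\<forall>n. x \<in> H n) \<and> (\<forall>V. openin (Mor G) V \<and> x \<in> V \<longrightarrow> (\<exists>n. H n \<subseteq> V)))"
    using Mor(1) unfolding countably_Choquet_def by (elim exE conjE) (rule that)
  obtain \<U> where \<U>: "countable \<U>" "\<And>U. U \<in> \<U> \<Longrightarrow> subgroupoid G U \<and> openin (Mor G) U"
    "\<And>x N. x \<in> topspace (Obj G) \<Longrightarrow> openin (Mor G) N \<Longrightarrow> unit_of G x \<in> N \<Longrightarrow>
      \<exists>U\<in>\<U>. unit_of G x \<in> U \<and> U \<subseteq> N"
    using countable_subgroupoid_base[OF assms(3) \<B> \<X>] by blast
  interpret coset_geometry G \<U> \<B> \<W> \<X>
  proof
    show "W \<subseteq> \<Union>\<C>" if "(W, \<C>) \<in> \<W>" for W \<C> using bspec[OF \<W>(2) that] by simp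
    show "openin (Mor G) C" if "(W, \<C>) \<in> \<W>" "C \<in> \<C>" for W \<C> C using bspec[OF \<W>(2) that(1)] that(2) by simp
    show "\<exists>g. (\<forall>n. g \<in> H n) \<and> (\<forall>V. openin (Mor G) V \<and> g \<in> V \<longrightarrow> (\<exists>n. H n \<subseteq> V))"
      if "decseq H" "\<And>n. H n \<in> \<B>" "\<And>n. H n \<noteq> {}"
        and *: "\<And>W \<C>. (W, \<C>) \<in> \<W> \<Longrightarrow> \<exists>n. H n \<subseteq> W \<Longrightarrow> \<exists>n. \<exists>C\<in>\<C>. H n \<subseteq> C" for H :: "nat \<Rightarrow> 'm set"
    proof -
      have "\<forall>(W, \<C>)\<in>\<W>. (\<exists>n. H n \<subseteq> W) \<longrightarrow> (\<exists>n. \<exists>C\<in>\<C>. H n \<subseteq> C)"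
      proof
        fix p assume "p \<in> \<W>"
        then show "case p of (W, \<C>) \<Rightarrow> (\<exists>n. H n \<subseteq> W) \<longrightarrow> (\<exists>n. \<exists>C\<in>\<C>. H n \<subseteq> C)"
          using *[of "fst p" "snd p"] by (simp add: case_prod_unfold)
      qed
      then show ?thesis using conv that(1-3) by simp
    qed
  qed (use \<U> \<B> \<X> \<W> Obj Mor in auto)
  show ?thesis
    using countable_coset_language etale_coset_structure second_countable_coset_structure translation_isomorphism
    by blast
qed

end
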